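(* Let $E$ and $F$ be finite directed graphs, with Toeplitz algebras $\mathcal{T}C^*(E)$ and $\mathcal{T}C^*(F)$. Let $\gamma^E$ be the gauge action of $\mathbb{T}$ on $\mathcal{T}C^*(E)$, let $M_E := \operatorname{span}\{q_v : v \in E^0\} \subseteq \mathcal{T}C^*(E)$, and let $\kappa^E$ be the generalised gauge action of $\mathbb{T}^{E^0}$ on $\mathcal{T}C^*(E)$ given by $\kappa^E_z(t_e) = z_{s(e)} t_e$ for all $e \in E^1$. Let $\gamma^F$, $M_F$ and $\kappa^F$ be the corresponding objects for $\mathcal{T}C^*(F)$. (1) There is an isomorphism $\mathcal{T}C^*(E) \cong \mathcal{T}C^*(F)$ that intertwines $\gamma^E$ and $\gamma^F$ and carries $M_E$ to $M_F$ if and only if $E \cong F$ as directed graphs. (2) Suppose that $E$ and $F$ have no sinks. Then there is an isomorphism $\mathcal{T}C^*(E) \cong \mathcal{T}C^*(F)$ that intertwines the generalised gauge actions $\kappa^E$ and $\kappa^F$ if and only if $E \cong F$ as directed graphs.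
   Context: A directed graph $E = (E^0, E^1, r, s)$ consists of a vertex set $E^0$, an edge set $E^1$ and range and source maps $r, s : E^1 \to E^0$; it is finite if $E^0$ and $E^1$ are finite. A sink is a vertex $v$ with $s^{-1}(v) = \emptyset$. An isomorphism of directed graphs $E \cong F$ is a pair of bijections $E^0 \to F^0$, $E^1 \to F^1$ compatible with the range and source maps. The Toeplitz algebra $\mathcal{T}C^*(E)$ of a finite directed graph $E$ is the universal $C^*$-algebra generated by mutually orthogonal projections $\{q_v : v \in E^0\}$ and partial isometries $\{t_e : e \in E^1\}$ such that $t_e^* t_e = q_{s(e)}$ for all $e \in E^1$ and $q_v \ge \sum_{r(e) = v} t_e t_e^*$ for all $v \in E^0$. The gauge action $\gamma^E : \mathbb{T} \to \operatorname{Aut}(\mathcal{T}C^*(E))$ is determined by $\gamma^E_z(q_v) = q_v$ and $\gamma^E_z(t_e) = z t_e$. The generalised gauge action $\kappa^E : \mathbb{T}^{E^0} \to \operatorname{Aut}(\mathcal{T}C^*(E))$ is determined by $\kappa^E_z(q_v) = q_v$ and $\kappa^E_z(t_e) = z_{s(e)} t_e$. An isomorphism $\rho : \mathcal{T}C^*(E) \to \mathcal{T}C^*(F)$ of $C^*$-algebras intertwines $\gamma^E$ and $\gamma^F$ if $\rho \circ \gamma^E_z = \gamma^F_z \circ \rho$ for all $z \in \mathbb{T}$. It carries $M_E$ to $M_F$ if $\rho(M_E) = M_F$. It intertwines the generalised gauge actions $\kappa^E$ and $\kappa^F$ if there is a bijection $\varphi : E^0 \to F^0$ such that the induced homomorphism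 $\varphi^* : \mathbb{T}^{E^0} \to \mathbb{T}^{F^0}$, $\varphi^*(z)_{\varphi(v)} = z_v$, satisfies $\rho \circ \kappa^E_z = \kappa^F_{\varphi^*(z)} \circ \rho$ for all $z \in \mathbb{T}^{E^0}$. *)

theory Defs
  imports Complex_Main "HOL-Algebra.Module" "Graph_Theory.Digraph_Isomorphism"
begin

section \<open>C*-algebras\<close>

text \<open>
  A C*-algebra need not be unital. The field \<open>one\<close>, inherited from the ring record, is unused:
  no axiom and no definition below refers to it.
\<close>

record 'a cstar = "(complex, 'a) module" +
  adj :: "'a \<Rightarrow> 'a"
  nrm :: "'a \<Rightarrow> real"

locale cstar_algebra = abelian_group A for A :: "'a cstar" (structure) +
  assumes smult_closed: "x \<in> carrier A \<Longrightarrow> c \<odot> x \<in> carrier A"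
    and smult_l_distr: "x \<in> carrier A \<Longrightarrow> (c + d) \<odot> x = c \<odot> x \<oplus> d \<odot> x"
    and smult_r_distr: "x \<in> carrier A \<Longrightarrow> y \<in> carrier A \<Longrightarrow> c \<odot> (x \<oplus> y) = c \<odot> x \<oplus> c \<odot> y"
    and smult_assoc: "x \<in> carrier A \<Longrightarrow> (c * d) \<odot> x = c \<odot> (d \<odot> x)"
    and smult_one: "x \<in> carrier A \<Longrightarrow> 1 \<odot> x = x"
    and mult_closed: "x \<in> carrier A \<Longrightarrow> y \<in> carrier A \<Longrightarrow> x \<otimes> y \<in> carrier A"
    and mult_assoc: "x \<in> carrier A \<Longrightarrow> y \<in> carrier A \<Longrightarrow> z \<in> carrier A
      \<Longrightarrow> (x \<otimes> y) \<otimes> z = x \<otimes> (y \<otimes> z)"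
    and mult_l_distr: "x \<in> carrier A \<Longrightarrow> y \<in> carrier A \<Longrightarrow> z \<in> carrier A
      \<Longrightarrow> (x \<oplus> y) \<otimes> z = x \<otimes> z \<oplus> y \<otimes> z"
    and mult_r_distr: "x \<in> carrier A \<Longrightarrow> y \<in> carrier A \<Longrightarrow> z \<in> carrier A
      \<Longrightarrow> z \<otimes> (x \<oplus> y) = z \<otimes> x \<oplus> z \<otimes> y"
    and smult_mult_left: "x \<in> carrier A \<Longrightarrow> y \<in> carrier A \<Longrightarrow> (c \<odot> x) \<otimes> y = c \<odot> (x \<otimes> y)"
    and smult_mult_right: "x \<in> carrier A \<Longrightarrow> y \<in> carrier A \<Longrightarrow> x \<otimes> (c \<odot> y) = c \<odot> (x \<otimes> y)"
    and adj_closed: "x \<in> carrier A \<Longrightarrow> adj A x \<in> carrier A"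
    and adj_add: "x \<in> carrier A \<Longrightarrow> y \<in> carrier A \<Longrightarrow> adj A (x \<oplus> y) = adj A x \<oplus> adj A y"
    and adj_smult: "x \<in> carrier A \<Longrightarrow> adj A (c \<odot> x) = cnj c \<odot> adj A x"
    and adj_mult: "x \<in> carrier A \<Longrightarrow> y \<in> carrier A \<Longrightarrow> adj A (x \<otimes> y) = adj A y \<otimes> adj A x"
    and adj_adj: "x \<in> carrier A \<Longrightarrow> adj A (adj A x) = x"
    and nrm_eq_zero: "x \<in> carrier A \<Longrightarrow> nrm A x = 0 \<longleftrightarrow> x = \<zero>"
    and nrm_triangle: "x \<in> carrier A \<Longrightarrow> y \<in> carrier A \<Longrightarrow> nrm A (x \<oplus> y) \<le> nrm A x + nrm A y"
    and nrm_smult: "x \<in> carrier A \<Longrightarrow> nrm A (c \<odot> x) = cmod c * nrm A x"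
    and nrm_mult: "x \<in> carrier A \<Longrightarrow> y \<in> carrier A \<Longrightarrow> nrm A (x \<otimes> y) \<le> nrm A x * nrm A y"
    and cstar_identity: "x \<in> carrier A \<Longrightarrow> nrm A (adj A x \<otimes> x) = (nrm A x)\<^sup>2"
    and complete: "(\<And>n. X n \<in> carrier A)
      \<Longrightarrow> (\<And>e. e > 0 \<Longrightarrow> \<exists>N. \<forall>m\<ge>N. \<forall>n\<ge>N. nrm A (X m \<ominus> X n) < e)
      \<Longrightarrow> \<exists>x\<in>carrier A. (\<lambda>n. nrm A (X n \<ominus> x)) \<longlonglongrightarrow> 0"

definition cstar_subalgebra :: "'a cstar \<Rightarrow> 'a set \<Rightarrow> bool" where
  "cstar_subalgebra A S \<longleftrightarrow> S \<subseteq> carrier A \<and> \<zero>\<^bsub>A\<^esub> \<in> S \<and>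
    (\<forall>x\<in>S. \<forall>y\<in>S. x \<oplus>\<^bsub>A\<^esub> y \<in> S \<and> x \<otimes>\<^bsub>A\<^esub> y \<in> S) \<and>
    (\<forall>x\<in>S. adj A x \<in> S \<and> (\<forall>c. c \<odot>\<^bsub>A\<^esub> x \<in> S)) \<and>
    (\<forall>X x. (\<forall>n. X n \<in> S) \<longrightarrow> x \<in> carrier A \<longrightarrow> (\<lambda>n. nrm A (X n \<ominus>\<^bsub>A\<^esub> x)) \<longlonglongrightarrow> 0 \<longrightarrow> x \<in> S)"

definition cstar_generated_by :: "'a cstar \<Rightarrow> 'a set \<Rightarrow> bool" where
  "cstar_generated_by A G \<longleftrightarrow> G \<subseteq> carrier A \<and>
    (\<forall>S. cstar_subalgebra A S \<longrightarrow> G \<subseteq> S \<longrightarrow> S = carrier A)"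

definition cstar_le :: "'a cstar \<Rightarrow> 'a \<Rightarrow> 'a \<Rightarrow> bool" where
  "cstar_le A x y \<longleftrightarrow> (\<exists>b\<in>carrier A. y \<ominus>\<^bsub>A\<^esub> x = adj A b \<otimes>\<^bsub>A\<^esub> b)"

definition projection :: "'a cstar \<Rightarrow> 'a \<Rightarrow> bool" where
  "projection A p \<longleftrightarrow> p \<in> carrier A \<and> adj A p = p \<and> p \<otimes>\<^bsub>A\<^esub> p = p"

definition partial_isometry :: "'a cstar \<Rightarrow> 'a \<Rightarrow> bool" where
  "partial_isometry A t \<longleftrightarrow> t \<in> carrier A \<and> t \<otimes>\<^bsub>A\<^esub> adj A t \<otimes>\<^bsub>A\<^esub> t = t"

definition star_hom :: "'a cstar \<Rightarrow> 'b cstar \<Rightarrow> ('a \<Rightarrow> 'b) \<Rightarrow> bool" where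
  "star_hom A B f \<longleftrightarrow> f \<in> carrier A \<rightarrow> carrier B \<and>
    (\<forall>x\<in>carrier A. \<forall>y\<in>carrier A. f (x \<oplus>\<^bsub>A\<^esub> y) = f x \<oplus>\<^bsub>B\<^esub> f y) \<and>
    (\<forall>x\<in>carrier A. \<forall>y\<in>carrier A. f (x \<otimes>\<^bsub>A\<^esub> y) = f x \<otimes>\<^bsub>B\<^esub> f y) \<and>
    (\<forall>c. \<forall>x\<in>carrier A. f (c \<odot>\<^bsub>A\<^esub> x) = c \<odot>\<^bsub>B\<^esub> f x) \<and>
    (\<forall>x\<in>carrier A. f (adj A x) = adj B (f x))"

definition star_iso :: "'a cstar \<Rightarrow> 'b cstar \<Rightarrow> ('a \<Rightarrow> 'b) \<Rightarrow> bool" where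
  "star_iso A B f \<longleftrightarrow> star_hom A B f \<and> bij_betw f (carrier A) (carrier B)"


section \<open>Toeplitz algebras of finite directed graphs\<close>

text \<open>The source map is \<^const>\<open>tail\<close> and the range map is \<^const>\<open>head\<close>.\<close>

definition no_sinks :: "('v, 'e) pre_digraph \<Rightarrow> bool" where
  "no_sinks E \<longleftrightarrow> (\<forall>v\<in>verts E. out_arcs E v \<noteq> {})"

definition toeplitz_family ::
  "('v, 'e) pre_digraph \<Rightarrow> 'a cstar \<Rightarrow> ('v \<Rightarrow> 'a) \<Rightarrow> ('e \<Rightarrow> 'a) \<Rightarrow> bool" where
  "toeplitz_family E A q t \<longleftrightarrow>
    (\<forall>v\<in>verts E. projection A (q v)) \<and>
    (\<forall>v\<in>verts E. \<forall>w\<in>verts E. v \<noteq> w \<longrightarrow> q v \<otimes>\<^bsub>A\<^esub> q w = \<zero>\<^bsub>A\<^esub>) \<and>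
    (\<forall>e\<in>arcs E. partial_isometry A (t e)) \<and>
    (\<forall>e\<in>arcs E. adj A (t e) \<otimes>\<^bsub>A\<^esub> t e = q (tail E e)) \<and>
    (\<forall>v\<in>verts E. cstar_le A (\<Oplus>\<^bsub>A\<^esub>e\<in>in_arcs E v. t e \<otimes>\<^bsub>A\<^esub> adj A (t e)) (q v))"

text \<open>
  \<open>toeplitz_algebra E A q t\<close>: the C*-algebra \<open>A\<close>, with generators \<open>q\<close> and \<open>t\<close>, is a universal
  C*-algebra for Toeplitz \<open>E\<close>-families. A formula cannot quantify over all types, so the universal
  property is tested on all C*-algebras whose underlying set is a set of infinite complex matrices.
  Nothing is lost: a C*-algebra generated by a finite family is separable, so it has at most
  continuum many elements and is isomorphic to one of this form, and only the C*-subalgebra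
  generated by a family matters for the homomorphism that it induces. That homomorphism is unique
  because \<open>q\<close> and \<open>t\<close> generate \<open>A\<close>.
\<close>

definition toeplitz_algebra ::
  "('v, 'e) pre_digraph \<Rightarrow> 'a cstar \<Rightarrow> ('v \<Rightarrow> 'a) \<Rightarrow> ('e \<Rightarrow> 'a) \<Rightarrow> bool" where
  "toeplitz_algebra E A q t \<longleftrightarrow>
    cstar_algebra A \<and> toeplitz_family E A q t \<and>
    cstar_generated_by A (q ` verts E \<union> t ` arcs E) \<and>
    (\<forall>(B :: (nat \<Rightarrow> nat \<Rightarrow> complex) cstar) Q T.
      cstar_algebra B \<longrightarrow> toeplitz_family E B Q T \<longrightarrow>
      (\<exists>f. star_hom A B f \<and> (\<forall>v\<in>verts E. f (q v) = Q v) \<and> (\<forall>e\<in>arcs E. f (t e) = T e)))"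

text \<open>
  The automorphism fixing every \<open>q v\<close> and multiplying \<open>t e\<close> by the scalar \<open>c e\<close>. For \<open>c\<close> with
  values in the unit circle it exists by the universal property; extensionality makes it unique as
  a total function.
\<close>

definition scaling_automorphism ::
  "('v, 'e) pre_digraph \<Rightarrow> 'a cstar \<Rightarrow> ('v \<Rightarrow> 'a) \<Rightarrow> ('e \<Rightarrow> 'a) \<Rightarrow> ('e \<Rightarrow> complex) \<Rightarrow> 'a \<Rightarrow> 'a" where
  "scaling_automorphism E A q t c = (THE \<alpha>. star_iso A A \<alpha> \<and> \<alpha> \<in> extensional (carrier A) \<and>
    (\<forall>v\<in>verts E. \<alpha> (q v) = q v) \<and> (\<forall>e\<in>arcs E. \<alpha> (t e) = c e \<odot>\<^bsub>A\<^esub> t e))"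

definition gauge_action ::
  "('v, 'e) pre_digraph \<Rightarrow> 'a cstar \<Rightarrow> ('v \<Rightarrow> 'a) \<Rightarrow> ('e \<Rightarrow> 'a) \<Rightarrow> complex \<Rightarrow> 'a \<Rightarrow> 'a" where
  "gauge_action E A q t z = scaling_automorphism E A q t (\<lambda>e. z)"

definition gen_gauge_action ::
  "('v, 'e) pre_digraph \<Rightarrow> 'a cstar \<Rightarrow> ('v \<Rightarrow> 'a) \<Rightarrow> ('e \<Rightarrow> 'a) \<Rightarrow> ('v \<Rightarrow> complex) \<Rightarrow> 'a \<Rightarrow> 'a" where
  "gen_gauge_action E A q t z = scaling_automorphism E A q t (\<lambda>e. z (tail E e))"

definition circle :: "complex set" where
  "circle = {z. cmod z = 1}"

definition vertex_span :: "('v, 'e) pre_digraph \<Rightarrow> 'a cstar \<Rightarrow> ('v \<Rightarrow> 'a) \<Rightarrow> 'a set" where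
  "vertex_span E A q = {\<Oplus>\<^bsub>A\<^esub>v\<in>verts E. c v \<odot>\<^bsub>A\<^esub> q v | c. True}"

definition intertwines_gauge ::
  "('v, 'e) pre_digraph \<Rightarrow> 'a cstar \<Rightarrow> ('v \<Rightarrow> 'a) \<Rightarrow> ('e \<Rightarrow> 'a) \<Rightarrow>
   ('w, 'f) pre_digraph \<Rightarrow> 'b cstar \<Rightarrow> ('w \<Rightarrow> 'b) \<Rightarrow> ('f \<Rightarrow> 'b) \<Rightarrow> ('a \<Rightarrow> 'b) \<Rightarrow> bool" where
  "intertwines_gauge E A qE tE F B qF tF \<rho> \<longleftrightarrow>
    (\<forall>z\<in>circle. \<forall>x\<in>carrier A.
      \<rho> (gauge_action E A qE tE z x) = gauge_action F B qF tF z (\<rho> x))"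

definition induced_torus_map ::
  "('v, 'e) pre_digraph \<Rightarrow> ('w, 'f) pre_digraph \<Rightarrow> ('v \<Rightarrow> 'w) \<Rightarrow> ('v \<Rightarrow> complex) \<Rightarrow> 'w \<Rightarrow> complex" where
  "induced_torus_map E F \<phi> z = (\<lambda>w\<in>verts F. z (inv_into (verts E) \<phi> w))"

definition intertwines_gen_gauge ::
  "('v, 'e) pre_digraph \<Rightarrow> 'a cstar \<Rightarrow> ('v \<Rightarrow> 'a) \<Rightarrow> ('e \<Rightarrow> 'a) \<Rightarrow>
   ('w, 'f) pre_digraph \<Rightarrow> 'b cstar \<Rightarrow> ('w \<Rightarrow> 'b) \<Rightarrow> ('f \<Rightarrow> 'b) \<Rightarrow> ('a \<Rightarrow> 'b) \<Rightarrow> bool" where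
  "intertwines_gen_gauge E A qE tE F B qF tF \<rho> \<longleftrightarrow>
    (\<exists>\<phi>. bij_betw \<phi> (verts E) (verts F) \<and>
      (\<forall>z \<in> verts E \<rightarrow>\<^sub>E circle. \<forall>x\<in>carrier A.
        \<rho> (gen_gauge_action E A qE tE z x) =
        gen_gauge_action F B qF tF (induced_torus_map E F \<phi> z) (\<rho> x)))"

end

theory Submission
  imports Defs "HOL-Analysis.Bounded_Linear_Function" "HOL-Analysis.Infinite_Sum"
begin

text \<open>Write \<open>gap\<^sub>v\<close> for the projection \<open>q\<^sub>v - \<Sum>\<^bsub>r(e) = v\<^esub> t\<^sub>e t\<^sub>e\<^sup>*\<close>. It is not zero, because it is not zero in a
  concrete family of operators on a Hilbert space. The elements \<open>t\<^sub>\<mu> gap\<^sub>v\<close>, where \<open>\<mu>\<close> runs over the paths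
  that leave \<open>v\<close>, satisfy \<open>(t\<^sub>\<mu> gap\<^sub>v)\<^sup>* (t\<^sub>\<nu> gap\<^sub>v) = \<delta>\<^bsub>\<mu>\<nu>\<^esub> gap\<^sub>v\<close> and span the left ideal of \<open>gap\<^sub>v\<close>. Hence an
  element of that ideal is determined by scalar coefficients, indexed by paths, and an element that is
  homogeneous for a gauge action has non-zero coefficients only at paths of the same degree.

  Consequently elements of degree \<open>-1\<close> kill the gap projections, and this characterizes the sum of the gap
  projections. So an isomorphism that respects the gauge actions maps gap projections to gap projections
  as soon as it matches them by vertices, and the matrix of its coefficients is unitary between finite
  blocks of paths of equal degree. Equating the sizes of the blocks counts edges. For the generalised gauge
  action a block of paths of length two determines the number of edges from \<open>w\<close> to \<open>v\<close> times the number of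
  edges that leave \<open>v\<close>, which is not zero if there are no sinks.

  That the range projections of a Toeplitz family are orthogonal, and that star homomorphisms are
  contractive, needs some C*-algebra theory. Both rest on the fact that \<open>b\<^sup>2 + k\<^sup>2 = 1\<close> for commuting self-adjoint
  \<open>b\<close> and \<open>k\<close> makes \<open>b + i k\<close> unitary, together with the square root of \<open>1 - c\<close> for \<open>\<parallel>c\<parallel> \<le> 1\<close>.\<close>

section \<open>Limits and square roots in C*-algebras\<close>

text \<open>The order relation in the definition of a Toeplitz family says only that a difference
  has the form \<open>b\<^sup>* b\<close>. To split it into orthogonality statements one must know
  that a vanishing sum of elements \<open>x\<^sup>* x\<close> vanishes term by term, which is the
  positivity of \<open>x\<^sup>* x\<close>; the argument takes place in the unitization, because the
  algebra need not have a unit. Contractivity makes homomorphisms continuous, hence determined by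
  their values on generators; this gives the gauge actions, introduced by a definite description, a
  meaning.

  The generalised degree of a path records only the sources of its edges, so the end of its last
  edge stays invisible, and nothing says that vertex projections go to vertex projections. The end
  of an edge shows up as the source of the next edge, whence the paths of length two. At a sink the
  coordinate of the torus acts trivially. An edge \<open>e\<close> that leaves \<open>v\<close>
  writes \<open>gap\<^sub>v\<close> as \<open>x\<^sup>* x\<close> for the homogeneous element
  \<open>x = t\<^sub>e gap\<^sub>v\<close>, and this ties the gap of \<open>v\<close> to that of the
  matched vertex.\<close>

context cstar_algebra
begin

section \<open>Algebraic rules in a star algebra without a unit\<close>

lemma mult_zero_left [simp]: "x \<in> carrier A \<Longrightarrow> \<zero> \<otimes> x = \<zero>"
  using mult_l_distr[of \<zero> \<zero> x] add.l_cancel_one' mult_closed by (metis l_zero zero_closed)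

lemma mult_zero_right [simp]: "x \<in> carrier A \<Longrightarrow> x \<otimes> \<zero> = \<zero>"
  using mult_r_distr[of \<zero> \<zero> x] add.l_cancel_one' mult_closed by (metis l_zero zero_closed)

lemma smult_zero_right [simp]: "c \<odot> \<zero> = \<zero>"
  using smult_r_distr[of \<zero> \<zero> c] smult_closed[of \<zero> c] add.l_cancel_one' by (metis l_zero zero_closed)

lemma smult_zero_left [simp]: "x \<in> carrier A \<Longrightarrow> 0 \<odot> x = \<zero>"
  using smult_l_distr[of x 0 0] smult_closed[of x 0] add.l_cancel_one' by (metis add_0)

lemma mult_minus_left: "x \<in> carrier A \<Longrightarrow> y \<in> carrier A \<Longrightarrow> (\<ominus> x) \<otimes> y = \<ominus> (x \<otimes> y)"
  using mult_l_distr[of x "\<ominus> x" y] by (metis a_inv_closed minus_equality mult_closed mult_zero_left l_neg mult_l_distr)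

lemma mult_minus_right: "x \<in> carrier A \<Longrightarrow> y \<in> carrier A \<Longrightarrow> x \<otimes> (\<ominus> y) = \<ominus> (x \<otimes> y)"
  by (metis a_inv_closed minus_equality mult_closed mult_zero_right l_neg mult_r_distr)

lemma smult_minus_right: "x \<in> carrier A \<Longrightarrow> c \<odot> (\<ominus> x) = \<ominus> (c \<odot> x)"
  by (metis a_inv_closed minus_equality smult_closed smult_zero_right l_neg smult_r_distr)

lemma smult_minus_left: "x \<in> carrier A \<Longrightarrow> (- c) \<odot> x = \<ominus> (c \<odot> x)"
  by (metis add.left_inverse minus_equality smult_closed smult_l_distr smult_zero_left)

lemma adj_zero [simp]: "adj A \<zero> = \<zero>"
  using adj_add[of \<zero> \<zero>] adj_closed[of \<zero>] add.l_cancel_one' by (metis l_zero zero_closed)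

lemma adj_minus: "x \<in> carrier A \<Longrightarrow> adj A (\<ominus> x) = \<ominus> (adj A x)"
  by (metis a_inv_closed minus_equality adj_closed adj_zero l_neg adj_add)

text \<open>These rules extend the method \<open>algebra\<close> to star algebras without a unit.
  Nested scalars are merged by the reversed \<open>smult_assoc\<close>, but sums of scalars are not
  expanded, so steps that rest on \<open>smult_l_distr\<close> are done by hand.\<close>

lemmas cstar_simprules
  [algebra cstar_algebra "zero A" "add A" "a_inv A" "a_minus A" "monoid.mult A"] =
  a_closed zero_closed a_inv_closed minus_closed mult_closed adj_closed smult_closed
  a_assoc l_zero l_neg a_comm mult_assoc mult_l_distr minus_eq
  r_zero r_neg r_neg2 r_neg1 minus_add minus_minus minus_zero
  a_lcomm mult_r_distr mult_zero_left mult_zero_right mult_minus_left mult_minus_right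
  adj_zero adj_minus adj_add adj_mult adj_adj
  smult_zero_right smult_minus_right smult_r_distr smult_mult_left smult_mult_right
  smult_one smult_assoc [symmetric] adj_smult

lemma minus_self: "x \<in> carrier A \<Longrightarrow> x \<ominus> x = \<zero>"
  by (simp add: minus_eq r_neg)

lemma minus_zero_right: "x \<in> carrier A \<Longrightarrow> x \<ominus> \<zero> = x"
  by (simp add: minus_eq minus_zero)

lemma minus_eq_zeroD: "x \<in> carrier A \<Longrightarrow> y \<in> carrier A \<Longrightarrow> x \<ominus> y = \<zero> \<Longrightarrow> x = y"
  by (metis add.inv_inv add.inv_equality minus_eq add.inv_closed a_comm minus_minus)

lemma nrm_zero [simp]: "nrm A \<zero> = 0"
  by (simp add: nrm_eq_zero)

lemma nrm_minus: "x \<in> carrier A \<Longrightarrow> nrm A (\<ominus> x) = nrm A x"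
  using nrm_smult[of x "-1"] by (simp add: smult_minus_left smult_one)

text \<open>Nonnegativity is not an axiom of the norm; it comes from the triangle inequality for
  \<open>x\<close> and \<open>\<ominus> x\<close>, whose norms agree.\<close>

lemma nrm_nonneg: "x \<in> carrier A \<Longrightarrow> 0 \<le> nrm A x"
  using nrm_triangle[of x "\<ominus> x"] by (simp add: nrm_minus r_neg)

lemma nrm_minus_commute: "x \<in> carrier A \<Longrightarrow> y \<in> carrier A \<Longrightarrow> nrm A (x \<ominus> y) = nrm A (y \<ominus> x)"
  by (subst nrm_minus [symmetric], simp) (rule arg_cong[where f = "nrm A"], algebra)

lemma nrm_triangle_via:
  assumes "x \<in> carrier A" "y \<in> carrier A" "z \<in> carrier A"
  shows "nrm A (x \<ominus> z) \<le> nrm A (x \<ominus> y) + nrm A (y \<ominus> z)"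
proof -
  have "x \<ominus> z = (x \<ominus> y) \<oplus> (y \<ominus> z)" using assms by algebra
  then show ?thesis using nrm_triangle[of "x \<ominus> y" "y \<ominus> z"] assms by simp
qed

lemma nrm_le_via: "x \<in> carrier A \<Longrightarrow> y \<in> carrier A \<Longrightarrow> nrm A x \<le> nrm A (x \<ominus> y) + nrm A y"
  using nrm_triangle_via[of x y \<zero>] by (simp add: minus_zero_right)

text \<open>The square of the norm of \<open>y\<close> is the norm of \<open>y\<^sup>* y\<close>,
  hence at most the product of the norms of \<open>y\<^sup>*\<close> and \<open>y\<close>.
  Cancelling one factor gives one inequality, and exchanging \<open>y\<close> with its adjoint gives
  the other.\<close>

lemma nrm_adj: 
  assumes "x \<in> carrier A" shows "nrm A (adj A x) = nrm A x"
proof -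
  have le: "nrm A y \<le> nrm A (adj A y)" if y: "y \<in> carrier A" for y
  proof (cases "nrm A y = 0")
    case True then show ?thesis using nrm_nonneg[OF adj_closed[OF y]] by simp
  next
    case False
    have "nrm A y * nrm A y \<le> nrm A (adj A y) * nrm A y"
      using cstar_identity[OF y] nrm_mult[OF adj_closed[OF y] y] by (simp add: power2_eq_square)
    then show ?thesis using False nrm_nonneg[OF y] by simp
  qed
  show ?thesis using le[OF assms] le[OF adj_closed[OF assms]] adj_adj[OF assms] by simp
qed

lemma nrm_self_adj: "x \<in> carrier A \<Longrightarrow> adj A x = x \<Longrightarrow> nrm A (x \<otimes> x) = (nrm A x)\<^sup>2"
  using cstar_identity[of x] by simp

lemma eq_if_nrm_diff: "x \<in> carrier A \<Longrightarrow> y \<in> carrier A \<Longrightarrow> nrm A (x \<ominus> y) = 0 \<Longrightarrow> x = y"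
  by (simp add: nrm_eq_zero minus_eq_zeroD)

lemma adj_mult_eq_zero: "x \<in> carrier A \<Longrightarrow> adj A x \<otimes> x = \<zero> \<Longrightarrow> x = \<zero>"
  using cstar_identity[of x] by (simp add: nrm_eq_zero)

lemma finsum_closed': "(\<And>i. i \<in> I \<Longrightarrow> f i \<in> carrier A) \<Longrightarrow> finsum A f I \<in> carrier A"
  by (rule finsum_closed) auto

lemma finsum_additive:
  assumes "finite I" "\<And>i. i \<in> I \<Longrightarrow> f i \<in> carrier A"
    and "\<And>x. x \<in> carrier A \<Longrightarrow> h x \<in> carrier B" "abelian_group B"
    and "\<And>x y. x \<in> carrier A \<Longrightarrow> y \<in> carrier A \<Longrightarrow> h (x \<oplus> y) = h x \<oplus>\<^bsub>B\<^esub> h y"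
  shows "h (finsum A f I) = finsum B (\<lambda>i. h (f i)) I"
proof -
  interpret B: abelian_group B by fact
  have z: "h \<zero> = \<zero>\<^bsub>B\<^esub>" using assms(5)[of \<zero> \<zero>] assms(3)[of \<zero>] by (metis B.add.l_cancel_one' l_zero zero_closed)
  show ?thesis using assms(1,2)
  proof (induction I rule: finite_induct)
    case empty then show ?case by (simp add: z)
  next
    case (insert i I)
    then show ?case
      using assms(3,5) by (simp add: Pi_def finsum_closed')
  qed
qed

section \<open>Convergence in norm\<close>

definition clim :: "(nat \<Rightarrow> 'a) \<Rightarrow> 'a \<Rightarrow> bool" where
  "clim X x \<longleftrightarrow> (\<forall>n. X n \<in> carrier A) \<and> x \<in> carrier A \<and> (\<lambda>n. nrm A (X n \<ominus> x)) \<longlonglongrightarrow> 0"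

lemma climD: "clim X x \<Longrightarrow> X n \<in> carrier A" "clim X x \<Longrightarrow> x \<in> carrier A"
  by (auto simp: clim_def)

lemma clim_const: "x \<in> carrier A \<Longrightarrow> clim (\<lambda>n. x) x"
  by (simp add: clim_def minus_self)

lemma climI_le:
  assumes "\<And>n. X n \<in> carrier A" "x \<in> carrier A" "\<And>n. nrm A (X n \<ominus> x) \<le> u n" "u \<longlonglongrightarrow> 0"
  shows "clim X x"
  unfolding clim_def using assms
  by (auto intro!: tendsto_sandwich[OF _ _ tendsto_const assms(4)] simp: nrm_nonneg)

lemma clim_unique:
  assumes "clim X x" "clim X y" shows "x = y"
proof -
  note c = climD[OF assms(1)] climD[OF assms(2)]
  have "(\<lambda>n. nrm A (X n \<ominus> x) + nrm A (X n \<ominus> y)) \<longlonglongrightarrow> 0 + 0"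
    using assms unfolding clim_def by (intro tendsto_add) auto
  moreover have "nrm A (x \<ominus> y) \<le> nrm A (X n \<ominus> x) + nrm A (X n \<ominus> y)" for n
    using nrm_triangle_via[of x "X n" y] nrm_minus_commute[of x "X n"] c by simp
  ultimately have "nrm A (x \<ominus> y) \<le> 0"
    by (intro tendsto_lowerbound[of _ 0 sequentially]) auto
  then show ?thesis using nrm_nonneg[of "x \<ominus> y"] c by (intro eq_if_nrm_diff) auto
qed

lemma clim_add:
  assumes "clim X x" "clim Y y" shows "clim (\<lambda>n. X n \<oplus> Y n) (x \<oplus> y)"
proof -
  note c = climD[OF assms(1)] climD[OF assms(2)]
  show ?thesis
  proof (rule climI_le)
    fix n
    have "X n \<oplus> Y n \<ominus> (x \<oplus> y) = (X n \<ominus> x) \<oplus> (Y n \<ominus> y)" using c(1,3)[of n] c(2,4) by algebra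
    then show "nrm A (X n \<oplus> Y n \<ominus> (x \<oplus> y)) \<le> nrm A (X n \<ominus> x) + nrm A (Y n \<ominus> y)"
      using nrm_triangle[of "X n \<ominus> x" "Y n \<ominus> y"] c by simp
  next
    show "(\<lambda>n. nrm A (X n \<ominus> x) + nrm A (Y n \<ominus> y)) \<longlonglongrightarrow> 0"
      using tendsto_add[of "\<lambda>n. nrm A (X n \<ominus> x)" 0 _ "\<lambda>n. nrm A (Y n \<ominus> y)" 0] assms by (simp add: clim_def)
  qed (use c in auto)
qed

lemma clim_smult:
  assumes "clim X x" shows "clim (\<lambda>n. c \<odot> X n) (c \<odot> x)"
proof -
  note c = climD[OF assms(1)]
  show ?thesis
  proof (rule climI_le)
    fix n
    have "c \<odot> X n \<ominus> c \<odot> x = c \<odot> (X n \<ominus> x)" using c(1)[of n] c(2) by algebra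
    then show "nrm A (c \<odot> X n \<ominus> c \<odot> x) \<le> cmod c * nrm A (X n \<ominus> x)"
      using nrm_smult[of "X n \<ominus> x" c] c by simp
  next
    show "(\<lambda>n. cmod c * nrm A (X n \<ominus> x)) \<longlonglongrightarrow> 0"
      using assms by (auto simp: clim_def intro: tendsto_mult_right_zero)
  qed (use c in \<open>auto simp: smult_closed\<close>)
qed

lemma clim_adj:
  assumes "clim X x" shows "clim (\<lambda>n. adj A (X n)) (adj A x)"
proof -
  note c = climD[OF assms(1)]
  have "nrm A (adj A (X n) \<ominus> adj A x) = nrm A (X n \<ominus> x)" for n
  proof -
    have "adj A (X n) \<ominus> adj A x = adj A (X n \<ominus> x)" using c(1)[of n] c(2) by algebra
    then show ?thesis using c by (simp add: nrm_adj)
  qed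
  then show ?thesis using assms by (simp add: clim_def adj_closed)
qed

lemma clim_mult:
  assumes "clim X x" "clim Y y" shows "clim (\<lambda>n. X n \<otimes> Y n) (x \<otimes> y)"
proof -
  note c = climD[OF assms(1)] climD[OF assms(2)]
  let ?u = "\<lambda>n. nrm A (X n \<ominus> x)" and ?v = "\<lambda>n. nrm A (Y n \<ominus> y)"
  show ?thesis
  proof (rule climI_le)
    fix n
    have "X n \<otimes> Y n \<ominus> x \<otimes> y = ((X n \<ominus> x) \<otimes> (Y n \<ominus> y) \<oplus> (X n \<ominus> x) \<otimes> y) \<oplus> x \<otimes> (Y n \<ominus> y)"
      using c(1,3)[of n] c(2,4) by algebra
    then have "nrm A (X n \<otimes> Y n \<ominus> x \<otimes> y) \<le> (nrm A ((X n \<ominus> x) \<otimes> (Y n \<ominus> y)) + nrm A ((X n \<ominus> x) \<otimes> y)) + nrm A (x \<otimes> (Y n \<ominus> y))"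
      using c by (auto intro!: order_trans[OF nrm_triangle] simp: mult_closed)
    also have "\<dots> \<le> (?u n * ?v n + ?u n * nrm A y) + nrm A x * ?v n"
      using c by (intro add_mono nrm_mult) auto
    finally show "nrm A (X n \<otimes> Y n \<ominus> x \<otimes> y) \<le> (?u n * ?v n + ?u n * nrm A y) + nrm A x * ?v n" .
  next
    have "?u \<longlonglongrightarrow> 0" "?v \<longlonglongrightarrow> 0" using assms by (auto simp: clim_def)
    then have "(\<lambda>n. (?u n * ?v n + ?u n * nrm A y) + nrm A x * ?v n) \<longlonglongrightarrow> (0 * 0 + 0 * nrm A y) + nrm A x * 0"
      by (intro tendsto_intros)
    then show "(\<lambda>n. (?u n * ?v n + ?u n * nrm A y) + nrm A x * ?v n) \<longlonglongrightarrow> 0" by simp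
  qed (use c in \<open>auto simp: mult_closed\<close>)
qed

lemma clim_nrm_le:
  assumes "clim X x" "\<And>n. nrm A (X n) \<le> r" shows "nrm A x \<le> r"
proof -
  note c = climD[OF assms(1)]
  have "(\<lambda>n. nrm A (X n \<ominus> x) + r) \<longlonglongrightarrow> 0 + r"
    using assms unfolding clim_def by (intro tendsto_intros) auto
  moreover have "nrm A x \<le> nrm A (X n \<ominus> x) + r" for n
    using nrm_le_via[of x "X n"] nrm_minus_commute[of x "X n"] c(1)[of n] c(2) assms(2)[of n] by simp
  ultimately show ?thesis
    by (intro tendsto_lowerbound[of _ r sequentially]) auto
qed

lemma clim_Suc: "clim X x \<Longrightarrow> clim (\<lambda>n. X (Suc n)) x"
  unfolding clim_def using LIMSEQ_Suc by blast

text \<open>The increments are dominated by those of a convergent real sequence \<open>s\<close>, so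
  differences telescope. A geometric rate would be too much to ask: the majorant of the square root
  iteration below approaches its limit 1 only at the rate \<open>1 / n\<close>.\<close>

lemma clim_if_summable_steps:
  assumes "\<And>n. X n \<in> carrier A" "\<And>n. nrm A (X (Suc n) \<ominus> X n) \<le> s (Suc n) - s n" "convergent s"
  shows "\<exists>x. clim X x"
proof -
  have step: "nrm A (X (m + k) \<ominus> X m) \<le> s (m + k) - s m" for m k
  proof (induction k)
    case (Suc k)
    then show ?case
      using nrm_triangle_via[of "X (m + Suc k)" "X (m + k)" "X m"] assms(1) assms(2)[of "m + k"] by simp
  qed (simp add: minus_self assms(1))
  have "\<exists>N. \<forall>m\<ge>N. \<forall>n\<ge>N. nrm A (X m \<ominus> X n) < e" if e: "e > 0" for e
  proof -
    have "Cauchy s" using assms(3) by (rule convergent_Cauchy)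
    then obtain N where N: "\<And>m n. m \<ge> N \<Longrightarrow> n \<ge> N \<Longrightarrow> \<bar>s m - s n\<bar> < e"
      using e unfolding Cauchy_def dist_real_def by meson
    have le: "nrm A (X m \<ominus> X n) \<le> \<bar>s m - s n\<bar>" if "n \<le> m" for m n
      using step[of n "m - n"] that by simp
    have "nrm A (X m \<ominus> X n) < e" if "m \<ge> N" "n \<ge> N" for m n
      using le[of m n] le[of n m] N[OF that] N[OF that(2) that(1)] nrm_minus_commute[of "X m" "X n"] assms(1)
      by (cases "n \<le> m") auto
    then show ?thesis by blast
  qed
  from complete[of X, OF assms(1) this] show ?thesis
    using assms(1) by (auto simp: clim_def)
qed

lemma finsum_mult_right:
  assumes "finite I" "\<And>i. i \<in> I \<Longrightarrow> f i \<in> carrier A" "x \<in> carrier A"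
  shows "x \<otimes> (\<Oplus>i\<in>I. f i) = (\<Oplus>i\<in>I. x \<otimes> f i)" and "(\<Oplus>i\<in>I. f i) \<otimes> x = (\<Oplus>i\<in>I. f i \<otimes> x)"
  using assms abelian_group_axioms
    finsum_additive[of I f "\<lambda>y. x \<otimes> y" A] finsum_additive[of I f "\<lambda>y. y \<otimes> x" A]
  by (simp_all add: mult_closed mult_l_distr mult_r_distr)

lemma finsum_zero': "(\<And>i. i \<in> I \<Longrightarrow> f i = \<zero>) \<Longrightarrow> (\<Oplus>i\<in>I. f i) = \<zero>"
  using finsum_cong'[of I I "\<lambda>_. \<zero>" f] by simp

lemma finsum_single:
  assumes "finite I" "i \<in> I" "f i \<in> carrier A" "\<And>j. j \<in> I \<Longrightarrow> j \<noteq> i \<Longrightarrow> f j = \<zero>"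
  shows "(\<Oplus>j\<in>I. f j) = f i"
proof -
  have "(\<Oplus>j\<in>insert i (I - {i}). f j) = f i \<oplus> (\<Oplus>j\<in>I - {i}. f j)"
    using assms by (intro finsum_insert) (auto simp: Pi_def)
  also have "(\<Oplus>j\<in>I - {i}. f j) = \<zero>" using assms by (intro finsum_zero') auto
  finally show ?thesis using assms by (simp add: insert_absorb)
qed

lemma smult_cancel:
  assumes g: "g \<in> carrier A" "g \<noteq> \<zero>" and e: "c \<odot> g = d \<odot> g" shows "c = d"
proof -
  have "(c - d) \<odot> g = c \<odot> g \<ominus> d \<odot> g"
    using g smult_l_distr[of g c "- d"] by (simp add: minus_eq smult_minus_left)
  then have "(c - d) \<odot> g = \<zero>" using e g by (simp add: minus_self smult_closed)
  then have "cmod (c - d) * nrm A g = 0" using g nrm_smult[of g "c - d"] by simp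
  then show "c = d" using g by (simp add: nrm_eq_zero)
qed

text \<open>The scalar satisfies \<open>k * k = k\<close>, and \<open>k = 0\<close> is excluded.
  Images of vertex and gap projections are identified in this way once they are known to be
  proportional to the expected projections.\<close>

lemma idempotent_multiple:
  assumes g: "g \<in> carrier A" "g \<noteq> \<zero>" "g \<otimes> g = g" and x: "x = k \<odot> g" "x \<noteq> \<zero>" "x \<otimes> x = x"
  shows "x = g"
proof -
  have "(k * k) \<odot> g = k \<odot> g"
    using x(3) g by (simp add: x(1) smult_mult_left smult_mult_right smult_assoc smult_closed)
  then have "k * k = k" by (rule smult_cancel[OF g(1,2)])
  moreover have "k \<noteq> 0" using x(1,2) g(1) by auto
  ultimately show ?thesis using x(1) g by (simp add: smult_one)
qed

text \<open>On the line spanned by \<open>g\<close> the norm is a fixed multiple of the modulus of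
  the scalar, so the scalars form a Cauchy sequence. This closedness of lines lets scalar path
  coefficients pass to norm limits.\<close>

lemma clim_line:
  assumes g: "g \<in> carrier A" and lim: "clim (\<lambda>n. c n \<odot> g) x" shows "\<exists>c. x = c \<odot> g"
proof (cases "g = \<zero>")
  case True
  then have "clim (\<lambda>n. \<zero>) x" using lim by simp
  then have "x = \<zero>" using clim_const[OF zero_closed] clim_unique by blast
  then show ?thesis using True by auto
next
  case False
  then have n0: "nrm A g > 0" using nrm_nonneg[OF g] nrm_eq_zero[OF g] by simp
  have x: "x \<in> carrier A" using climD(2)[OF lim] .
  have "Cauchy c"
    unfolding Cauchy_def dist_norm
  proof (intro allI impI)
    fix e :: real assume e: "e > 0"
    have "(\<lambda>n. nrm A (c n \<odot> g \<ominus> x)) \<longlonglongrightarrow> 0" using lim by (simp add: clim_def)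
    then have "eventually (\<lambda>n. nrm A (c n \<odot> g \<ominus> x) < e * nrm A g / 2) sequentially"
      using e n0 by (intro order_tendstoD) auto
    then obtain N where N: "\<And>n. n \<ge> N \<Longrightarrow> nrm A (c n \<odot> g \<ominus> x) < e * nrm A g / 2"
      by (auto simp: eventually_sequentially)
    have "cmod (c m - c n) < e" if "m \<ge> N" "n \<ge> N" for m n
    proof -
      have eq: "(c m - c n) \<odot> g = c m \<odot> g \<ominus> c n \<odot> g"
        using g smult_l_distr[of g "c m" "- c n"] by (simp add: minus_eq smult_minus_left)
      have "cmod (c m - c n) * nrm A g = nrm A (c m \<odot> g \<ominus> c n \<odot> g)"
        using g nrm_smult[of g "c m - c n"] by (simp add: eq)
      also have "\<dots> \<le> nrm A (c m \<odot> g \<ominus> x) + nrm A (x \<ominus> c n \<odot> g)"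
        using g x by (intro nrm_triangle_via) (auto simp: smult_closed)
      also have "\<dots> < e * nrm A g"
        using N[OF that(1)] N[OF that(2)] nrm_minus_commute[of x "c n \<odot> g"] g x by (simp add: smult_closed)
      finally show ?thesis using n0 by simp
    qed
    then show "\<exists>M. \<forall>m\<ge>M. \<forall>n\<ge>M. cmod (c m - c n) < e" by blast
  qed
  then obtain l where l: "c \<longlonglongrightarrow> l" using Cauchy_convergent convergent_def by blast
  have "clim (\<lambda>n. c n \<odot> g) (l \<odot> g)"
  proof (rule climI_le)
    fix n
    have "c n \<odot> g \<ominus> l \<odot> g = (c n - l) \<odot> g"
      using g smult_l_distr[of g "c n" "- l"] by (simp add: minus_eq smult_minus_left)
    then show "nrm A (c n \<odot> g \<ominus> l \<odot> g) \<le> cmod (c n - l) * nrm A g" using g by (simp add: nrm_smult)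
    have "(\<lambda>n. cmod (c n - l) * nrm A g) \<longlonglongrightarrow> 0 * nrm A g"
      using l by (intro tendsto_intros) (simp add: LIM_zero tendsto_norm_zero)
    then show "(\<lambda>n. cmod (c n - l) * nrm A g) \<longlonglongrightarrow> 0" by simp
  qed (use g in \<open>auto simp: smult_closed\<close>)
  then show ?thesis using lim clim_unique by blast
qed

text \<open>The iteration \<open>g \<mapsto> (c + g\<^sup>2) / 2\<close>, dominated by the scalar iteration for \<open>c = 1\<close>, converges
  to \<open>1 - (1 - c)\<^bsup>1/2\<^esup>\<close>.\<close>

lemma sqrt_defect_exists:
  assumes c: "c \<in> carrier A" "nrm A c \<le> 1" "adj A c = c"
  obtains g where "g \<in> carrier A" "adj A g = g" "nrm A g \<le> 1" "g \<oplus> g = c \<oplus> g \<otimes> g"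
    "\<And>x. x \<in> carrier A \<Longrightarrow> c \<otimes> x = x \<otimes> c \<Longrightarrow> g \<otimes> x = x \<otimes> g"
proof -
  define G where "G = rec_nat \<zero> (\<lambda>_ g. (1/2) \<odot> (c \<oplus> g \<otimes> g))"
  define s :: "nat \<Rightarrow> real" where "s = rec_nat 0 (\<lambda>_ t. (1 + t\<^sup>2) / 2)"
  have G0 [simp]: "G 0 = \<zero>" and GS: "G (Suc n) = (1/2) \<odot> (c \<oplus> G n \<otimes> G n)" for n by (simp_all add: G_def)
  have s0 [simp]: "s 0 = 0" and sS: "s (Suc n) = (1 + (s n)\<^sup>2) / 2" for n by (simp_all add: s_def)
  have Gc: "G n \<in> carrier A" for n
    by (induction n) (auto simp: GS c smult_closed mult_closed)
  have s01: "0 \<le> s n \<and> s n \<le> 1" for n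
    by (induction n) (auto simp: sS power_le_one)
  have Gn: "nrm A (G n) \<le> s n" for n
  proof (induction n)
    case (Suc n)
    have "nrm A (G (Suc n)) = (1/2) * nrm A (c \<oplus> G n \<otimes> G n)"
      by (simp add: GS nrm_smult c Gc mult_closed)
    also have "\<dots> \<le> (1/2) * (nrm A c + nrm A (G n) * nrm A (G n))"
      using nrm_triangle[of c "G n \<otimes> G n"] nrm_mult[of "G n" "G n"] by (simp add: c Gc mult_closed)
    also have "\<dots> \<le> (1/2) * (1 + s n * s n)"
      using Suc mult_mono[OF Suc Suc] s01[of n] nrm_nonneg[OF Gc, of n] c(2) by simp
    finally show ?case by (simp add: sS power2_eq_square)
  qed simp
  have step: "nrm A (G (Suc n) \<ominus> G n) \<le> s (Suc n) - s n" for n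
  proof (induction n)
    case 0
    have "G (Suc 0) \<ominus> G 0 = (1/2) \<odot> c" using c by (simp add: GS minus_eq smult_closed)
    then show ?case using c by (simp add: nrm_smult sS)
  next
    case (Suc n)
    let ?d = "G (Suc n) \<ominus> G n"
    have "G (Suc (Suc n)) \<ominus> G (Suc n) = (1/2) \<odot> (c \<oplus> G (Suc n) \<otimes> G (Suc n)) \<ominus> (1/2) \<odot> (c \<oplus> G n \<otimes> G n)"
      using GS[of "Suc n"] GS[of n] by simp
    \<comment> \<open>A difference of squares without commutativity:
      \<open>a a - b b = a (a - b) + (a - b) b\<close>. The same identity for the numbers
      \<open>s n\<close> produces the majorant.\<close>
    also have "\<dots> = (1/2) \<odot> (G (Suc n) \<otimes> ?d \<oplus> ?d \<otimes> G n)"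
      using Gc[of n] Gc[of "Suc n"] c(1) by algebra
    finally have "nrm A (G (Suc (Suc n)) \<ominus> G (Suc n)) = (1/2) * nrm A (G (Suc n) \<otimes> ?d \<oplus> ?d \<otimes> G n)"
      by (simp add: nrm_smult Gc mult_closed)
    also have "\<dots> \<le> (1/2) * (nrm A (G (Suc n)) * nrm A ?d + nrm A ?d * nrm A (G n))"
      using nrm_triangle[of "G (Suc n) \<otimes> ?d" "?d \<otimes> G n"] nrm_mult[of "G (Suc n)" ?d] nrm_mult[of ?d "G n"]
      by (simp add: Gc mult_closed)
    also have "\<dots> \<le> (1/2) * (s (Suc n) * (s (Suc n) - s n) + (s (Suc n) - s n) * s n)"
      using Suc Gn[of n] Gn[of "Suc n"] nrm_nonneg[OF Gc, of n] nrm_nonneg[OF Gc, of "Suc n"] nrm_nonneg[of ?d] Gc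
      by (intro mult_left_mono add_mono mult_mono) auto
    also have "\<dots> = s (Suc (Suc n)) - s (Suc n)"
      by (simp add: sS field_simps power2_eq_square)
    finally show ?case .
  qed
  have "incseq s"
    using step nrm_nonneg Gc by (intro incseq_SucI) (smt (verit) minus_closed)
  then have "convergent s"
    using s01 by (elim incseq_convergent[of s 1]) (auto simp: convergent_def)
  then obtain g where g: "clim G g" using clim_if_summable_steps[of G s] Gc step by blast
  note gc = climD(2)[OF g]
  have "clim (\<lambda>n. G (Suc n)) ((1/2) \<odot> (c \<oplus> g \<otimes> g))"
    unfolding GS by (intro clim_smult clim_add clim_mult clim_const g c)
  then have fix_g: "g = (1/2) \<odot> (c \<oplus> g \<otimes> g)" using clim_Suc[OF g] clim_unique by blast
  have "g \<oplus> g = c \<oplus> g \<otimes> g"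
  proof -
    have "g \<oplus> g = (1/2) \<odot> (c \<oplus> g \<otimes> g) \<oplus> (1/2) \<odot> (c \<oplus> g \<otimes> g)"
      by (rule arg_cong2[OF fix_g fix_g])
    also have "\<dots> = (1/2 + 1/2) \<odot> (c \<oplus> g \<otimes> g)" using c gc by (simp only: smult_l_distr mult_closed a_closed)
    also have "\<dots> = c \<oplus> g \<otimes> g" using c gc by (simp add: smult_one mult_closed)
    finally show ?thesis .
  qed
  moreover have "adj A g = g"
  proof -
    have "adj A (G n) = G n" for n
      by (induction n) (auto simp: GS c Gc adj_smult adj_add adj_mult mult_closed)
    then have "clim G (adj A g)" using clim_adj[OF g] by (simp only:)
    then show ?thesis using g by (rule clim_unique)
  qed
  moreover have "nrm A g \<le> 1"
    using Gn s01 by (intro clim_nrm_le[OF g]) (meson order_trans)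
  moreover have "g \<otimes> x = x \<otimes> g" if x: "x \<in> carrier A" "c \<otimes> x = x \<otimes> c" for x
  proof -
    have "G n \<otimes> x = x \<otimes> G n" for n
    proof (induction n)
      case (Suc n)
      have "G n \<otimes> G n \<otimes> x = x \<otimes> (G n \<otimes> G n)"
        using Suc mult_assoc[of "G n" "G n" x] mult_assoc[of "G n" x "G n"] mult_assoc[of x "G n" "G n"] Gc[of n] x by simp
      then show ?case using Suc x Gc[of n] c
        by (simp add: GS mult_closed smult_mult_left smult_mult_right mult_l_distr mult_r_distr)
    qed (simp add: x)
    then have "clim (\<lambda>n. G n \<otimes> x) (x \<otimes> g)" using clim_mult[OF clim_const[OF x(1)] g] by simp
    then show ?thesis using clim_mult[OF g clim_const[OF x(1)]] clim_unique by blast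
  qed
  ultimately show ?thesis using that gc by blast
qed

end

section \<open>Positivity in unital C*-algebras\<close>

text \<open>For \<open>t > 1\<close> the powers of \<open>t\<close> outgrow every linear function.
  The exponents are powers of two because the norm of a power of a self-adjoint element is computed
  for these.\<close>

lemma real_le_one_if_linear_powers:
  fixes t C :: real
  assumes "\<And>k. t ^ (2 ^ k) \<le> 1 + 2 ^ k * C" shows "t \<le> 1"
proof (rule ccontr)
  assume "\<not> t \<le> 1"
  then have t: "t > 1" by simp
  have "(\<lambda>n. of_nat n / t ^ n) \<longlonglongrightarrow> (0::real)"
    using lim_n_over_pown[of t] t by simp
  then have "(\<lambda>n. (1 / t) ^ n + C * (of_nat n / t ^ n)) \<longlonglongrightarrow> 0 + C * 0"
    using t by (intro tendsto_intros LIMSEQ_power_zero) auto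
  then have "eventually (\<lambda>n. (1 / t) ^ n + C * (of_nat n / t ^ n) < 1) sequentially"
    by (intro order_tendstoD) auto
  then obtain N where N: "\<And>n. n \<ge> N \<Longrightarrow> (1 / t) ^ n + C * (of_nat n / t ^ n) < 1"
    by (auto simp: eventually_sequentially)
  \<comment> \<open>The hypothesis at index \<open>N\<close> concerns the exponent
    \<open>2 ^ N\<close>, so the eventual estimate is taken at that exponent.\<close>
  have "N \<le> 2 ^ N" by (simp add: less_imp_le)
  from N[OF this] have "1 + 2 ^ N * C < t ^ (2 ^ N)"
    using t by (simp add: power_divide field_simps)
  then show False using assms[of N] by simp
qed

locale unital_cstar_algebra = cstar_algebra +
  assumes unit_closed: "\<one> \<in> carrier A"
    and mult_unit_left: "x \<in> carrier A \<Longrightarrow> \<one> \<otimes> x = x"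
    and mult_unit_right: "x \<in> carrier A \<Longrightarrow> x \<otimes> \<one> = x"
begin

sublocale ring A
  by unfold_locales
    (auto simp: mult_closed unit_closed mult_unit_left mult_unit_right mult_assoc mult_l_distr mult_r_distr)

lemma adj_unit: "adj A \<one> = \<one>"
  by (metis adj_adj adj_closed adj_mult mult_unit_left unit_closed)

lemmas unital_cstar_simprules
  [algebra cstar_algebra "zero A" "add A" "a_inv A" "a_minus A" "monoid.mult A"] =
  unit_closed mult_unit_left mult_unit_right adj_unit

text \<open>The norm of the unit equals its own square. An inequality is all that holds in general,
  because in the zero algebra the unit is zero.\<close>

lemma nrm_unit_le: "nrm A \<one> \<le> 1"
proof -
  have "nrm A \<one> = (nrm A \<one>)\<^sup>2" using cstar_identity[OF unit_closed] adj_unit by (simp add: unit_closed)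
  then show ?thesis using nrm_nonneg[OF unit_closed] by (metis mult_cancel_right2 power2_eq_square dual_order.refl zero_le_one)
qed

text \<open>\<open>b + i k\<close> is a multiple of a unitary.\<close>

lemma nrm_sq_le_if_sum_squares:
  assumes "b \<in> carrier A" "k \<in> carrier A" "adj A b = b" "adj A k = k" "b \<otimes> k = k \<otimes> b"
    and "r \<ge> 0" "b \<otimes> b \<oplus> k \<otimes> k = of_real r \<odot> \<one>"
  shows "(nrm A b)\<^sup>2 \<le> r"
proof -
  define w where "w = b \<oplus> \<i> \<odot> k"
  define w' where "w' = b \<oplus> (- \<i>) \<odot> k"
  have wc: "w \<in> carrier A" "w' \<in> carrier A" using assms by (auto simp: w_def w'_def smult_closed)
  have aw: "adj A w = w'" using assms by (simp add: w_def w'_def adj_add adj_smult smult_closed)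
  have "w' \<otimes> w = b \<otimes> b \<oplus> (\<i> \<odot> (b \<otimes> k) \<oplus> ((- \<i>) \<odot> (k \<otimes> b) \<oplus> (\<i> * (- \<i>)) \<odot> (k \<otimes> k)))"
    using assms(1,2) unfolding w_def w'_def by algebra
  also have "\<dots> = b \<otimes> b \<oplus> k \<otimes> k"
    using assms(1-5) by (simp add: smult_minus_left smult_one mult_closed smult_closed r_neg2)
  finally have "(nrm A w)\<^sup>2 = nrm A (of_real r \<odot> \<one>)" using cstar_identity[of w] aw wc assms(7) by simp
  also have "\<dots> \<le> r" using assms(6) nrm_unit_le by (simp add: nrm_smult unit_closed mult_left_le)
  finally have w2: "(nrm A w)\<^sup>2 \<le> r" .
  have "w \<oplus> w' = b \<oplus> b"
    unfolding w_def w'_def smult_minus_left[OF assms(2)] using assms(1,2) by algebra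
  also have "\<dots> = 2 \<odot> b" using assms(1) smult_l_distr[of b 1 1] by (simp add: smult_one)
  finally have "2 * nrm A b = nrm A (w \<oplus> w')" using assms by (simp add: nrm_smult)
  also have "\<dots> \<le> 2 * nrm A w" using nrm_triangle[of w w'] nrm_adj[of w] aw wc by simp
  finally have "nrm A b \<le> nrm A w" by simp
  then have "(nrm A b)\<^sup>2 \<le> (nrm A w)\<^sup>2" using nrm_nonneg assms by (intro power_mono) auto
  then show ?thesis using w2 by simp
qed

text \<open>For self-adjoint \<open>a\<close> the norm condition says that the spectrum consists of
  nonnegative reals. In this form positivity is free of spectral theory, and closure under sums
  becomes a triangle inequality.\<close>

definition pos :: "'a \<Rightarrow> bool" where
  "pos a \<longleftrightarrow> a \<in> carrier A \<and> adj A a = a \<and> (\<exists>r\<ge>0. nrm A (of_real r \<odot> \<one> \<ominus> a) \<le> r)"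

lemma posD: "pos a \<Longrightarrow> a \<in> carrier A" "pos a \<Longrightarrow> adj A a = a"
  by (auto simp: pos_def)

text \<open>Passing from \<open>r\<close> to \<open>s\<close> adds a multiple of the unit of norm at
  most \<open>s - r\<close>. It serves to replace a radius by a strictly positive one before
  dividing by it.\<close>

lemma pos_bound_mono:
  assumes "a \<in> carrier A" "nrm A (of_real r \<odot> \<one> \<ominus> a) \<le> r" "r \<le> s"
  shows "nrm A (of_real s \<odot> \<one> \<ominus> a) \<le> s"
proof -
  have "of_real s \<odot> \<one> = of_real (s - r) \<odot> \<one> \<oplus> of_real r \<odot> \<one>"
    by (simp add: smult_l_distr[symmetric] unit_closed)
  then have "of_real s \<odot> \<one> \<ominus> a = of_real (s - r) \<odot> \<one> \<oplus> (of_real r \<odot> \<one> \<ominus> a)"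
    using assms(1) unit_closed by (simp add: minus_eq a_assoc smult_closed)
  then have "nrm A (of_real s \<odot> \<one> \<ominus> a) \<le> nrm A (of_real (s - r) \<odot> \<one>) + nrm A (of_real r \<odot> \<one> \<ominus> a)"
    using nrm_triangle assms(1) unit_closed by (simp add: smult_closed)
  also have "nrm A (of_real (s - r) \<odot> \<one>) \<le> s - r"
    using assms(3) nrm_unit_le by (simp add: nrm_smult unit_closed mult_left_le flip: of_real_diff)
  finally show ?thesis using assms(2) by simp
qed

lemma pos_add:
  assumes "pos a" "pos b" shows "pos (a \<oplus> b)"
proof -
  note c = posD[OF assms(1)] posD[OF assms(2)]
  obtain r s where r: "r \<ge> 0" "nrm A (of_real r \<odot> \<one> \<ominus> a) \<le> r" and s: "s \<ge> 0" "nrm A (of_real s \<odot> \<one> \<ominus> b) \<le> s"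
    using assms by (auto simp: pos_def)
  have "of_real (r + s) \<odot> \<one> \<ominus> (a \<oplus> b) = (of_real r \<odot> \<one> \<oplus> of_real s \<odot> \<one>) \<ominus> (a \<oplus> b)"
    by (simp add: smult_l_distr unit_closed)
  also have "\<dots> = (of_real r \<odot> \<one> \<ominus> a) \<oplus> (of_real s \<odot> \<one> \<ominus> b)"
    using c unit_closed by algebra
  finally have "nrm A (of_real (r + s) \<odot> \<one> \<ominus> (a \<oplus> b)) \<le> r + s"
    using nrm_triangle[of "of_real r \<odot> \<one> \<ominus> a" "of_real s \<odot> \<one> \<ominus> b"] r s c by (simp add: smult_closed unit_closed)
  then show ?thesis using c r s unfolding pos_def
    by (auto simp: adj_add intro!: exI[of _ "r + s"])
qed

lemma pos_smult:
  assumes "pos a" "t \<ge> 0" shows "pos (of_real t \<odot> a)"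
proof -
  note c = posD[OF assms(1)]
  obtain r where r: "r \<ge> 0" "nrm A (of_real r \<odot> \<one> \<ominus> a) \<le> r"
    using assms by (auto simp: pos_def)
  have "of_real t \<odot> (of_real r \<odot> \<one> \<ominus> a) = of_real (t * r) \<odot> \<one> \<ominus> of_real t \<odot> a"
    using c unit_closed by (simp add: minus_eq smult_r_distr smult_minus_right smult_closed smult_assoc[symmetric])
  then have "nrm A (of_real (t * r) \<odot> \<one> \<ominus> of_real t \<odot> a) = t * nrm A (of_real r \<odot> \<one> \<ominus> a)"
    using c assms(2) nrm_smult[of "of_real r \<odot> \<one> \<ominus> a" "of_real t"] by (simp add: smult_closed unit_closed)
  also have "\<dots> \<le> t * r" using r assms by (intro mult_left_mono) auto
  finally show ?thesis using c r assms(2) unfolding pos_def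
    by (auto simp: adj_smult smult_closed intro!: exI[of _ "t * r"])
qed

lemma pos_finsum:
  assumes "finite I" "\<And>i. i \<in> I \<Longrightarrow> pos (f i)" shows "pos (finsum A f I)"
  using assms
proof (induction I rule: finite_induct)
  case empty
  show ?case by (auto simp: pos_def minus_self intro!: exI[of _ 0])
next
  case (insert i I)
  then show ?case using posD by (simp add: pos_add Pi_def)
qed

text \<open>With a radius \<open>r > 0\<close> for \<open>a\<close>, the element
  \<open>c = 1 - a / r\<close> is a self-adjoint contraction, and \<open>sqrt_defect_exists\<close>
  supplies \<open>g\<close> such that the square of \<open>1 - g\<close> is
  \<open>1 - c = a / r\<close>. Hence \<open>h\<close> is \<open>sqrt r\<close> times
  \<open>1 - g\<close>. Positivity of \<open>1 - g\<close>, with radius one, is the bound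
  \<open>nrm A g \<le> 1\<close>.\<close>

lemma pos_sqrt:
  assumes "pos a"
  obtains h where "pos h" "h \<otimes> h = a" "\<And>x. x \<in> carrier A \<Longrightarrow> a \<otimes> x = x \<otimes> a \<Longrightarrow> h \<otimes> x = x \<otimes> h"
proof -
  note a = posD[OF assms]
  obtain r' where r': "r' \<ge> 0" "nrm A (of_real r' \<odot> \<one> \<ominus> a) \<le> r'"
    using assms by (auto simp: pos_def)
  define r where "r = r' + 1"
  have r: "r > 0" "nrm A (of_real r \<odot> \<one> \<ominus> a) \<le> r"
    using pos_bound_mono[OF a(1) r'(2), of r] r' by (auto simp: r_def)
  define c where "c = of_real (1/r) \<odot> (of_real r \<odot> \<one> \<ominus> a)"
  have cc: "c \<in> carrier A" using a by (simp add: c_def smult_closed unit_closed)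
  have ceq: "c = \<one> \<ominus> of_real (1/r) \<odot> a" using a r unit_closed
    by (simp add: c_def minus_eq smult_r_distr smult_minus_right smult_closed smult_assoc[symmetric] smult_one)
  have "nrm A c = nrm A (of_real r \<odot> \<one> \<ominus> a) / r"
    unfolding c_def using r a by (subst nrm_smult) (auto simp: smult_closed unit_closed norm_divide)
  then have "nrm A c \<le> 1" using r by simp
  moreover have "adj A c = c"
    unfolding ceq using a by (simp add: minus_eq adj_add adj_minus adj_smult smult_closed unit_closed adj_unit)
  ultimately obtain g where g: "g \<in> carrier A" "adj A g = g" "nrm A g \<le> 1" "g \<oplus> g = c \<oplus> g \<otimes> g"
    "\<And>x. x \<in> carrier A \<Longrightarrow> c \<otimes> x = x \<otimes> c \<Longrightarrow> g \<otimes> x = x \<otimes> g"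
    using sqrt_defect_exists[OF cc] by blast
  define k where "k = \<one> \<ominus> g"
  have kc: "k \<in> carrier A" "adj A k = k" using g
    by (auto simp: k_def unit_closed minus_eq adj_add adj_minus adj_unit)
  have "\<one> \<ominus> k = g" unfolding k_def using g(1) unit_closed by algebra
  then have kpos: "pos k" unfolding pos_def using kc g(3)
    by (auto intro!: exI[of _ 1] simp: smult_one unit_closed)
  define h where "h = of_real (sqrt r) \<odot> k"
  have "k \<otimes> k = \<one> \<oplus> g \<otimes> g \<ominus> (g \<oplus> g)" unfolding k_def using g(1) unit_closed by algebra
  also have "\<dots> = \<one> \<ominus> c" unfolding g(4) using g(1) cc unit_closed by algebra
  also have "\<dots> = of_real (1/r) \<odot> a"
    unfolding ceq using a unit_closed smult_closed[of a "of_real (1/r)"] by algebra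
  finally have kk: "k \<otimes> k = of_real (1/r) \<odot> a" .
  have "h \<otimes> h = (of_real (sqrt r) * of_real (sqrt r)) \<odot> (k \<otimes> k)"
    using kc by (simp add: h_def smult_mult_left smult_mult_right smult_assoc[symmetric] smult_closed mult_closed)
  also have "of_real (sqrt r) * of_real (sqrt r) = (of_real r :: complex)"
    using r by (simp flip: of_real_mult)
  also have "of_real r \<odot> (k \<otimes> k) = a" using r a by (simp add: kk smult_assoc[symmetric] smult_one)
  finally have hh: "h \<otimes> h = a" .
  have "h \<otimes> x = x \<otimes> h" if x: "x \<in> carrier A" "a \<otimes> x = x \<otimes> a" for x
  proof -
    have "c \<otimes> x = x \<ominus> of_real (1/r) \<odot> (a \<otimes> x)" unfolding ceq using a x(1) unit_closed by algebra
    also have "\<dots> = x \<otimes> c" unfolding ceq x(2) using a x(1) unit_closed by algebra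
    finally have "g \<otimes> x = x \<otimes> g" using g(5) x by blast
    then have "k \<otimes> x = x \<otimes> k" unfolding k_def using x g(1)
      by (simp add: minus_eq mult_l_distr mult_r_distr unit_closed mult_minus_left mult_minus_right)
    then show ?thesis using x kc by (simp add: h_def smult_mult_left smult_mult_right)
  qed
  moreover have "pos h" unfolding h_def using kpos r by (intro pos_smult) auto
  ultimately show ?thesis using that hh by blast
qed

text \<open>\<open>k\<close> is the square root of \<open>1 - b b\<close>, so that
  \<open>b + i k\<close> is unitary. It commutes with \<open>b\<close> because this root commutes
  with everything that commutes with \<open>b b\<close>.\<close>

lemma self_adj_contraction_complement:
  assumes b: "b \<in> carrier A" "adj A b = b" "nrm A b \<le> 1"
  obtains k where "k \<in> carrier A" "adj A k = k" "k \<otimes> b = b \<otimes> k" "k \<otimes> k \<oplus> b \<otimes> b = \<one>"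
proof -
  define c where "c = b \<otimes> b"
  have c: "c \<in> carrier A" "adj A c = c" "nrm A c \<le> 1"
    using b nrm_self_adj[of b] nrm_nonneg[of b] by (auto simp: c_def mult_closed adj_mult power_le_one)
  obtain g where g: "g \<in> carrier A" "adj A g = g" "g \<oplus> g = c \<oplus> g \<otimes> g"
    "\<And>x. x \<in> carrier A \<Longrightarrow> c \<otimes> x = x \<otimes> c \<Longrightarrow> g \<otimes> x = x \<otimes> g"
    by (rule sqrt_defect_exists[OF c(1,3,2)]) metis
  define k where "k = \<one> \<ominus> g"
  have k: "k \<in> carrier A" "adj A k = k" using g
    by (auto simp: k_def unit_closed minus_eq adj_add adj_minus adj_unit)
  have "c \<otimes> b = b \<otimes> c" using b by (simp add: c_def mult_assoc)
  then have "g \<otimes> b = b \<otimes> g" using g(4) b by blast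
  then have comm: "k \<otimes> b = b \<otimes> k" unfolding k_def using b g(1)
    by (simp add: minus_eq mult_l_distr mult_r_distr unit_closed mult_minus_left mult_minus_right)
  have "k \<otimes> k = \<one> \<oplus> g \<otimes> g \<ominus> (g \<oplus> g)" unfolding k_def using g(1) unit_closed by algebra
  also have "\<dots> = \<one> \<ominus> c" unfolding g(3) using g(1) c(1) unit_closed by algebra
  finally have "k \<otimes> k \<oplus> b \<otimes> b = \<one>" using b unit_closed c(1)
    by (simp add: c_def minus_eq a_assoc l_neg mult_closed)
  with k comm show ?thesis using that by blast
qed

text \<open>Scale \<open>h\<close> to an element \<open>b\<close> of norm one and let
  \<open>k\<close> be its complement. Since \<open>k k + b b = 1\<close>, the roles of
  \<open>b\<close> and \<open>k\<close> can be exchanged in \<open>nrm_sq_le_if_sum_squares\<close>,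
  so \<open>k\<close> is a contraction. Then \<open>1 - b b = k k\<close> has norm at most one,
  which is positivity of \<open>b b\<close> with radius one.\<close>

lemma pos_square:
  assumes h: "h \<in> carrier A" "adj A h = h" shows "pos (h \<otimes> h)"
proof (cases "nrm A h = 0")
  case True
  then have "h = \<zero>" using h by (simp add: nrm_eq_zero)
  then show ?thesis by (auto simp: pos_def minus_self intro!: exI[of _ 0])
next
  case False
  define r where "r = (nrm A h)\<^sup>2"
  have r: "r > 0" using False by (simp add: r_def)
  define b where "b = of_real (1 / nrm A h) \<odot> h"
  have b: "b \<in> carrier A" "adj A b = b" using h by (auto simp: b_def smult_closed adj_smult)
  have nb: "nrm A b = 1" using False h nrm_nonneg[OF h(1)] by (simp add: b_def nrm_smult norm_divide)
  define c where "c = b \<otimes> b"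
  have c: "c \<in> carrier A" "adj A c = c" using b by (auto simp: c_def mult_closed adj_mult)
  obtain k where k: "k \<in> carrier A" "adj A k = k" "k \<otimes> b = b \<otimes> k" "k \<otimes> k \<oplus> b \<otimes> b = \<one>"
    using self_adj_contraction_complement[OF b] nb by auto
  have kk: "k \<otimes> k = \<one> \<ominus> c" unfolding k(4)[symmetric] c_def using k(1) b(1) by algebra
  have "(nrm A k)\<^sup>2 \<le> 1" using nrm_sq_le_if_sum_squares[of k b 1] k b unit_closed by (auto simp: smult_one)
  then have n1: "nrm A (\<one> \<ominus> c) \<le> 1" using nrm_self_adj[OF k(1,2)] kk by simp
  have "h \<otimes> h = of_real r \<odot> c"
  proof -
    have "of_real r \<odot> c = of_real (r * (1 / nrm A h) * (1 / nrm A h)) \<odot> (h \<otimes> h)"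
      using h by (simp add: c_def b_def smult_mult_left smult_mult_right smult_assoc[symmetric] smult_closed mult_closed)
    also have "r * (1 / nrm A h) * (1 / nrm A h) = 1" using False by (simp add: r_def power2_eq_square)
    finally show ?thesis using h by (simp add: smult_one mult_closed)
  qed
  moreover have "pos c" unfolding pos_def using c n1 unit_closed by (auto intro!: exI[of _ 1] simp: smult_one)
  ultimately show ?thesis using pos_smult r by simp
qed

text \<open>The square roots \<open>h\<close> of \<open>a\<close> and \<open>k\<close> of
  \<open>\<ominus> a\<close> commute, and their squares add up to zero. This is the case
  \<open>r = 0\<close> of \<open>nrm_sq_le_if_sum_squares\<close>.\<close>

lemma pos_antisym:
  assumes "pos a" "pos (\<ominus> a)" shows "a = \<zero>"
proof -
  note a = posD[OF assms(1)]
  obtain h where h: "pos h" "h \<otimes> h = a" "\<And>x. x \<in> carrier A \<Longrightarrow> a \<otimes> x = x \<otimes> a \<Longrightarrow> h \<otimes> x = x \<otimes> h"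
    using pos_sqrt[OF assms(1)] by metis
  obtain k where k: "pos k" "k \<otimes> k = \<ominus> a"
    "\<And>x. x \<in> carrier A \<Longrightarrow> \<ominus> a \<otimes> x = x \<otimes> \<ominus> a \<Longrightarrow> k \<otimes> x = x \<otimes> k"
    using pos_sqrt[OF assms(2)] by metis
  note hc = posD[OF h(1)] and kc = posD[OF k(1)]
  have "k \<otimes> a = a \<otimes> k" using k(3)[OF a(1)] a by (simp add: mult_minus_left mult_minus_right)
  then have "h \<otimes> k = k \<otimes> h" using h(3)[OF kc(1)] by simp
  moreover have "h \<otimes> h \<oplus> k \<otimes> k = of_real 0 \<odot> \<one>" using a unit_closed by (simp add: h k r_neg)
  ultimately have "(nrm A h)\<^sup>2 \<le> 0" using nrm_sq_le_if_sum_squares[of h k 0] hc kc by auto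
  then have "h = \<zero>" using nrm_eq_zero[OF hc(1)] by simp
  then show ?thesis using h(2) by simp
qed

text \<open>Each doubling of the exponent is one application of the C*-identity to a self-adjoint
  element, which explains the exponents.\<close>

lemma nrm_pow_self_adj:
  assumes "x \<in> carrier A" "adj A x = x" shows "nrm A (x [^] (2 ^ k :: nat)) = nrm A x ^ (2 ^ k)"
proof (induction k)
  case (Suc k)
  have sa: "adj A (x [^] n) = x [^] n" for n :: nat
  proof (induction n)
    case (Suc n)
    then show ?case using assms by (simp add: adj_mult nat_pow_Suc2[OF assms(1), symmetric])
  qed (simp add: adj_unit)
  have "x [^] (2 ^ Suc k :: nat) = x [^] (2 ^ k :: nat) \<otimes> x [^] (2 ^ k :: nat)"
    using assms by (simp add: nat_pow_mult mult_2)
  then have "nrm A (x [^] (2 ^ Suc k :: nat)) = (nrm A (x [^] (2 ^ k :: nat)))\<^sup>2"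
    using nrm_self_adj[of "x [^] (2 ^ k :: nat)"] sa assms by simp
  then show ?case by (simp add: Suc power_mult[symmetric] mult.commute)
qed (use assms in simp)

text \<open>\<open>y\<^sup>* y\<close> and \<open>y y\<^sup>*\<close> have the same spectral radius. The elements \<open>E n\<close> below satisfy
  \<open>(1 + y y\<^sup>*)\<^sup>n = 1 + y (E n) y\<^sup>*\<close> and have norm at most \<open>n\<close>, so the powers of \<open>1 + y y\<^sup>*\<close> grow at
  most linearly.\<close>

lemma nrm_one_plus_swap:
  assumes y: "y \<in> carrier A" and le: "nrm A (\<one> \<oplus> adj A y \<otimes> y) \<le> 1"
  shows "nrm A (\<one> \<oplus> y \<otimes> adj A y) \<le> 1"
proof -
  define w where "w = adj A y \<otimes> y"
  define z where "z = \<one> \<oplus> y \<otimes> adj A y"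
  have wc: "w \<in> carrier A" and zc: "z \<in> carrier A" "adj A z = z" using y unit_closed
    by (auto simp: w_def z_def mult_closed adj_closed adj_add adj_mult adj_adj adj_unit)
  \<comment> \<open>\<open>E n\<close> is the sum of the powers of \<open>1 + w\<close> with
    exponents below \<open>n\<close>. Each of these powers has norm at most one.\<close>
  define E where "E = rec_nat \<zero> (\<lambda>_ e. (\<one> \<oplus> w) \<otimes> e \<oplus> \<one>)"
  have E0: "E 0 = \<zero>" and ES: "E (Suc n) = (\<one> \<oplus> w) \<otimes> E n \<oplus> \<one>" for n by (simp_all add: E_def)
  have Ec: "E n \<in> carrier A" for n by (induction n) (auto simp: E0 ES wc unit_closed mult_closed)
  have En: "nrm A (E n) \<le> of_nat n" for n
  proof (induction n)
    case (Suc n)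
    have "nrm A (E (Suc n)) \<le> nrm A ((\<one> \<oplus> w) \<otimes> E n) + nrm A \<one>"
      unfolding ES using Ec wc unit_closed by (intro nrm_triangle) (auto simp: mult_closed)
    also have "\<dots> \<le> nrm A (\<one> \<oplus> w) * nrm A (E n) + 1"
      using nrm_mult[of "\<one> \<oplus> w" "E n"] nrm_unit_le Ec wc unit_closed by simp
    also have "\<dots> \<le> 1 * of_nat n + 1"
      using Suc le Ec nrm_nonneg[OF Ec, of n] unfolding w_def[symmetric] by (intro add_mono mult_mono) auto
    finally show ?case by simp
  qed (simp add: E0)
  have zn: "z [^] n = \<one> \<oplus> y \<otimes> E n \<otimes> adj A y" for n
  proof (induction n)
    case 0 show ?case using y unit_closed by (simp add: E0 adj_closed)
  next
    case (Suc n)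
    have "z [^] Suc n = z \<otimes> (\<one> \<oplus> y \<otimes> E n \<otimes> adj A y)"
      using zc nat_pow_Suc2 Suc by metis
    also have "\<dots> = \<one> \<oplus> y \<otimes> E (Suc n) \<otimes> adj A y"
      unfolding ES z_def w_def using y Ec[of n] unit_closed by algebra
    finally show ?case .
  qed
  have "nrm A z ^ (2 ^ k) \<le> 1 + 2 ^ k * (nrm A y)\<^sup>2" for k
  proof -
    let ?N = "2 ^ k :: nat"
    have "nrm A z ^ ?N = nrm A (\<one> \<oplus> y \<otimes> E ?N \<otimes> adj A y)"
      using nrm_pow_self_adj[OF zc] zn by metis
    also have "\<dots> \<le> nrm A \<one> + nrm A (y \<otimes> E ?N \<otimes> adj A y)"
      using y Ec unit_closed by (intro nrm_triangle) (auto simp: mult_closed adj_closed)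
    also have "nrm A (y \<otimes> E ?N \<otimes> adj A y) \<le> nrm A (y \<otimes> E ?N) * nrm A (adj A y)"
      using y Ec by (intro nrm_mult) (auto simp: mult_closed adj_closed)
    also have "\<dots> \<le> (nrm A y * nrm A (E ?N)) * nrm A y"
      using y Ec nrm_nonneg by (simp add: nrm_adj nrm_mult mult_right_mono)
    also have "\<dots> \<le> (nrm A y * of_nat ?N) * nrm A y"
      using En[of ?N] nrm_nonneg[OF y] by (intro mult_right_mono mult_left_mono) auto
    finally show ?thesis using nrm_unit_le by (simp add: power2_eq_square algebra_simps)
  qed
  then show ?thesis unfolding z_def[symmetric] by (rule real_le_one_if_linear_powers)
qed

text \<open>For \<open>r > 0\<close> the bound \<open>r\<close> on the norm of \<open>r + u\<close>
  is the bound 1 on the norm of \<open>1 + u / r\<close>. Dividing \<open>y\<close> by the square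
  root of \<open>r\<close> therefore reduces the claim to \<open>nrm_one_plus_swap\<close>.\<close>

lemma pos_minus_swap:
  assumes y: "y \<in> carrier A" and "pos (\<ominus> (adj A y \<otimes> y))"
  shows "pos (\<ominus> (y \<otimes> adj A y))"
proof -
  obtain r' where r': "r' \<ge> 0" "nrm A (of_real r' \<odot> \<one> \<ominus> (\<ominus> (adj A y \<otimes> y))) \<le> r'"
    using assms(2) by (auto simp: pos_def)
  define r where "r = r' + 1"
  have r: "r > 0" "nrm A (of_real r \<odot> \<one> \<ominus> (\<ominus> (adj A y \<otimes> y))) \<le> r"
    using pos_bound_mono[OF _ r'(2), of r] r' y by (auto simp: r_def mult_closed adj_closed)
  define v where "v = of_real (1 / sqrt r) \<odot> y"
  have vc: "v \<in> carrier A" using y by (simp add: v_def smult_closed)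
  have sq: "of_real (1 / sqrt r) * of_real (1 / sqrt r) = (of_real (1/r) :: complex)"
    using r by (simp flip: of_real_mult)
  have vv: "adj A v \<otimes> v = of_real (1/r) \<odot> (adj A y \<otimes> y)" "v \<otimes> adj A v = of_real (1/r) \<odot> (y \<otimes> adj A y)"
    unfolding v_def using y sq
    by (simp_all add: adj_smult smult_mult_left smult_mult_right smult_assoc[symmetric] smult_closed mult_closed adj_closed)
  have sc: "\<one> \<oplus> of_real (1/r) \<odot> u = of_real (1/r) \<odot> (of_real r \<odot> \<one> \<ominus> (\<ominus> u))" if "u \<in> carrier A" for u
    using that r unit_closed
    by (simp add: minus_eq smult_r_distr smult_closed smult_assoc[symmetric] smult_one)
  have nsc: "nrm A (\<one> \<oplus> of_real (1/r) \<odot> u) = nrm A (of_real r \<odot> \<one> \<ominus> (\<ominus> u)) / r" if "u \<in> carrier A" for u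
    unfolding sc[OF that] using that r unit_closed by (subst nrm_smult) (auto simp: smult_closed norm_divide)
  have "nrm A (\<one> \<oplus> adj A v \<otimes> v) \<le> 1"
    unfolding vv using nsc[of "adj A y \<otimes> y"] r y by (simp add: mult_closed adj_closed)
  then have "nrm A (\<one> \<oplus> v \<otimes> adj A v) \<le> 1" using nrm_one_plus_swap vc by blast
  then have "nrm A (of_real r \<odot> \<one> \<ominus> (\<ominus> (y \<otimes> adj A y))) \<le> r"
    unfolding vv using nsc[of "y \<otimes> adj A y"] r y by (simp add: mult_closed adj_closed)
  then show ?thesis unfolding pos_def using r y
    by (auto simp: mult_closed adj_closed adj_minus adj_mult adj_adj intro!: exI[of _ r])
qed

lemma eq_zero_if_pos_minus_square:
  assumes y: "y \<in> carrier A" and neg: "pos (\<ominus> (adj A y \<otimes> y))"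
  shows "y = \<zero>"
proof -
  define h where "h = y \<oplus> adj A y"
  define k where "k = \<i> \<odot> (y \<ominus> adj A y)"
  have h: "h \<in> carrier A" "adj A h = h"
    using y by (auto simp: h_def adj_closed adj_add adj_adj a_comm)
  have k: "k \<in> carrier A" using y by (simp add: k_def smult_closed adj_closed)
  have "adj A k = (- \<i>) \<odot> (adj A y \<ominus> y)" using y
    by (simp add: k_def adj_smult minus_eq adj_add adj_minus adj_adj adj_closed smult_closed)
  also have "\<dots> = \<i> \<odot> (y \<ominus> adj A y)" using y
    by (simp add: smult_minus_left minus_eq smult_r_distr smult_minus_right minus_add adj_closed smult_closed a_comm)
  finally have ak: "adj A k = k" by (simp add: k_def)
  have "k \<otimes> k = (\<i> * \<i>) \<odot> ((y \<ominus> adj A y) \<otimes> (y \<ominus> adj A y))"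
    unfolding k_def using y by (simp add: smult_mult_left smult_mult_right smult_assoc[symmetric] smult_closed mult_closed adj_closed)
  also have "\<dots> = \<ominus> ((y \<ominus> adj A y) \<otimes> (y \<ominus> adj A y))"
    using y by (simp add: smult_minus_left smult_one mult_closed adj_closed)
  finally have "(h \<otimes> h \<oplus> k \<otimes> k) \<oplus> (\<ominus> (adj A y \<otimes> y) \<oplus> \<ominus> (adj A y \<otimes> y)) = y \<otimes> adj A y \<oplus> y \<otimes> adj A y"
    unfolding h_def using y by simp algebra
  moreover have "pos ((h \<otimes> h \<oplus> k \<otimes> k) \<oplus> (\<ominus> (adj A y \<otimes> y) \<oplus> \<ominus> (adj A y \<otimes> y)))"
    using neg h k ak by (intro pos_add pos_square) auto
  ultimately have "pos (y \<otimes> adj A y \<oplus> y \<otimes> adj A y)" by simp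
  moreover have "pos (\<ominus> (y \<otimes> adj A y \<oplus> y \<otimes> adj A y))"
    using pos_add[OF pos_minus_swap[OF y neg] pos_minus_swap[OF y neg]] y
    by (simp add: minus_add mult_closed adj_closed)
  ultimately have "y \<otimes> adj A y \<oplus> y \<otimes> adj A y = \<zero>" by (rule pos_antisym)
  moreover have "y \<otimes> adj A y \<oplus> y \<otimes> adj A y = 2 \<odot> (y \<otimes> adj A y)"
    using y smult_l_distr[of "y \<otimes> adj A y" 1 1] by (simp add: smult_one mult_closed adj_closed)
  ultimately have "nrm A (2 \<odot> (adj A (adj A y) \<otimes> adj A y)) = 0" using y by (simp add: adj_adj)
  then have "nrm A (adj A y) = 0"
    using y cstar_identity[of "adj A y"] by (simp add: nrm_smult mult_closed adj_closed adj_adj)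
  then show ?thesis using y by (simp add: nrm_adj nrm_eq_zero)
qed

text \<open>With \<open>s = \<bar>a\<bar>\<close> for \<open>a = x\<^sup>* x\<close> and \<open>m = s - a\<close>, the element \<open>(x m)\<^sup>* (x m) = - s m\<^sup>2\<close> is
  negative, so \<open>x m = 0\<close>; this forces \<open>m = 0\<close>.\<close>

lemma pos_adj_mult_self:
  assumes x: "x \<in> carrier A" shows "pos (adj A x \<otimes> x)"
proof -
  define a where "a = adj A x \<otimes> x"
  have a: "a \<in> carrier A" "adj A a = a" using x by (auto simp: a_def mult_closed adj_closed adj_mult adj_adj)
  obtain s where s: "pos s" "s \<otimes> s = a \<otimes> a" "\<And>z. z \<in> carrier A \<Longrightarrow> (a \<otimes> a) \<otimes> z = z \<otimes> (a \<otimes> a) \<Longrightarrow> s \<otimes> z = z \<otimes> s"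
    using pos_sqrt[OF pos_square[OF a]] by metis
  note sc = posD[OF s(1)]
  have sa: "s \<otimes> a = a \<otimes> s" using s(3)[OF a(1)] a by (simp add: mult_assoc)
  define m where "m = s \<ominus> a"
  have m: "m \<in> carrier A" "adj A m = m" using a sc
    by (auto simp: m_def minus_eq adj_add adj_minus)
  \<comment> \<open>The second square root exhibits \<open>s m m\<close> as the square of the
    self-adjoint element \<open>r m\<close>, hence as a positive element.\<close>
  obtain r where r: "pos r" "r \<otimes> r = s" "\<And>z. z \<in> carrier A \<Longrightarrow> s \<otimes> z = z \<otimes> s \<Longrightarrow> r \<otimes> z = z \<otimes> r"
    using pos_sqrt[OF s(1)] by metis
  note rc = posD[OF r(1)]
  have sm: "s \<otimes> m = m \<otimes> s" unfolding m_def minus_eq using a sc sa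
    by (simp add: mult_l_distr mult_r_distr mult_minus_left mult_minus_right)
  then have rm: "r \<otimes> m = m \<otimes> r" using r(3) m by blast
  \<comment> \<open>\<open>s s = a a\<close> rewrites \<open>a (s - a)\<close> as
    \<open>- s (s - a)\<close>: the element \<open>m\<close> is twice the negative part of
    \<open>a\<close>, and \<open>a\<close> acts on it as \<open>- s\<close>.\<close>
  have am: "a \<otimes> m = \<ominus> (s \<otimes> m)"
  proof -
    have "a \<otimes> m = s \<otimes> a \<ominus> s \<otimes> s" unfolding sa s(2) m_def using a sc by algebra
    also have "\<dots> = \<ominus> (s \<otimes> m)" unfolding m_def using a(1) sc(1) by algebra
    finally show ?thesis .
  qed
  have rmrm: "(r \<otimes> m) \<otimes> (r \<otimes> m) = s \<otimes> m \<otimes> m"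
  proof -
    have "(r \<otimes> m) \<otimes> (r \<otimes> m) = r \<otimes> (m \<otimes> r) \<otimes> m" using rc m by (simp add: mult_assoc mult_closed)
    also have "\<dots> = s \<otimes> m \<otimes> m" unfolding rm[symmetric] r(2)[symmetric] using rc m by (simp add: mult_assoc mult_closed)
    finally show ?thesis .
  qed
  have rms: "r \<otimes> m \<in> carrier A" "adj A (r \<otimes> m) = r \<otimes> m" using rc m rm by (auto simp: mult_closed adj_mult)
  have "adj A (x \<otimes> m) \<otimes> (x \<otimes> m) = m \<otimes> (a \<otimes> m)"
    using x m by (simp add: a_def adj_mult mult_assoc mult_closed adj_closed)
  also have "\<dots> = \<ominus> (s \<otimes> m \<otimes> m)" unfolding am using m sc sm by (simp add: mult_minus_right mult_closed mult_assoc)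
  finally have ym: "adj A (x \<otimes> m) \<otimes> (x \<otimes> m) = \<ominus> (s \<otimes> m \<otimes> m)" .
  then have "\<ominus> (adj A (x \<otimes> m) \<otimes> (x \<otimes> m)) = (r \<otimes> m) \<otimes> (r \<otimes> m)"
    using rmrm m sc by (simp add: minus_minus mult_closed)
  then have "pos (\<ominus> (adj A (x \<otimes> m) \<otimes> (x \<otimes> m)))" using pos_square[OF rms] by simp
  then have "x \<otimes> m = \<zero>" using x m by (intro eq_zero_if_pos_minus_square) (auto simp: mult_closed)
  then have "\<ominus> (s \<otimes> m \<otimes> m) = \<zero>" using ym by simp
  then have "s \<otimes> m \<otimes> m = \<zero>" using m sc minus_minus[of "s \<otimes> m \<otimes> m"] by (simp add: minus_zero mult_closed)
  then have "r \<otimes> m = \<zero>" using adj_mult_eq_zero[OF rms(1)] rms rmrm by simp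
  then have "s \<otimes> m = \<zero>" unfolding r(2)[symmetric] using rc m by (simp add: mult_assoc)
  moreover have "m \<otimes> m = s \<otimes> m \<oplus> \<ominus> (a \<otimes> m)" unfolding m_def using a(1) sc(1) by algebra
  ultimately have "m \<otimes> m = \<zero>" using am by (simp add: minus_zero)
  then have "m = \<zero>" using adj_mult_eq_zero[of m] m by simp
  then have "s = a" unfolding m_def using minus_eq_zeroD sc a by blast
  then show ?thesis using s(1) by (simp add: a_def)
qed

text \<open>\<open>- y\<^sup>* y\<close> equals a sum of positive elements. Two squares stand
  outside the indexed sum to match the later use: the sum runs over the remaining projections,
  \<open>z\<close> comes from the defect of an order relation, and \<open>y\<close> from the
  projection under study.\<close>

lemma eq_zero_if_sum_squares_eq_zero:
  assumes "finite I" "\<And>i. i \<in> I \<Longrightarrow> f i \<in> carrier A" "z \<in> carrier A" "y \<in> carrier A"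
    and "(\<Oplus>i\<in>I. adj A (f i) \<otimes> f i) \<oplus> adj A z \<otimes> z \<oplus> adj A y \<otimes> y = \<zero>"
  shows "y = \<zero>"
proof -
  let ?s = "(\<Oplus>i\<in>I. adj A (f i) \<otimes> f i) \<oplus> adj A z \<otimes> z"
  have "pos ?s" using assms by (intro pos_add pos_finsum pos_adj_mult_self) auto
  moreover have "\<ominus> (adj A y \<otimes> y) = ?s"
    using assms by (intro minus_equality) (auto simp: mult_closed adj_closed intro!: finsum_closed')
  ultimately show ?thesis using assms by (intro eq_zero_if_pos_minus_square) auto
qed

end

section \<open>Unitization\<close>

context cstar_algebra
begin

definition lmul :: "complex \<times> 'a \<Rightarrow> 'a \<Rightarrow> 'a" where
  "lmul p y = fst p \<odot> y \<oplus> snd p \<otimes> y"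

definition opn :: "complex \<times> 'a \<Rightarrow> real" where
  "opn p = (SUP y\<in>{y \<in> carrier A. nrm A y \<le> 1}. nrm A (lmul p y))"

text \<open>The norm is the maximum of two C*-seminorms: the modulus of the scalar part and the
  operator norm of left multiplication on \<open>A\<close>. The second one alone fails to separate
  points if \<open>A\<close> already has a unit, because then \<open>(1, -1)\<close> acts as zero;
  the maximum covers this case too.\<close>

definition unitization :: "(complex \<times> 'a) cstar" where
  "unitization = \<lparr>carrier = UNIV \<times> carrier A,
    monoid.mult = (\<lambda>p q. (fst p * fst q, fst p \<odot> snd q \<oplus> fst q \<odot> snd p \<oplus> snd p \<otimes> snd q)),
    one = (1, \<zero>), zero = (0, \<zero>), add = (\<lambda>p q. (fst p + fst q, snd p \<oplus> snd q)),
    smult = (\<lambda>c p. (c * fst p, c \<odot> snd p)), adj = (\<lambda>p. (cnj (fst p), adj A (snd p))),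
    nrm = (\<lambda>p. max (cmod (fst p)) (opn p))\<rparr>"

lemma unitization_simps [simp]:
  "carrier unitization = UNIV \<times> carrier A" "\<one>\<^bsub>unitization\<^esub> = (1, \<zero>)" "\<zero>\<^bsub>unitization\<^esub> = (0, \<zero>)"
  "p \<otimes>\<^bsub>unitization\<^esub> q = (fst p * fst q, fst p \<odot> snd q \<oplus> fst q \<odot> snd p \<oplus> snd p \<otimes> snd q)"
  "p \<oplus>\<^bsub>unitization\<^esub> q = (fst p + fst q, snd p \<oplus> snd q)"
  "c \<odot>\<^bsub>unitization\<^esub> p = (c * fst p, c \<odot> snd p)"
  "adj unitization p = (cnj (fst p), adj A (snd p))"
  "nrm unitization p = max (cmod (fst p)) (opn p)"
  by (simp_all add: unitization_def)

lemma lmul_closed: "snd p \<in> carrier A \<Longrightarrow> y \<in> carrier A \<Longrightarrow> lmul p y \<in> carrier A"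
  by (simp add: lmul_def smult_closed mult_closed)

lemma nrm_lmul_crude:
  assumes "snd p \<in> carrier A" "y \<in> carrier A"
  shows "nrm A (lmul p y) \<le> (cmod (fst p) + nrm A (snd p)) * nrm A y"
  unfolding lmul_def using assms nrm_triangle[of "fst p \<odot> y" "snd p \<otimes> y"] nrm_mult[of "snd p" y]
  by (simp add: smult_closed mult_closed nrm_smult algebra_simps)

lemma opn_bdd: "snd p \<in> carrier A \<Longrightarrow> bdd_above ((\<lambda>y. nrm A (lmul p y)) ` {y \<in> carrier A. nrm A y \<le> 1})"
  by (rule bdd_aboveI2[where M = "cmod (fst p) + nrm A (snd p)"])
    (auto intro!: order_trans[OF nrm_lmul_crude] mult_left_le simp: nrm_nonneg)

lemma opn_nonneg:
  assumes "snd p \<in> carrier A" shows "0 \<le> opn p"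
proof -
  have "nrm A (lmul p \<zero>) \<le> opn p"
    unfolding opn_def by (rule cSUP_upper[OF _ opn_bdd[OF assms]]) auto
  then show ?thesis using nrm_nonneg[OF lmul_closed[OF assms zero_closed]] by linarith
qed

lemma lmul_smult: "snd p \<in> carrier A \<Longrightarrow> y \<in> carrier A \<Longrightarrow> lmul p (c \<odot> y) = c \<odot> lmul p y"
  by (simp add: lmul_def smult_r_distr smult_closed mult_closed smult_mult_right smult_assoc[symmetric] mult.commute)

lemma nrm_lmul_le:
  assumes "snd p \<in> carrier A" "y \<in> carrier A"
  shows "nrm A (lmul p y) \<le> opn p * nrm A y"
proof (cases "nrm A y = 0")
  case True
  then show ?thesis using nrm_lmul_crude[OF assms] by simp
next
  case False
  let ?c = "of_real (1 / nrm A y) :: complex"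
  have ny: "nrm A y > 0" using False nrm_nonneg[OF assms(2)] by simp
  have "nrm A (lmul p (?c \<odot> y)) \<le> opn p"
    unfolding opn_def using assms ny
    by (intro cSUP_upper[OF _ opn_bdd[OF assms(1)]]) (auto simp: smult_closed nrm_smult norm_divide)
  moreover have "nrm A (lmul p (?c \<odot> y)) = nrm A (lmul p y) / nrm A y"
    using assms ny by (subst lmul_smult) (auto simp: nrm_smult lmul_closed norm_divide)
  ultimately have "nrm A (lmul p y) / nrm A y \<le> opn p" by (simp only:)
  then show ?thesis using ny by (simp only: pos_divide_le_eq)
qed

lemma opn_least:
  assumes "0 \<le> C" "\<And>y. y \<in> carrier A \<Longrightarrow> nrm A (lmul p y) \<le> C * nrm A y"
  shows "opn p \<le> C"
  unfolding opn_def
proof (rule cSUP_least)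
  show "{y \<in> carrier A. nrm A y \<le> 1} \<noteq> {}" by (auto intro!: exI[of _ \<zero>])
  fix y assume "y \<in> {y \<in> carrier A. nrm A y \<le> 1}"
  then show "nrm A (lmul p y) \<le> C"
    using assms(2)[of y] mult_left_le[of "nrm A y" C] assms(1) by auto
qed

lemma opn_le_sum: "snd p \<in> carrier A \<Longrightarrow> opn p \<le> cmod (fst p) + nrm A (snd p)"
  by (intro opn_least nrm_lmul_crude) (auto simp: nrm_nonneg)

text \<open>The lower bound tests left multiplication by \<open>x\<close> at the adjoint of
  \<open>x\<close>, where the C*-identity gives the square of the norm.\<close>

lemma opn_embed:
  assumes "x \<in> carrier A" shows "opn (0, x) = nrm A x"
proof (rule antisym)
  show "opn (0, x) \<le> nrm A x" using opn_le_sum[of "(0, x)"] assms by simp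
  have "nrm A (lmul (0, x) (adj A x)) \<le> opn (0, x) * nrm A (adj A x)"
    using assms by (intro nrm_lmul_le) (auto simp: adj_closed)
  moreover have "nrm A (lmul (0, x) (adj A x)) = (nrm A x)\<^sup>2"
    using cstar_identity[of "adj A x"] assms by (simp add: lmul_def adj_closed adj_adj nrm_adj mult_closed)
  ultimately have "nrm A x * nrm A x \<le> opn (0, x) * nrm A x" using assms by (simp add: nrm_adj power2_eq_square)
  then show "nrm A x \<le> opn (0, x)"
    using nrm_nonneg[OF assms] opn_nonneg[of "(0, x)"] assms by (cases "nrm A x = 0") auto
qed

lemma lmul_mult: "snd p \<in> carrier A \<Longrightarrow> snd q \<in> carrier A \<Longrightarrow> y \<in> carrier A \<Longrightarrow>
    lmul (p \<otimes>\<^bsub>unitization\<^esub> q) y = lmul p (lmul q y)"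
  unfolding lmul_def unitization_simps fst_conv snd_conv
  by (simp add: smult_closed mult_closed mult_l_distr mult_r_distr smult_r_distr smult_assoc[symmetric]
      smult_mult_left smult_mult_right mult_assoc a_ac)

lemma lmul_add: "snd p \<in> carrier A \<Longrightarrow> snd q \<in> carrier A \<Longrightarrow> y \<in> carrier A \<Longrightarrow>
    lmul (p \<oplus>\<^bsub>unitization\<^esub> q) y = lmul p y \<oplus> lmul q y"
  by (simp add: lmul_def smult_l_distr mult_l_distr smult_closed mult_closed a_ac)

lemma lmul_adj: "snd p \<in> carrier A \<Longrightarrow> y \<in> carrier A \<Longrightarrow> z \<in> carrier A \<Longrightarrow>
    adj A (lmul p y) \<otimes> z = adj A y \<otimes> lmul (adj unitization p) z"
  by (simp add: lmul_def adj_add adj_smult adj_mult smult_closed mult_closed adj_closed mult_l_distr mult_r_distr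
      smult_mult_left smult_mult_right mult_assoc)

lemma opn_mult:
  assumes "snd p \<in> carrier A" "snd q \<in> carrier A"
  shows "opn (p \<otimes>\<^bsub>unitization\<^esub> q) \<le> opn p * opn q"
proof (rule opn_least)
  fix y assume y: "y \<in> carrier A"
  have "nrm A (lmul p (lmul q y)) \<le> opn p * (opn q * nrm A y)"
    using nrm_lmul_le[OF assms(1) lmul_closed[OF assms(2) y]] mult_left_mono[OF nrm_lmul_le[OF assms(2) y] opn_nonneg[OF assms(1)]]
    by linarith
  then show "nrm A (lmul (p \<otimes>\<^bsub>unitization\<^esub> q) y) \<le> opn p * opn q * nrm A y"
    by (simp only: lmul_mult[OF assms y] mult.assoc)
qed (use assms opn_nonneg in auto)

lemma opn_add:
  assumes "snd p \<in> carrier A" "snd q \<in> carrier A"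
  shows "opn (p \<oplus>\<^bsub>unitization\<^esub> q) \<le> opn p + opn q"
proof (rule opn_least)
  fix y assume y: "y \<in> carrier A"
  show "nrm A (lmul (p \<oplus>\<^bsub>unitization\<^esub> q) y) \<le> (opn p + opn q) * nrm A y"
    unfolding lmul_add[OF assms y] using nrm_triangle[OF lmul_closed[OF assms(1) y] lmul_closed[OF assms(2) y]]
      nrm_lmul_le[OF assms(1) y] nrm_lmul_le[OF assms(2) y] by (simp add: distrib_right)
qed (use assms opn_nonneg in auto)

lemma opn_smult:
  assumes "snd p \<in> carrier A" shows "opn (c \<odot>\<^bsub>unitization\<^esub> p) = cmod c * opn p"
proof -
  have eq: "lmul (c \<odot>\<^bsub>unitization\<^esub> q) y = c \<odot> lmul q y" if "snd q \<in> carrier A" "y \<in> carrier A" for q y c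
    using that by (simp add: lmul_def smult_r_distr smult_closed mult_closed smult_mult_left smult_assoc[symmetric])
  have le: "opn (c \<odot>\<^bsub>unitization\<^esub> q) \<le> cmod c * opn q" if q: "snd q \<in> carrier A" for q c
    using nrm_lmul_le[OF q] opn_nonneg[OF q]
    by (intro opn_least) (auto simp: eq[OF q, simplified] nrm_smult lmul_closed q mult.assoc intro!: mult_left_mono)
  show ?thesis
  proof (cases "c = 0")
    case True
    then show ?thesis using le[OF assms, of 0] opn_nonneg[of "0 \<odot>\<^bsub>unitization\<^esub> p"] assms by (simp add: smult_closed)
  next
    case False
    have "(1 / c) \<odot>\<^bsub>unitization\<^esub> (c \<odot>\<^bsub>unitization\<^esub> p) = p" using False assms
      by (cases p) (simp add: smult_assoc[symmetric] smult_one)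
    then have "opn p \<le> cmod (1 / c) * opn (c \<odot>\<^bsub>unitization\<^esub> p)"
      using le[of "c \<odot>\<^bsub>unitization\<^esub> p" "1 / c"] assms by (simp add: smult_closed)
    then show ?thesis using le[OF assms, of c] False by (simp add: norm_divide field_simps)
  qed
qed

text \<open>\<open>(p y)\<^sup>* (p y) = y\<^sup>* (p\<^sup>* p) y\<close>, so the C*-identity in
  \<open>A\<close> bounds the square of the norm of \<open>p y\<close> through the operator norm of
  \<open>p\<^sup>* p\<close>.\<close>

lemma opn_cstar_le:
  assumes "snd p \<in> carrier A" shows "(opn p)\<^sup>2 \<le> opn (adj unitization p \<otimes>\<^bsub>unitization\<^esub> p)"
proof -
  let ?q = "adj unitization p \<otimes>\<^bsub>unitization\<^esub> p"
  have ap: "snd (adj unitization p) \<in> carrier A" and qc: "snd ?q \<in> carrier A" using assms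
    by (auto simp: adj_closed smult_closed mult_closed)
  have "opn p \<le> sqrt (opn ?q)"
  proof (rule opn_least)
    fix y assume y: "y \<in> carrier A"
    note c = lmul_closed[OF assms y]
    have "(nrm A (lmul p y))\<^sup>2 = nrm A (adj A y \<otimes> lmul ?q y)"
      using cstar_identity[OF c] lmul_adj[OF assms y c] lmul_mult[OF ap assms y] by (simp only:)
    also have "\<dots> \<le> nrm A y * (opn ?q * nrm A y)"
      using nrm_mult[of "adj A y" "lmul ?q y"] nrm_lmul_le[OF qc y] y lmul_closed[OF qc y] nrm_nonneg[OF y]
      by (smt (verit) adj_closed mult_left_mono nrm_adj)
    also have "\<dots> = (sqrt (opn ?q) * nrm A y)\<^sup>2"
      using opn_nonneg[OF qc] by (simp add: power_mult_distrib power2_eq_square[of "nrm A y"])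
    finally show "nrm A (lmul p y) \<le> sqrt (opn ?q) * nrm A y"
      using opn_nonneg[OF qc] nrm_nonneg[OF y] by (auto intro: power2_le_imp_le)
  qed (use opn_nonneg[OF qc] in auto)
  then have "(opn p)\<^sup>2 \<le> (sqrt (opn ?q))\<^sup>2" using opn_nonneg[OF assms] by (intro power_mono) auto
  then show ?thesis using opn_nonneg[OF qc] by simp
qed

lemma opn_adj:
  assumes "snd p \<in> carrier A" shows "opn (adj unitization p) = opn p"
proof -
  have le: "opn q \<le> opn (adj unitization q)" if q: "snd q \<in> carrier A" for q
  proof (cases "opn q = 0")
    case True then show ?thesis using opn_nonneg[of "adj unitization q"] q by (simp add: adj_closed)
  next
    case False
    have "snd (adj unitization q) \<in> carrier A" using q by (simp add: adj_closed)
    from order_trans[OF opn_cstar_le[OF q] opn_mult[OF this q]]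
    show ?thesis using opn_nonneg[OF q] False by (simp add: power2_eq_square)
  qed
  have "adj unitization (adj unitization p) = p" using assms by (cases p) (simp add: adj_adj)
  then show ?thesis using le[OF assms] le[of "adj unitization p"] assms by (simp add: adj_closed)
qed

lemma opn_cstar:
  assumes "snd p \<in> carrier A" shows "opn (adj unitization p \<otimes>\<^bsub>unitization\<^esub> p) = (opn p)\<^sup>2"
proof (rule antisym[OF _ opn_cstar_le[OF assms]])
  have "snd (adj unitization p) \<in> carrier A" using assms by (simp add: adj_closed)
  from opn_mult[OF this assms] show "opn (adj unitization p \<otimes>\<^bsub>unitization\<^esub> p) \<le> (opn p)\<^sup>2"
    by (simp only: opn_adj[OF assms] power2_eq_square)
qed

lemma unitization_abelian_group: "abelian_group unitization"
proof (rule abelian_groupI)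
  fix p assume "p \<in> carrier unitization"
  then show "\<exists>q\<in>carrier unitization. q \<oplus>\<^bsub>unitization\<^esub> p = \<zero>\<^bsub>unitization\<^esub>"
    by (intro bexI[of _ "(- fst p, \<ominus> snd p)"]) (auto simp: l_neg)
qed (auto simp: a_ac)

lemma unitization_minus:
  assumes "p \<in> carrier unitization" "q \<in> carrier unitization"
  shows "p \<ominus>\<^bsub>unitization\<^esub> q = (fst p - fst q, snd p \<ominus> snd q)"
proof -
  interpret U: abelian_group unitization by (rule unitization_abelian_group)
  have "\<ominus>\<^bsub>unitization\<^esub> q = (- fst q, \<ominus> snd q)"
    using assms by (intro U.minus_equality) (auto simp: l_neg)
  then show ?thesis using assms by (simp add: U.minus_eq minus_eq)
qed

text \<open>The norm controls the scalar parts directly. Subtracting the scalar part costs its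
  modulus once more, so a difference of norm below \<open>e\<close> has an algebra part of norm
  below \<open>2 * e\<close>. Both components are then Cauchy and converge separately.\<close>

lemma unitization_complete:
  assumes X: "\<And>n. X n \<in> carrier unitization"
    and Cau: "\<And>e. e > 0 \<Longrightarrow> \<exists>N. \<forall>m\<ge>N. \<forall>n\<ge>N. nrm unitization (X m \<ominus>\<^bsub>unitization\<^esub> X n) < e"
  shows "\<exists>p\<in>carrier unitization. (\<lambda>n. nrm unitization (X n \<ominus>\<^bsub>unitization\<^esub> p)) \<longlonglongrightarrow> 0"
proof -
  have Xc: "snd (X n) \<in> carrier A" for n using X[of n] by auto
  have bounds: "cmod (fst (X m) - fst (X n)) < e \<and> nrm A (snd (X m) \<ominus> snd (X n)) < 2 * e"
    if "nrm unitization (X m \<ominus>\<^bsub>unitization\<^esub> X n) < e" for m n e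
  proof -
    let ?l = "fst (X m) - fst (X n)" and ?x = "snd (X m) \<ominus> snd (X n)"
    have xc: "?x \<in> carrier A" using Xc by simp
    have "X m \<ominus>\<^bsub>unitization\<^esub> X n = (?l, ?x)" by (rule unitization_minus[OF X X])
    then have 1: "cmod ?l < e" "opn (?l, ?x) < e" using that by auto
    have "nrm A ?x = opn ((?l, ?x) \<oplus>\<^bsub>unitization\<^esub> (- ?l, \<zero>))"
      using xc by (simp add: opn_embed)
    also have "\<dots> \<le> opn (?l, ?x) + opn (- ?l, \<zero>)" using xc by (intro opn_add) auto
    also have "opn (- ?l, \<zero>) \<le> cmod ?l" using opn_le_sum[of "(- ?l, \<zero>)"] by (simp add: norm_minus_commute)
    finally show ?thesis using 1 by (intro conjI) linarith+
  qed
  have "Cauchy (\<lambda>n. fst (X n))"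
    unfolding Cauchy_def dist_norm
  proof (intro allI impI)
    fix e :: real assume "e > 0"
    then obtain N where "\<forall>m\<ge>N. \<forall>n\<ge>N. nrm unitization (X m \<ominus>\<^bsub>unitization\<^esub> X n) < e"
      using Cau by blast
    then show "\<exists>N. \<forall>m\<ge>N. \<forall>n\<ge>N. cmod (fst (X m) - fst (X n)) < e" using bounds by blast
  qed
  then obtain l where l: "(\<lambda>n. fst (X n)) \<longlonglongrightarrow> l" using Cauchy_convergent convergent_def by blast
  have "\<exists>N. \<forall>m\<ge>N. \<forall>n\<ge>N. nrm A (snd (X m) \<ominus> snd (X n)) < e" if e: "e > 0" for e
  proof -
    obtain N where "\<forall>m\<ge>N. \<forall>n\<ge>N. nrm unitization (X m \<ominus>\<^bsub>unitization\<^esub> X n) < e / 2"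
      using Cau[OF half_gt_zero[OF e]] by blast
    then have "\<forall>m\<ge>N. \<forall>n\<ge>N. nrm A (snd (X m) \<ominus> snd (X n)) < 2 * (e / 2)" using bounds by blast
    then show ?thesis by auto
  qed
  from complete[of "\<lambda>n. snd (X n)", OF Xc this]
  obtain x where x: "x \<in> carrier A" "(\<lambda>n. nrm A (snd (X n) \<ominus> x)) \<longlonglongrightarrow> 0" by blast
  have lim: "(\<lambda>n. cmod (fst (X n) - l) + nrm A (snd (X n) \<ominus> x)) \<longlonglongrightarrow> 0 + 0"
    using l x(2) by (intro tendsto_add) (auto simp: LIM_zero_iff tendsto_norm_zero_iff)
  have eq: "X n \<ominus>\<^bsub>unitization\<^esub> (l, x) = (fst (X n) - l, snd (X n) \<ominus> x)" for n
    using unitization_minus[OF X, of "(l, x)" n] x(1) by simp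
  have le: "nrm unitization (X n \<ominus>\<^bsub>unitization\<^esub> (l, x)) \<le> cmod (fst (X n) - l) + nrm A (snd (X n) \<ominus> x)" for n
    using opn_le_sum[of "(fst (X n) - l, snd (X n) \<ominus> x)"] nrm_nonneg[of "snd (X n) \<ominus> x"] Xc[of n] x(1)
    unfolding eq by simp
  have ge: "0 \<le> nrm unitization (X n \<ominus>\<^bsub>unitization\<^esub> (l, x))" for n
    unfolding eq by (simp add: le_max_iff_disj)
  have "(\<lambda>n. nrm unitization (X n \<ominus>\<^bsub>unitization\<^esub> (l, x))) \<longlonglongrightarrow> 0"
    using lim by (intro tendsto_sandwich[OF always_eventually[OF allI[OF ge]] always_eventually[OF allI[OF le]] tendsto_const]) simp
  moreover have "(l, x) \<in> carrier unitization" using x(1) by simp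
  ultimately show ?thesis by (rule bexI)
qed

lemma unitization_unital: "unital_cstar_algebra unitization"
proof -
  interpret U: abelian_group unitization by (rule unitization_abelian_group)
  show ?thesis
  proof unfold_locales
    fix p q r c d
    assume p: "p \<in> carrier unitization"
    then have pc: "snd p \<in> carrier A" by auto
    show "c \<odot>\<^bsub>unitization\<^esub> p \<in> carrier unitization" using pc by (simp add: smult_closed)
    show "(c + d) \<odot>\<^bsub>unitization\<^esub> p = c \<odot>\<^bsub>unitization\<^esub> p \<oplus>\<^bsub>unitization\<^esub> d \<odot>\<^bsub>unitization\<^esub> p"
      using pc by (simp add: smult_l_distr distrib_right)
    show "(c * d) \<odot>\<^bsub>unitization\<^esub> p = c \<odot>\<^bsub>unitization\<^esub> (d \<odot>\<^bsub>unitization\<^esub> p)"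
      using pc by (simp add: smult_assoc)
    show "1 \<odot>\<^bsub>unitization\<^esub> p = p" "\<one>\<^bsub>unitization\<^esub> \<otimes>\<^bsub>unitization\<^esub> p = p" "p \<otimes>\<^bsub>unitization\<^esub> \<one>\<^bsub>unitization\<^esub> = p"
      using pc by (simp_all add: smult_one smult_closed)
    show "adj unitization p \<in> carrier unitization" using pc by (simp add: adj_closed)
    show "adj unitization (c \<odot>\<^bsub>unitization\<^esub> p) = cnj c \<odot>\<^bsub>unitization\<^esub> adj unitization p"
      using pc by (simp add: adj_smult)
    show "adj unitization (adj unitization p) = p" using pc by (simp add: adj_adj)
    show "nrm unitization p = 0 \<longleftrightarrow> p = \<zero>\<^bsub>unitization\<^esub>"
    proof
      assume "nrm unitization p = 0"
      then have "fst p = 0" "opn p = 0" using opn_nonneg[OF pc] by (auto simp: max_def split: if_splits)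
      then show "p = \<zero>\<^bsub>unitization\<^esub>" using opn_embed[OF pc] pc by (cases p) (auto simp: nrm_eq_zero)
    qed (simp add: opn_embed)
    show "nrm unitization (c \<odot>\<^bsub>unitization\<^esub> p) = cmod c * nrm unitization p"
      using opn_smult[OF pc, of c] by (simp add: norm_mult max_mult_distrib_left)
    show "nrm unitization (adj unitization p \<otimes>\<^bsub>unitization\<^esub> p) = (nrm unitization p)\<^sup>2"
    proof -
      have "nrm unitization (adj unitization p \<otimes>\<^bsub>unitization\<^esub> p) =
          max ((cmod (fst p))\<^sup>2) (opn (adj unitization p \<otimes>\<^bsub>unitization\<^esub> p))"
        by (simp add: norm_mult power2_eq_square)
      also have "\<dots> = (max (cmod (fst p)) (opn p))\<^sup>2"
        unfolding opn_cstar[OF pc] using opn_nonneg[OF pc] by (auto simp: max_def power_mono dest: power2_le_imp_le)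
      finally show ?thesis by simp
    qed
    assume q: "q \<in> carrier unitization"
    then have qc: "snd q \<in> carrier A" by auto
    show "c \<odot>\<^bsub>unitization\<^esub> (p \<oplus>\<^bsub>unitization\<^esub> q) = c \<odot>\<^bsub>unitization\<^esub> p \<oplus>\<^bsub>unitization\<^esub> c \<odot>\<^bsub>unitization\<^esub> q"
      using pc qc by (simp add: smult_r_distr distrib_left)
    show "p \<otimes>\<^bsub>unitization\<^esub> q \<in> carrier unitization"
      using pc qc by (simp add: smult_closed mult_closed)
    show "adj unitization (p \<oplus>\<^bsub>unitization\<^esub> q) = adj unitization p \<oplus>\<^bsub>unitization\<^esub> adj unitization q"
      using pc qc by (simp add: adj_add)
    show "nrm unitization (p \<oplus>\<^bsub>unitization\<^esub> q) \<le> nrm unitization p + nrm unitization q"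
      using opn_add[OF pc qc] norm_triangle_ineq[of "fst p" "fst q"] by (auto simp: max_def)
    show "nrm unitization (p \<otimes>\<^bsub>unitization\<^esub> q) \<le> nrm unitization p * nrm unitization q"
    proof -
      have "cmod (fst p * fst q) \<le> max (cmod (fst p)) (opn p) * max (cmod (fst q)) (opn q)"
        unfolding norm_mult by (intro mult_mono) (auto simp: le_max_iff_disj)
      moreover have "opn (p \<otimes>\<^bsub>unitization\<^esub> q) \<le> max (cmod (fst p)) (opn p) * max (cmod (fst q)) (opn q)"
        using opn_nonneg[OF pc] opn_nonneg[OF qc]
        by (intro order_trans[OF opn_mult[OF pc qc]] mult_mono) (auto simp: le_max_iff_disj)
      ultimately show ?thesis by simp
    qed
    show "adj unitization (p \<otimes>\<^bsub>unitization\<^esub> q) = adj unitization q \<otimes>\<^bsub>unitization\<^esub> adj unitization p"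
      using pc qc by (simp add: adj_add adj_smult adj_mult smult_closed mult_closed adj_closed a_ac)
    show "(c \<odot>\<^bsub>unitization\<^esub> p) \<otimes>\<^bsub>unitization\<^esub> q = c \<odot>\<^bsub>unitization\<^esub> (p \<otimes>\<^bsub>unitization\<^esub> q)"
      and "p \<otimes>\<^bsub>unitization\<^esub> (c \<odot>\<^bsub>unitization\<^esub> q) = c \<odot>\<^bsub>unitization\<^esub> (p \<otimes>\<^bsub>unitization\<^esub> q)"
      using pc qc by (simp_all add: smult_r_distr smult_closed mult_closed smult_mult_left smult_mult_right
        smult_assoc[symmetric] mult.commute mult.left_commute)
    assume r: "r \<in> carrier unitization"
    then have rc: "snd r \<in> carrier A" by auto
    show "(p \<otimes>\<^bsub>unitization\<^esub> q) \<otimes>\<^bsub>unitization\<^esub> r = p \<otimes>\<^bsub>unitization\<^esub> (q \<otimes>\<^bsub>unitization\<^esub> r)"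
      using pc qc rc by (simp add: smult_r_distr smult_closed mult_closed smult_mult_left smult_mult_right
        mult_l_distr mult_r_distr mult_assoc smult_assoc[symmetric] a_ac mult.commute mult.left_commute)
    show "(p \<oplus>\<^bsub>unitization\<^esub> q) \<otimes>\<^bsub>unitization\<^esub> r = p \<otimes>\<^bsub>unitization\<^esub> r \<oplus>\<^bsub>unitization\<^esub> q \<otimes>\<^bsub>unitization\<^esub> r"
      and "r \<otimes>\<^bsub>unitization\<^esub> (p \<oplus>\<^bsub>unitization\<^esub> q) = r \<otimes>\<^bsub>unitization\<^esub> p \<oplus>\<^bsub>unitization\<^esub> r \<otimes>\<^bsub>unitization\<^esub> q"
      using pc qc rc by (simp_all add: smult_l_distr smult_r_distr smult_closed mult_closed
        mult_l_distr mult_r_distr distrib_left distrib_right a_ac)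
  next
    fix X :: "nat \<Rightarrow> complex \<times> 'a"
    assume "\<And>n. X n \<in> carrier unitization"
      and "\<And>e. e > 0 \<Longrightarrow> \<exists>N. \<forall>m\<ge>N. \<forall>n\<ge>N. nrm unitization (X m \<ominus>\<^bsub>unitization\<^esub> X n) < e"
    then show "\<exists>x\<in>carrier unitization. (\<lambda>n. nrm unitization (X n \<ominus>\<^bsub>unitization\<^esub> x)) \<longlonglongrightarrow> 0"
      by (rule unitization_complete)
  qed simp
qed

text \<open>The unit that the positivity argument works with is supplied by the unitization; the
  embedding of \<open>x\<close> as \<open>(0, x)\<close> carries sums and squares over.\<close>

lemma sum_squares_eq_zeroD:
  assumes "finite I" "\<And>i. i \<in> I \<Longrightarrow> f i \<in> carrier A" "z \<in> carrier A" "y \<in> carrier A"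
    and sum: "(\<Oplus>i\<in>I. adj A (f i) \<otimes> f i) \<oplus> adj A z \<otimes> z \<oplus> adj A y \<otimes> y = \<zero>"
  shows "y = \<zero>"
proof -
  interpret U: unital_cstar_algebra unitization by (rule unitization_unital)
  have g: "(0, \<Oplus>i\<in>I. adj A (f i) \<otimes> f i) = (\<Oplus>\<^bsub>unitization\<^esub>i\<in>I. (0, adj A (f i) \<otimes> f i))"
    using assms(1,2) U.abelian_group_axioms
    by (intro finsum_additive[of I "\<lambda>i. adj A (f i) \<otimes> f i" "\<lambda>x. (0, x)" unitization]) (auto simp: mult_closed adj_closed)
  have "(\<Oplus>\<^bsub>unitization\<^esub>i\<in>I. adj unitization (0, f i) \<otimes>\<^bsub>unitization\<^esub> (0, f i)) = (\<Oplus>\<^bsub>unitization\<^esub>i\<in>I. (0, adj A (f i) \<otimes> f i))"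
    using assms(2) by (intro U.finsum_cong') (auto simp: adj_closed mult_closed)
  note eq = this
  have "(0, y) = \<zero>\<^bsub>unitization\<^esub>"
    by (rule U.eq_zero_if_sum_squares_eq_zero[of I "\<lambda>i. (0, f i)" "(0, z)"])
      (use assms g[symmetric] eq in \<open>auto simp: adj_closed mult_closed\<close>)
  then show ?thesis by simp
qed

section \<open>Projections below a projection\<close>

lemma projectionD:
  assumes "projection A p" shows "p \<in> carrier A" "adj A p = p" "p \<otimes> p = p"
  using assms by (auto simp: projection_def)

text \<open>The identity that writes \<open>q\<close> as the sum of the \<open>p i\<close> and
  \<open>b\<^sup>* b\<close> is compressed, and the resulting squares vanish term by term.
  Compression by \<open>1 - q\<close> kills \<open>q\<close>, so every \<open>p i\<close> is zero on
  the complement of \<open>q\<close>. Compression by \<open>p j\<close> maps both \<open>q\<close>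
  and \<open>p j\<close> to \<open>p j\<close>, so the remaining terms add up to zero, among them
  \<open>p j p i p j\<close>.\<close>

lemma
  assumes q: "projection A q" and I: "finite I" and p: "\<And>i. i \<in> I \<Longrightarrow> projection A (p i)"
    and b: "b \<in> carrier A" "q \<ominus> (\<Oplus>i\<in>I. p i) = adj A b \<otimes> b"
  shows projection_sum_le_absorb: "i \<in> I \<Longrightarrow> q \<otimes> p i = p i"
    and projection_sum_le_orthogonal: "i \<in> I \<Longrightarrow> j \<in> I \<Longrightarrow> i \<noteq> j \<Longrightarrow> p i \<otimes> p j = \<zero>"
proof -
  note q = projectionD[OF q]
  have p: "p i \<in> carrier A" "adj A (p i) = p i" "p i \<otimes> p i = p i" if "i \<in> I" for i
    using projectionD[OF p[OF that]] by auto
  have sc: "(\<Oplus>i\<in>J. p i) \<in> carrier A" if "J \<subseteq> I" for J using that p by (auto intro!: finsum_closed')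
  have dc: "q = (\<Oplus>i\<in>I. p i) \<oplus> adj A b \<otimes> b"
    unfolding b(2)[symmetric] using q(1) sc[OF order.refl] by algebra
  have split: "(\<Oplus>i\<in>J. p i) = (\<Oplus>i\<in>J - {i}. p i) \<oplus> p i" if "J \<subseteq> I" "i \<in> J" for i J
  proof -
    have "(\<Oplus>i\<in>insert i (J - {i}). p i) = p i \<oplus> (\<Oplus>i\<in>J - {i}. p i)"
      using that I p by (intro finsum_insert) (auto intro: finite_subset)
    then show ?thesis using a_comm[OF p(1), of i "\<Oplus>i\<in>J - {i}. p i"] that sc[of "J - {i}"] by (auto simp: insert_absorb)
  qed
  have absorb: "q \<otimes> p i = p i" if i: "i \<in> I" for i
  proof -
    \<comment> \<open>This is \<open>(1 - q) x (1 - q)\<close> multiplied out, as the algebra need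
      not have a unit.\<close>
    define h where "h x = x \<ominus> x \<otimes> q \<ominus> q \<otimes> x \<oplus> q \<otimes> x \<otimes> q" for x
    have hc: "h x \<in> carrier A" if "x \<in> carrier A" for x using that q by (simp add: h_def mult_closed)
    have h_add: "h (x \<oplus> y) = h x \<oplus> h y" if "x \<in> carrier A" "y \<in> carrier A" for x y
      unfolding h_def using that q(1) by algebra
    have hx: "h (adj A x \<otimes> x) = adj A (x \<ominus> x \<otimes> q) \<otimes> (x \<ominus> x \<otimes> q)" if "x \<in> carrier A" for x
      unfolding h_def using that q(1,2) by algebra
    have hp: "h (p j) = adj A (p j \<ominus> p j \<otimes> q) \<otimes> (p j \<ominus> p j \<otimes> q)" if "j \<in> I" for j
      using hx[OF p(1)[OF that]] p[OF that] by simp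
    have S: "h (\<Oplus>j\<in>I - {i}. p j) = (\<Oplus>j\<in>I - {i}. h (p j))"
      using I p hc h_add abelian_group_axioms by (intro finsum_additive[of "I - {i}" p h A]) auto
    also have "\<dots> = (\<Oplus>j\<in>I - {i}. adj A (p j \<ominus> p j \<otimes> q) \<otimes> (p j \<ominus> p j \<otimes> q))"
      using p q by (intro finsum_cong') (auto simp: hp mult_closed adj_closed)
    finally have S: "h (\<Oplus>j\<in>I - {i}. p j) = (\<Oplus>j\<in>I - {i}. adj A (p j \<ominus> p j \<otimes> q) \<otimes> (p j \<ominus> p j \<otimes> q))" .
    have "q = (\<Oplus>j\<in>I - {i}. p j) \<oplus> adj A b \<otimes> b \<oplus> p i"
      unfolding split[OF order.refl i, symmetric]
      using trans[OF dc arg_cong2[OF split[OF order.refl i] refl, of "(\<oplus>)"]] sc[of "I - {i}"] p(1)[OF i] b(1)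
      by (simp only: a_assoc a_comm[of "p i"] mult_closed adj_closed Diff_subset)
    moreover have "h q = \<zero>" unfolding h_def using q by (simp add: minus_eq r_neg l_neg a_assoc minus_add)
    ultimately have "\<zero> = h ((\<Oplus>j\<in>I - {i}. p j) \<oplus> adj A b \<otimes> b \<oplus> p i)" by simp
    also have "\<dots> = h (\<Oplus>j\<in>I - {i}. p j) \<oplus> h (adj A b \<otimes> b) \<oplus> h (p i)"
      using sc[of "I - {i}"] p[OF i] b(1) by (simp add: h_add mult_closed adj_closed)
    finally have "(\<Oplus>j\<in>I - {i}. adj A (p j \<ominus> p j \<otimes> q) \<otimes> (p j \<ominus> p j \<otimes> q))
        \<oplus> adj A (b \<ominus> b \<otimes> q) \<otimes> (b \<ominus> b \<otimes> q) \<oplus> adj A (p i \<ominus> p i \<otimes> q) \<otimes> (p i \<ominus> p i \<otimes> q) = \<zero>"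
      unfolding S hx[OF b(1)] hp[OF i] by simp
    note sum0 = this
    have "p i \<ominus> p i \<otimes> q = \<zero>"
      by (rule sum_squares_eq_zeroD[OF _ _ _ _ sum0]) (use I p q i b(1) in \<open>auto simp: mult_closed\<close>)
    then have "p i = p i \<otimes> q" using p[OF i] q mult_closed minus_eq_zeroD by blast
    then have "adj A (p i \<otimes> q) = p i" using p[OF i] by simp
    then show ?thesis using p[OF i] q by (simp add: adj_mult)
  qed
  then show "i \<in> I \<Longrightarrow> q \<otimes> p i = p i" .
  assume i: "i \<in> I" and j: "j \<in> I" and ij: "i \<noteq> j"
  define h where "h x = p j \<otimes> x \<otimes> p j" for x
  have hc: "h x \<in> carrier A" if "x \<in> carrier A" for x using that p j by (simp add: h_def mult_closed)
  have h_add: "h (x \<oplus> y) = h x \<oplus> h y" if "x \<in> carrier A" "y \<in> carrier A" for x y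
    unfolding h_def using that p(1)[OF j] by algebra
  have hx: "h (adj A x \<otimes> x) = adj A (x \<otimes> p j) \<otimes> (x \<otimes> p j)" if "x \<in> carrier A" for x
    unfolding h_def using that p(1,2)[OF j] by algebra
  have hp: "h (p k) = adj A (p k \<otimes> p j) \<otimes> (p k \<otimes> p j)" if "k \<in> I" for k
    using hx[OF p(1)[OF that]] p[OF that] by simp
  \<comment> \<open>With \<open>j\<close> cancelled and \<open>i\<close> removed from the sum,
    \<open>p i\<close> becomes the separate term to which \<open>sum_squares_eq_zeroD\<close>
    applies.\<close>
  let ?J = "I - {j} - {i}"
  have S: "h (\<Oplus>k\<in>?J. p k) = (\<Oplus>k\<in>?J. h (p k))"
    using I p hc h_add abelian_group_axioms by (intro finsum_additive[of ?J p h A]) auto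
  also have "\<dots> = (\<Oplus>k\<in>?J. adj A (p k \<otimes> p j) \<otimes> (p k \<otimes> p j))"
    using p j by (intro finsum_cong') (auto simp: hp mult_closed adj_closed)
  finally have S: "h (\<Oplus>k\<in>?J. p k) = (\<Oplus>k\<in>?J. adj A (p k \<otimes> p j) \<otimes> (p k \<otimes> p j))" .
  have sJ: "(\<Oplus>k\<in>?J. p k) \<in> carrier A" by (rule sc) auto
  have "q = (\<Oplus>k\<in>?J. p k) \<oplus> p i \<oplus> p j \<oplus> adj A b \<otimes> b"
    using dc split[OF order.refl j] split[of "I - {j}" i] i ij by auto
  also have "\<dots> = ((\<Oplus>k\<in>?J. p k) \<oplus> adj A b \<otimes> b \<oplus> p i) \<oplus> p j"
    using sJ p(1)[OF i] p(1)[OF j] b(1) by (simp add: a_ac mult_closed adj_closed)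
  finally have "h q = h ((\<Oplus>k\<in>?J. p k) \<oplus> adj A b \<otimes> b \<oplus> p i) \<oplus> h (p j)"
    using h_add sJ p(1)[OF i] p(1)[OF j] b(1) by (simp add: mult_closed adj_closed)
  moreover have "h q = p j" using absorb[OF j] p[OF j] q by (simp add: h_def mult_assoc)
  moreover have "h (p j) = p j" using p[OF j] by (simp add: h_def)
  ultimately have e: "h ((\<Oplus>k\<in>?J. p k) \<oplus> adj A b \<otimes> b \<oplus> p i) \<oplus> p j = p j" by simp
  have "h ((\<Oplus>k\<in>?J. p k) \<oplus> adj A b \<otimes> b \<oplus> p i) = \<zero>"
    using e p(1)[OF j] hc sJ p(1)[OF i] b(1) by (simp add: mult_closed adj_closed)
  then have "(\<Oplus>k\<in>?J. adj A (p k \<otimes> p j) \<otimes> (p k \<otimes> p j)) \<oplus> adj A (b \<otimes> p j) \<otimes> (b \<otimes> p j)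
      \<oplus> adj A (p i \<otimes> p j) \<otimes> (p i \<otimes> p j) = \<zero>"
    unfolding S[symmetric] hx[OF b(1), symmetric] hp[OF i, symmetric]
    using h_add sJ p(1)[OF i] b(1) by (simp add: mult_closed adj_closed)
  note sum0 = this
  show "p i \<otimes> p j = \<zero>"
    by (rule sum_squares_eq_zeroD[OF _ _ _ _ sum0]) (use I p i j b(1) in \<open>auto simp: mult_closed\<close>)
qed

end

section \<open>Star homomorphisms\<close>

locale star_homomorphism = A: cstar_algebra A + B: cstar_algebra B
  for A :: "'a cstar" and B :: "'b cstar" +
  fixes f :: "'a \<Rightarrow> 'b"
  assumes star_hom: "star_hom A B f"
begin

lemma closed: "x \<in> carrier A \<Longrightarrow> f x \<in> carrier B"
  and add: "x \<in> carrier A \<Longrightarrow> y \<in> carrier A \<Longrightarrow> f (x \<oplus>\<^bsub>A\<^esub> y) = f x \<oplus>\<^bsub>B\<^esub> f y"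
  and mult: "x \<in> carrier A \<Longrightarrow> y \<in> carrier A \<Longrightarrow> f (x \<otimes>\<^bsub>A\<^esub> y) = f x \<otimes>\<^bsub>B\<^esub> f y"
  and smult: "x \<in> carrier A \<Longrightarrow> f (c \<odot>\<^bsub>A\<^esub> x) = c \<odot>\<^bsub>B\<^esub> f x"
  and adj: "x \<in> carrier A \<Longrightarrow> f (adj A x) = adj B (f x)"
  using star_hom by (auto simp: star_hom_def)

lemma zero: "f \<zero>\<^bsub>A\<^esub> = \<zero>\<^bsub>B\<^esub>"
  using smult[of "\<zero>\<^bsub>A\<^esub>" 0] closed[of "\<zero>\<^bsub>A\<^esub>"] by simp

lemma minus: "x \<in> carrier A \<Longrightarrow> y \<in> carrier A \<Longrightarrow> f (x \<ominus>\<^bsub>A\<^esub> y) = f x \<ominus>\<^bsub>B\<^esub> f y"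
  using add[of x "(- 1) \<odot>\<^bsub>A\<^esub> y"] smult[of y "- 1"] closed
  by (simp add: A.minus_eq B.minus_eq A.smult_minus_left B.smult_minus_left A.smult_one B.smult_one A.smult_closed)

lemma finsum:
  assumes "finite I" "\<And>i. i \<in> I \<Longrightarrow> g i \<in> carrier A"
  shows "f (finsum A g I) = (\<Oplus>\<^bsub>B\<^esub>i\<in>I. f (g i))"
  using assms closed add B.abelian_group_axioms by (intro A.finsum_additive[of I g f B]) auto

text \<open>A self-adjoint contraction \<open>h\<close> has a complement \<open>k = (l, x)\<close>
  in the unitization. Applying \<open>f\<close> to the algebra parts and leaving scalars fixed
  preserves the relation \<open>k k + h h = 1\<close> and commutation, so \<open>f h\<close> is
  again part of a sum of two squares equal to one.\<close>

lemma nrm_le_one_self_adj: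
  assumes h: "h \<in> carrier A" "adj A h = h" "nrm A h \<le> 1"
  shows "nrm B (f h) \<le> 1"
proof -
  interpret UA: unital_cstar_algebra A.unitization by (rule A.unitization_unital)
  interpret UB: unital_cstar_algebra B.unitization by (rule B.unitization_unital)
  obtain k where k: "k \<in> carrier A.unitization" "adj A.unitization k = k"
    "k \<otimes>\<^bsub>A.unitization\<^esub> (0, h) = (0, h) \<otimes>\<^bsub>A.unitization\<^esub> k"
    "k \<otimes>\<^bsub>A.unitization\<^esub> k \<oplus>\<^bsub>A.unitization\<^esub> (0, h) \<otimes>\<^bsub>A.unitization\<^esub> (0, h) = \<one>\<^bsub>A.unitization\<^esub>"
    using UA.self_adj_contraction_complement[of "(0, h)"] h by (auto simp: A.opn_embed)
  obtain l x where kx: "k = (l, x)" "x \<in> carrier A" using k(1) by auto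
  let ?k = "(l, f x)" and ?h = "(0, f h)"
  have "?h \<otimes>\<^bsub>B.unitization\<^esub> ?k = ?k \<otimes>\<^bsub>B.unitization\<^esub> ?h"
  proof -
    have "x \<otimes>\<^bsub>A\<^esub> h = h \<otimes>\<^bsub>A\<^esub> x"
      using k(3) kx(2) h(1) by (simp add: kx A.smult_closed A.mult_closed)
    then have "f x \<otimes>\<^bsub>B\<^esub> f h = f h \<otimes>\<^bsub>B\<^esub> f x" using kx(2) h(1) by (metis mult)
    then show ?thesis using kx(2) h(1) by (simp add: B.smult_closed B.mult_closed closed)
  qed
  moreover have "?h \<otimes>\<^bsub>B.unitization\<^esub> ?h \<oplus>\<^bsub>B.unitization\<^esub> ?k \<otimes>\<^bsub>B.unitization\<^esub> ?k = of_real 1 \<odot>\<^bsub>B.unitization\<^esub> \<one>\<^bsub>B.unitization\<^esub>"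
  proof -
    have l: "l * l = 1" and e: "(l \<odot>\<^bsub>A\<^esub> x \<oplus>\<^bsub>A\<^esub> l \<odot>\<^bsub>A\<^esub> x \<oplus>\<^bsub>A\<^esub> x \<otimes>\<^bsub>A\<^esub> x) \<oplus>\<^bsub>A\<^esub> h \<otimes>\<^bsub>A\<^esub> h = \<zero>\<^bsub>A\<^esub>"
      using k(4) kx h by (auto simp: A.mult_closed)
    from e have "f ((l \<odot>\<^bsub>A\<^esub> x \<oplus>\<^bsub>A\<^esub> l \<odot>\<^bsub>A\<^esub> x \<oplus>\<^bsub>A\<^esub> x \<otimes>\<^bsub>A\<^esub> x) \<oplus>\<^bsub>A\<^esub> h \<otimes>\<^bsub>A\<^esub> h) = \<zero>\<^bsub>B\<^esub>" by (simp add: zero)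
    then have "(l \<odot>\<^bsub>B\<^esub> f x \<oplus>\<^bsub>B\<^esub> l \<odot>\<^bsub>B\<^esub> f x \<oplus>\<^bsub>B\<^esub> f x \<otimes>\<^bsub>B\<^esub> f x) \<oplus>\<^bsub>B\<^esub> f h \<otimes>\<^bsub>B\<^esub> f h = \<zero>\<^bsub>B\<^esub>"
      using kx h by (simp add: add mult smult A.smult_closed A.mult_closed)
    then show ?thesis using l kx h
      by (simp add: closed B.smult_closed B.mult_closed B.a_ac)
  qed
  moreover have "adj B (f x) = f x" "cnj l = l" "adj B (f h) = f h" using k(2) kx h by (auto simp flip: adj)
  ultimately have "(nrm B.unitization ?h)\<^sup>2 \<le> 1"
    using kx h by (intro UB.nrm_sq_le_if_sum_squares[of ?h ?k 1]) (auto simp: closed)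
  then show ?thesis using h closed by (simp add: B.opn_embed B.nrm_nonneg power_le_one_iff abs_square_le_1)
qed

text \<open>After normalization the C*-identities of both algebras reduce the claim to the
  self-adjoint element \<open>b\<^sup>* b\<close>.\<close>

lemma nrm_le:
  assumes x: "x \<in> carrier A" shows "nrm B (f x) \<le> nrm A x"
proof (cases "nrm A x = 0")
  case True
  then show ?thesis using x by (simp add: A.nrm_eq_zero zero)
next
  case False
  define b where "b = of_real (1 / nrm A x) \<odot>\<^bsub>A\<^esub> x"
  have b: "b \<in> carrier A" using x by (simp add: b_def A.smult_closed)
  have "nrm A b = 1" using False x A.nrm_nonneg[OF x] by (simp add: b_def A.nrm_smult norm_divide)
  then have "nrm B (f (adj A b \<otimes>\<^bsub>A\<^esub> b)) \<le> 1"
    using b A.cstar_identity[OF b] by (intro nrm_le_one_self_adj) (auto simp: A.mult_closed A.adj_closed A.adj_mult A.adj_adj)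
  then have "(nrm B (f b))\<^sup>2 \<le> 1"
    using b B.cstar_identity[OF closed[OF b]] by (simp add: mult adj A.adj_closed)
  then have "nrm B (f b) \<le> 1" using abs_square_le_1[of "nrm B (f b)"] by simp
  moreover have "nrm B (f b) = nrm B (f x) / nrm A x"
    using x closed A.nrm_nonneg[OF x] by (simp add: b_def smult B.nrm_smult norm_divide)
  ultimately have "nrm B (f x) / nrm A x \<le> 1" by simp
  then show ?thesis using False A.nrm_nonneg[OF x] by (simp add: divide_le_eq split: if_splits)
qed

lemma clim: "A.clim X x \<Longrightarrow> B.clim (\<lambda>n. f (X n)) (f x)"
  using nrm_le by (intro B.climI_le[where u = "\<lambda>n. nrm A (X n \<ominus>\<^bsub>A\<^esub> x)"]) (auto simp: A.clim_def closed simp flip: minus)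

end

section \<open>Separability and transport of structure\<close>

context cstar_algebra
begin

text \<open>The set on which two homomorphisms agree is a C*-subalgebra. It is closed in norm
  because homomorphisms are contractive.\<close>

lemma star_hom_eqI:
  assumes gen: "cstar_generated_by A G" and B: "cstar_algebra B"
    and f: "star_hom A B f" and g: "star_hom A B g" and eq: "\<And>x. x \<in> G \<Longrightarrow> f x = g x"
    and x: "x \<in> carrier A"
  shows "f x = g x"
proof -
  interpret B: cstar_algebra B by fact
  interpret f: star_homomorphism A B f by unfold_locales fact
  interpret g: star_homomorphism A B g by unfold_locales fact
  let ?S = "{x \<in> carrier A. f x = g x}"
  have "cstar_subalgebra A ?S"
    unfolding cstar_subalgebra_def
  proof (intro conjI ballI allI impI)
    fix X x assume X: "\<forall>n. X n \<in> ?S" and x: "x \<in> carrier A" "(\<lambda>n. nrm A (X n \<ominus> x)) \<longlonglongrightarrow> 0"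
    then have "clim X x" by (simp add: clim_def)
    then have "B.clim (\<lambda>n. f (X n)) (f x)" "B.clim (\<lambda>n. g (X n)) (g x)" by (rule f.clim g.clim)+
    then show "x \<in> ?S" using X x(1) B.clim_unique by auto
  qed (auto simp: f.add g.add f.mult g.mult f.smult g.smult f.adj g.adj f.zero g.zero mult_closed adj_closed smult_closed)
  moreover have "G \<subseteq> ?S" using gen eq by (auto simp: cstar_generated_by_def)
  ultimately show ?thesis using gen x unfolding cstar_generated_by_def by blast
qed

definition dense_in :: "'a set \<Rightarrow> bool" where
  "dense_in D \<longleftrightarrow> D \<subseteq> carrier A \<and> (\<forall>x\<in>carrier A. \<forall>e>0. \<exists>d\<in>D. nrm A (x \<ominus> d) < e)"

lemma approx_iff_clim:
  assumes "D \<subseteq> carrier A" "x \<in> carrier A"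
  shows "(\<forall>e>0. \<exists>d\<in>D. nrm A (x \<ominus> d) < e) \<longleftrightarrow> (\<exists>X. (\<forall>n. X n \<in> D) \<and> clim X x)"
proof
  assume "\<forall>e>0. \<exists>d\<in>D. nrm A (x \<ominus> d) < e"
  then have "\<exists>d\<in>D. nrm A (x \<ominus> d) < inverse (real (Suc n))" for n by simp
  then obtain X where X: "\<And>n. X n \<in> D" "\<And>n. nrm A (x \<ominus> X n) < inverse (real (Suc n))" by metis
  have Xc: "X n \<in> carrier A" for n using X(1) assms(1) by blast
  have "clim X x"
    using X(2) Xc assms(2) nrm_minus_commute[OF Xc assms(2)]
    by (intro climI_le[OF _ _ _ LIMSEQ_inverse_real_of_nat]) (auto intro: less_imp_le)
  then show "\<exists>X. (\<forall>n. X n \<in> D) \<and> clim X x" using X(1) by blast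
next
  assume "\<exists>X. (\<forall>n. X n \<in> D) \<and> clim X x"
  then obtain X where X: "\<And>n. X n \<in> D" "clim X x" by blast
  show "\<forall>e>0. \<exists>d\<in>D. nrm A (x \<ominus> d) < e"
  proof (intro allI impI)
    fix e :: real assume "e > 0"
    moreover have "(\<lambda>n. nrm A (X n \<ominus> x)) \<longlonglongrightarrow> 0" using X(2) by (simp add: clim_def)
    ultimately have "eventually (\<lambda>n. nrm A (X n \<ominus> x) < e) sequentially" by (intro order_tendstoD)
    then obtain n where "nrm A (X n \<ominus> x) < e" by (auto simp: eventually_sequentially)
    moreover have "nrm A (X n \<ominus> x) = nrm A (x \<ominus> X n)"
      using X(1) assms by (intro nrm_minus_commute) auto
    ultimately show "\<exists>d\<in>D. nrm A (x \<ominus> d) < e" using X(1) by auto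
  qed
qed

text \<open>The generators are closed under the operations, with scalars taken from a countable
  dense set \<open>Q\<close> so that the result \<open>D\<close> stays countable. The norm closure
  of \<open>D\<close> recovers all scalars and is a C*-subalgebra that contains the
  generators.\<close>

lemma countable_dense_if_countably_generated:
  assumes gen: "cstar_generated_by A G" and G: "countable G"
  obtains D where "countable D" "dense_in D"
proof -
  obtain Q :: "complex set" where Q: "countable Q" "\<And>X. open X \<Longrightarrow> X \<noteq> {} \<Longrightarrow> \<exists>d\<in>Q. d \<in> X"
    by (rule countable_dense_setE) blast
  define step where "step S = S \<union> (\<lambda>(x, y). x \<oplus> y) ` (S \<times> S) \<union> (\<lambda>(x, y). x \<otimes> y) ` (S \<times> S)
      \<union> adj A ` S \<union> (\<lambda>(c, x). c \<odot> x) ` (Q \<times> S)" for S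
  define Dn where "Dn = rec_nat (insert \<zero> G) (\<lambda>_. step)"
  have D0: "Dn 0 = insert \<zero> G" and DS: "Dn (Suc n) = step (Dn n)" for n by (simp_all add: Dn_def)
  define D where "D = (\<Union>n. Dn n)"
  have "countable (Dn n)" for n by (induction n) (auto simp: D0 DS step_def G Q)
  then have cD: "countable D" by (simp add: D_def)
  have "step S \<subseteq> carrier A" if "S \<subseteq> carrier A" for S
    using that by (auto simp: step_def subset_iff mult_closed adj_closed smult_closed)
  then have Dnc: "Dn n \<subseteq> carrier A" for n
    using gen by (induction n) (auto simp: D0 DS cstar_generated_by_def)
  then have Dc: "D \<subseteq> carrier A" by (auto simp: D_def)
  have mono: "Dn m \<subseteq> Dn n" if "m \<le> n" for m n
    using that by (rule lift_Suc_mono_le[rotated]) (auto simp: DS step_def)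
  have D2: "x \<oplus> y \<in> D \<and> x \<otimes> y \<in> D" if xy: "x \<in> D" "y \<in> D" for x y
  proof -
    obtain m n where "x \<in> Dn m" "y \<in> Dn n" using xy unfolding D_def by blast
    then have "x \<in> Dn (max m n)" "y \<in> Dn (max m n)" using mono[of m "max m n"] mono[of n "max m n"] by auto
    then have "x \<oplus> y \<in> Dn (Suc (max m n))" "x \<otimes> y \<in> Dn (Suc (max m n))"
      by (auto simp: DS step_def image_iff)
    then show ?thesis by (auto simp: D_def)
  qed
  have D1: "adj A x \<in> D" "\<And>c. c \<in> Q \<Longrightarrow> c \<odot> x \<in> D" if xD: "x \<in> D" for x
  proof -
    obtain m where "x \<in> Dn m" using xD unfolding D_def by blast
    then have "adj A x \<in> Dn (Suc m)" "\<And>c. c \<in> Q \<Longrightarrow> c \<odot> x \<in> Dn (Suc m)"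
      by (auto simp: DS step_def image_iff)
    then show "adj A x \<in> D" "\<And>c. c \<in> Q \<Longrightarrow> c \<odot> x \<in> D" by (auto simp: D_def)
  qed
  have GD: "insert \<zero> G \<subseteq> D" unfolding D_def D0[symmetric] by blast
  let ?S = "{x \<in> carrier A. \<forall>e>0. \<exists>d\<in>D. nrm A (x \<ominus> d) < e}"
  have Sseq: "x \<in> ?S \<longleftrightarrow> (\<exists>X. (\<forall>n. X n \<in> D) \<and> clim X x)" for x
    using approx_iff_clim[OF Dc, of x] climD(2) by blast
  have SI: "x \<in> ?S" if "\<And>n. X n \<in> D" "clim X x" for X x unfolding Sseq using that by blast
  have DsubS: "D \<subseteq> ?S" using Dc by (auto intro!: bexI simp: minus_self)
  have smultS: "c \<odot> x \<in> ?S" if x: "x \<in> ?S" for c x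
  proof -
    have xc: "x \<in> carrier A" using x by simp
    have "\<exists>d\<in>D. nrm A (c \<odot> x \<ominus> d) < e" if e: "e > 0" for e
    proof -
      \<comment> \<open>The scalar is approximated before the vector, since the accuracy asked of
        \<open>d\<close> depends on the chosen \<open>c'\<close>. The summands 1 keep the
        denominators positive.\<close>
      let ?r = "e / (2 * (nrm A x + 1))"
      have r: "?r > 0" using e nrm_nonneg[OF xc] by simp
      then obtain c' where c': "c' \<in> Q" "c' \<in> ball c ?r" using Q(2)[of "ball c ?r"] by (meson ball_eq_empty not_less open_ball)
      let ?s = "e / (2 * (cmod c' + 1))"
      have "?s > 0" using e by (simp add: add_nonneg_pos)
      then obtain d where d: "d \<in> D" "nrm A (x \<ominus> d) < ?s" using x by blast
      then have dc: "d \<in> carrier A" using Dc by blast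
      have "c \<odot> x \<ominus> c' \<odot> d = (c - c') \<odot> x \<oplus> c' \<odot> (x \<ominus> d)"
      proof -
        have "c \<odot> x = (c - c') \<odot> x \<oplus> c' \<odot> x" using xc by (simp flip: smult_l_distr)
        then show ?thesis using xc dc
          by (simp add: minus_eq smult_r_distr smult_minus_right smult_closed a_assoc)
      qed
      then have "nrm A (c \<odot> x \<ominus> c' \<odot> d) \<le> cmod (c - c') * nrm A x + cmod c' * nrm A (x \<ominus> d)"
        using nrm_triangle[of "(c - c') \<odot> x" "c' \<odot> (x \<ominus> d)"] xc dc by (simp add: smult_closed nrm_smult)
      also have "\<dots> < e"
      proof -
        have "cmod (c - c') * nrm A x \<le> ?r * nrm A x"
          using c'(2) nrm_nonneg[OF xc] by (intro mult_right_mono) (auto simp: dist_norm)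
        also have "\<dots> \<le> e / 2" using nrm_nonneg[OF xc] e by (simp add: divide_le_eq field_simps)
        finally have 1: "cmod (c - c') * nrm A x \<le> e / 2" .
        have "cmod c' * nrm A (x \<ominus> d) \<le> cmod c' * ?s" using d(2) by (intro mult_left_mono) auto
        also have "\<dots> < e / 2"
        proof -
          have "0 < cmod c' + 1" by (simp add: add_nonneg_pos)
          then show ?thesis using e by (simp add: divide_less_eq field_simps)
        qed
        finally show ?thesis using 1 by simp
      qed
      finally show ?thesis using D1(2)[OF d(1) c'(1)] by blast
    qed
    then show ?thesis using xc by (simp add: smult_closed)
  qed
  have sub: "cstar_subalgebra A ?S"
    unfolding cstar_subalgebra_def
  proof (intro conjI ballI allI impI)
    show "\<zero> \<in> ?S" by (rule subsetD[OF DsubS]) (use GD in blast)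
  next
    fix x y assume "x \<in> ?S" "y \<in> ?S"
    then obtain X Y where X: "\<And>n. X n \<in> D" "clim X x" and Y: "\<And>n. Y n \<in> D" "clim Y y" unfolding Sseq by blast
    show "x \<oplus> y \<in> ?S" by (rule SI[OF _ clim_add[OF X(2) Y(2)]]) (simp add: D2 X(1) Y(1))
    show "x \<otimes> y \<in> ?S" by (rule SI[OF _ clim_mult[OF X(2) Y(2)]]) (simp add: D2 X(1) Y(1))
  next
    fix x assume "x \<in> ?S"
    then obtain X where X: "\<And>n. X n \<in> D" "clim X x" unfolding Sseq by blast
    show "adj A x \<in> ?S" by (rule SI[OF _ clim_adj[OF X(2)]]) (simp add: D1(1) X(1))
  next
    fix X x assume X: "\<forall>n. X n \<in> ?S" and x: "x \<in> carrier A" "(\<lambda>n. nrm A (X n \<ominus> x)) \<longlonglongrightarrow> 0"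
    have "\<exists>d\<in>D. nrm A (x \<ominus> d) < e" if "e > 0" for e
    proof -
      have "eventually (\<lambda>n. nrm A (X n \<ominus> x) < e / 2) sequentially" using x(2) that by (intro order_tendstoD) auto
      then obtain n where n: "nrm A (X n \<ominus> x) < e / 2" by (auto simp: eventually_sequentially)
      have "X n \<in> ?S" "e / 2 > 0" using X that by simp_all
      then obtain d where d: "d \<in> D" "nrm A (X n \<ominus> d) < e / 2" by blast
      have "nrm A (x \<ominus> d) \<le> nrm A (x \<ominus> X n) + nrm A (X n \<ominus> d)"
        using X x(1) d(1) Dc by (intro nrm_triangle_via) auto
      then have "nrm A (x \<ominus> d) < e" using n d(2) nrm_minus_commute[of x "X n"] X x(1) by simp
      then show ?thesis using d(1) by blast
    qed
    then show "x \<in> ?S" using x(1) by blast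
  qed (use smultS in auto)
  moreover have "G \<subseteq> ?S" by (rule order_trans[OF _ DsubS]) (use GD in blast)
  ultimately have "?S = carrier A" using gen unfolding cstar_generated_by_def by blast
  then have "dense_in D" unfolding dense_in_def using Dc by blast
  then show ?thesis using cD that by blast
qed

text \<open>A point is determined by its distances to a dense sequence. The distances are stored as
  matrices constant in the second index, because the universal property is tested on algebras of
  matrices.\<close>

lemma inj_on_matrices_if_countably_generated:
  assumes "cstar_generated_by A G" "countable G"
  obtains g :: "'a \<Rightarrow> nat \<Rightarrow> nat \<Rightarrow> complex" where "inj_on g (carrier A)"
proof -
  obtain D where D: "countable D" "dense_in D"
    using countable_dense_if_countably_generated[OF assms] by blast
  then have "D \<noteq> {}" unfolding dense_in_def using zero_closed zero_less_one by blast
  then obtain d :: "nat \<Rightarrow> 'a" where d: "range d = D" using D(1) by (metis uncountable_def)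
  define g :: "'a \<Rightarrow> nat \<Rightarrow> nat \<Rightarrow> complex" where "g x = (\<lambda>n m. of_real (nrm A (x \<ominus> d n)))" for x
  have dc: "d n \<in> carrier A" for n using d D(2) unfolding dense_in_def by blast
  have "x = y" if x: "x \<in> carrier A" and y: "y \<in> carrier A" and eq: "g x = g y" for x y
  proof -
    have le: "nrm A (x \<ominus> y) \<le> e" if e: "e > 0" for e
    proof -
      obtain n where n: "nrm A (x \<ominus> d n) < e / 2"
        using D(2) x half_gt_zero[OF e] d unfolding dense_in_def by blast
      have "nrm A (y \<ominus> d n) = nrm A (x \<ominus> d n)"
        using fun_cong[OF fun_cong[OF eq], of n 0] by (simp add: g_def)
      then show ?thesis
        using nrm_triangle_via[OF x dc y, of n] nrm_minus_commute[OF dc y, of n] n by simp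
    qed
    have "nrm A (x \<ominus> y) \<le> 0" by (rule field_le_epsilon) (use le in simp)
    then show ?thesis using nrm_nonneg[of "x \<ominus> y"] x y by (intro eq_if_nrm_diff) auto
  qed
  then show ?thesis using that[of g] by (auto simp: inj_on_def)
qed

text \<open>Copies an algebra over an arbitrary type to another type, in the end that of infinite
  matrices, where the universal property can be instantiated. The operations go back to
  \<open>A\<close> along the inverse of \<open>g\<close> on the carrier.\<close>

definition transport :: "('a \<Rightarrow> 'b) \<Rightarrow> 'b cstar" where
  "transport g = (let u = inv_into (carrier A) g in
    \<lparr>carrier = g ` carrier A, monoid.mult = (\<lambda>x y. g (u x \<otimes> u y)), one = undefined, zero = g \<zero>,
     add = (\<lambda>x y. g (u x \<oplus> u y)), smult = (\<lambda>c x. g (c \<odot> u x)), adj = (\<lambda>x. g (adj A (u x))),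
     nrm = (\<lambda>x. nrm A (u x))\<rparr>)"

lemma transport_carrier: "carrier (transport g) = g ` carrier A" "\<zero>\<^bsub>transport g\<^esub> = g \<zero>"
  by (simp_all add: transport_def Let_def)

lemma
  assumes g: "inj_on g (carrier A)"
  shows cstar_algebra_transport: "cstar_algebra (transport g)"
    and star_iso_transport: "star_iso A (transport g) g"
proof -
  let ?T = "transport g"
  have u: "inv_into (carrier A) g (g x) = x" if "x \<in> carrier A" for x using g that by simp
  have ops2: "g x \<otimes>\<^bsub>?T\<^esub> g y = g (x \<otimes> y)" "g x \<oplus>\<^bsub>?T\<^esub> g y = g (x \<oplus> y)"
    if "x \<in> carrier A" "y \<in> carrier A" for x y
    using that by (simp_all add: transport_def Let_def u)
  have ops1: "c \<odot>\<^bsub>?T\<^esub> g x = g (c \<odot> x)"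
    "adj ?T (g x) = g (adj A x)" "nrm ?T (g x) = nrm A x" if "x \<in> carrier A" for x c
    using that by (simp_all add: transport_def Let_def u)
  note ops = ops1 ops2
  note cs = mult_closed adj_closed smult_closed
  have ag: "abelian_group ?T"
  proof (rule abelian_groupI)
    fix x assume "x \<in> carrier ?T"
    then obtain x' where "x = g x'" "x' \<in> carrier A" by (auto simp: transport_carrier)
    then show "\<exists>y\<in>carrier ?T. y \<oplus>\<^bsub>?T\<^esub> x = \<zero>\<^bsub>?T\<^esub>"
      by (intro bexI[of _ "g (\<ominus> x')"]) (auto simp: transport_carrier ops l_neg)
  qed (auto simp: transport_carrier ops a_ac)
  interpret T: abelian_group ?T by (rule ag)
  have minus: "g x \<ominus>\<^bsub>?T\<^esub> g y = g (x \<ominus> y)" if "x \<in> carrier A" "y \<in> carrier A" for x y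
  proof -
    have "\<ominus>\<^bsub>?T\<^esub> g y = g (\<ominus> y)" using that by (intro T.minus_equality) (auto simp: transport_carrier ops l_neg)
    then show ?thesis using that by (simp add: T.minus_eq minus_eq ops)
  qed
  show "star_iso A ?T g"
    using g by (auto simp: star_iso_def star_hom_def bij_betw_def transport_carrier ops cs)
  show "cstar_algebra ?T"
  proof unfold_locales
    fix X :: "nat \<Rightarrow> 'b" assume X: "\<And>n. X n \<in> carrier ?T"
      and Cau: "\<And>e. e > 0 \<Longrightarrow> \<exists>N. \<forall>m\<ge>N. \<forall>n\<ge>N. nrm ?T (X m \<ominus>\<^bsub>?T\<^esub> X n) < e"
    have "\<exists>x. x \<in> carrier A \<and> X n = g x" for n using X[of n] by (auto simp: transport_carrier)
    then obtain Y where Y: "\<And>n. Y n \<in> carrier A" "\<And>n. X n = g (Y n)" by metis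
    have "\<exists>N. \<forall>m\<ge>N. \<forall>n\<ge>N. nrm A (Y m \<ominus> Y n) < e" if "e > 0" for e
      using Cau[OF that] by (simp add: Y minus ops)
    then obtain x where "x \<in> carrier A" "(\<lambda>n. nrm A (Y n \<ominus> x)) \<longlonglongrightarrow> 0" using complete[of Y] Y(1) by blast
    then show "\<exists>x\<in>carrier ?T. (\<lambda>n. nrm ?T (X n \<ominus>\<^bsub>?T\<^esub> x)) \<longlonglongrightarrow> 0"
      by (intro bexI[of _ "g x"]) (auto simp: transport_carrier Y minus ops)
  qed (auto simp: transport_carrier ops cs smult_l_distr smult_r_distr smult_assoc smult_one mult_assoc
      mult_l_distr mult_r_distr smult_mult_left smult_mult_right adj_add adj_smult adj_mult adj_adj
      nrm_triangle nrm_smult nrm_mult cstar_identity nrm_eq_zero u inj_on_eq_iff[OF g])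
qed

end

lemma star_hom_comp: "star_hom A B f \<Longrightarrow> star_hom B C g \<Longrightarrow> star_hom A C (g \<circ> f)"
  unfolding star_hom_def by (auto simp: Pi_iff)

lemma star_hom_id: "star_hom A A (\<lambda>x. x)"
  unfolding star_hom_def by auto

lemma star_iso_inv:
  assumes A: "cstar_algebra A" and f: "star_iso A B f"
  shows "star_iso B A (inv_into (carrier A) f)"
proof -
  interpret cstar_algebra A by fact
  let ?g = "inv_into (carrier A) f"
  have bij: "bij_betw f (carrier A) (carrier B)" and h: "star_hom A B f" using f by (auto simp: star_iso_def)
  have g: "?g (f x) = x" if "x \<in> carrier A" for x using bij that by (simp add: bij_betw_def)
  have surj: "\<exists>x\<in>carrier A. y = f x" if "y \<in> carrier B" for y using bij that by (auto simp: bij_betw_def)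
  have hom: "f (x \<oplus>\<^bsub>A\<^esub> y) = f x \<oplus>\<^bsub>B\<^esub> f y" "f (x \<otimes>\<^bsub>A\<^esub> y) = f x \<otimes>\<^bsub>B\<^esub> f y" "f (c \<odot>\<^bsub>A\<^esub> x) = c \<odot>\<^bsub>B\<^esub> f x" "f (adj A x) = adj B (f x)"
    if "x \<in> carrier A" "y \<in> carrier A" for x y c
    using h that by (auto simp: star_hom_def)
  have "star_hom B A ?g"
    unfolding star_hom_def
  proof (intro conjI ballI allI)
    show "?g \<in> carrier B \<rightarrow> carrier A"
    proof
      fix y assume "y \<in> carrier B"
      then obtain x where "x \<in> carrier A" "y = f x" using surj by blast
      then show "?g y \<in> carrier A" by (simp add: g)
    qed
  next
    fix c y assume "y \<in> carrier B"
    then obtain x where x: "x \<in> carrier A" "y = f x" using surj by blast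
    then show "?g (c \<odot>\<^bsub>B\<^esub> y) = c \<odot>\<^bsub>A\<^esub> ?g y"
      using hom(3)[OF x(1) x(1)] g[OF smult_closed[OF x(1)]] g[OF x(1)] by metis
  next
    fix y assume "y \<in> carrier B"
    then obtain x where x: "x \<in> carrier A" "y = f x" using surj by blast
    then show "?g (adj B y) = adj A (?g y)"
      using hom(4)[OF x(1) x(1)] g[OF adj_closed[OF x(1)]] g[OF x(1)] by metis
  next
    fix y y' assume "y \<in> carrier B" "y' \<in> carrier B"
    then obtain x x' where x: "x \<in> carrier A" "y = f x" and x': "x' \<in> carrier A" "y' = f x'" using surj by meson
    show "?g (y \<oplus>\<^bsub>B\<^esub> y') = ?g y \<oplus>\<^bsub>A\<^esub> ?g y'"
      using x x' hom(1)[OF x(1) x'(1)] g[OF a_closed[OF x(1) x'(1)]] g[OF x(1)] g[OF x'(1)] by metis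
    show "?g (y \<otimes>\<^bsub>B\<^esub> y') = ?g y \<otimes>\<^bsub>A\<^esub> ?g y'"
      using x x' hom(2)[OF x(1) x'(1)] g[OF mult_closed[OF x(1) x'(1)]] g[OF x(1)] g[OF x'(1)] by metis
  qed
  then show ?thesis using bij by (simp add: star_iso_def bij_betw_inv_into)
qed

section \<open>The universal property\<close>

lemma toeplitz_familyD:
  assumes "toeplitz_family E A q t"
  shows "v \<in> verts E \<Longrightarrow> projection A (q v)"
    and "v \<in> verts E \<Longrightarrow> w \<in> verts E \<Longrightarrow> v \<noteq> w \<Longrightarrow> q v \<otimes>\<^bsub>A\<^esub> q w = \<zero>\<^bsub>A\<^esub>"
    and "e \<in> arcs E \<Longrightarrow> partial_isometry A (t e)"
    and "e \<in> arcs E \<Longrightarrow> adj A (t e) \<otimes>\<^bsub>A\<^esub> t e = q (tail E e)"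
    and "v \<in> verts E \<Longrightarrow> cstar_le A (\<Oplus>\<^bsub>A\<^esub>e\<in>in_arcs E v. t e \<otimes>\<^bsub>A\<^esub> adj A (t e)) (q v)"
  using assms by (auto simp: toeplitz_family_def)

text \<open>The order relation survives because a witness \<open>b\<close> is mapped to a witness
  \<open>f b\<close>; all other conditions are equations.\<close>

lemma toeplitz_family_image:
  assumes A: "cstar_algebra A" and B: "cstar_algebra B" and f: "star_hom A B f" and fin: "finite (arcs E)"
    and fam: "toeplitz_family E A q t"
  shows "toeplitz_family E B (\<lambda>v. f (q v)) (\<lambda>e. f (t e))"
proof -
  interpret A: cstar_algebra A by fact
  interpret B: cstar_algebra B by fact
  interpret f: star_homomorphism A B f by unfold_locales fact
  note fam = toeplitz_familyD[OF fam]
  have tc: "t e \<in> carrier A" if "e \<in> arcs E" for e using fam(3)[OF that] by (simp add: partial_isometry_def)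
  have qc: "q v \<in> carrier A" if "v \<in> verts E" for v using fam(1)[OF that] by (simp add: projection_def)
  show ?thesis
    unfolding toeplitz_family_def
  proof (intro conjI ballI impI)
    fix v assume v: "v \<in> verts E"
    show "projection B (f (q v))"
      using fam(1)[OF v] by (auto simp: projection_def f.closed simp flip: f.adj f.mult)
    obtain b where b: "b \<in> carrier A"
      "q v \<ominus>\<^bsub>A\<^esub> (\<Oplus>\<^bsub>A\<^esub>e\<in>in_arcs E v. t e \<otimes>\<^bsub>A\<^esub> adj A (t e)) = adj A b \<otimes>\<^bsub>A\<^esub> b"
      using fam(5)[OF v] by (auto simp: cstar_le_def)
    have c: "t e \<otimes>\<^bsub>A\<^esub> adj A (t e) \<in> carrier A" if "e \<in> in_arcs E v" for e
      using tc that by (auto simp: in_arcs_def A.mult_closed A.adj_closed)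
    have fin': "finite (in_arcs E v)" using fin by (auto simp: in_arcs_def)
    have "f (\<Oplus>\<^bsub>A\<^esub>e\<in>in_arcs E v. t e \<otimes>\<^bsub>A\<^esub> adj A (t e)) = (\<Oplus>\<^bsub>B\<^esub>e\<in>in_arcs E v. f (t e \<otimes>\<^bsub>A\<^esub> adj A (t e)))"
      using fin' c by (rule f.finsum)
    also have "\<dots> = (\<Oplus>\<^bsub>B\<^esub>e\<in>in_arcs E v. f (t e) \<otimes>\<^bsub>B\<^esub> adj B (f (t e)))"
      using tc by (intro B.finsum_cong') (auto simp: in_arcs_def f.mult f.adj f.closed A.adj_closed B.mult_closed B.adj_closed)
    finally have s: "f (\<Oplus>\<^bsub>A\<^esub>e\<in>in_arcs E v. t e \<otimes>\<^bsub>A\<^esub> adj A (t e)) = (\<Oplus>\<^bsub>B\<^esub>e\<in>in_arcs E v. f (t e) \<otimes>\<^bsub>B\<^esub> adj B (f (t e)))" .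
    have "f (q v \<ominus>\<^bsub>A\<^esub> (\<Oplus>\<^bsub>A\<^esub>e\<in>in_arcs E v. t e \<otimes>\<^bsub>A\<^esub> adj A (t e)))
        = f (q v) \<ominus>\<^bsub>B\<^esub> (\<Oplus>\<^bsub>B\<^esub>e\<in>in_arcs E v. f (t e) \<otimes>\<^bsub>B\<^esub> adj B (f (t e)))"
      unfolding s[symmetric] using v qc c by (intro f.minus) (auto intro: A.finsum_closed')
    then show "cstar_le B (\<Oplus>\<^bsub>B\<^esub>e\<in>in_arcs E v. f (t e) \<otimes>\<^bsub>B\<^esub> adj B (f (t e))) (f (q v))"
      unfolding cstar_le_def b(2) using b(1) by (intro bexI[of _ "f b"]) (auto simp: f.mult f.adj f.closed A.adj_closed)
  next
    fix v w assume "v \<in> verts E" "w \<in> verts E" "v \<noteq> w"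
    then show "f (q v) \<otimes>\<^bsub>B\<^esub> f (q w) = \<zero>\<^bsub>B\<^esub>" using fam(2)[of v w] qc by (simp add: f.zero flip: f.mult)
  next
    fix e assume e: "e \<in> arcs E"
    have te: "t e \<otimes>\<^bsub>A\<^esub> adj A (t e) \<otimes>\<^bsub>A\<^esub> t e = t e" using fam(3)[OF e] by (simp add: partial_isometry_def)
    show "partial_isometry B (f (t e))"
      using tc[OF e] te by (auto simp: partial_isometry_def f.closed A.mult_closed A.adj_closed simp flip: f.adj f.mult)
    show "adj B (f (t e)) \<otimes>\<^bsub>B\<^esub> f (t e) = f (q (tail E e))"
      using tc[OF e] fam(4)[OF e] by (simp add: A.adj_closed flip: f.adj f.mult)
  qed
qed

text \<open>The family is moved to the matrix copy of \<open>B\<close>, the universal property is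
  applied there, and the homomorphism is composed with the way back.\<close>

lemma toeplitz_algebra_universal:
  fixes B :: "'b cstar" and g :: "'b \<Rightarrow> nat \<Rightarrow> nat \<Rightarrow> complex"
  assumes A: "toeplitz_algebra E A q t" and fin: "finite (arcs E)"
    and B: "cstar_algebra B" and fam: "toeplitz_family E B Q T" and g: "inj_on g (carrier B)"
  obtains f where "star_hom A B f" "\<And>v. v \<in> verts E \<Longrightarrow> f (q v) = Q v" "\<And>e. e \<in> arcs E \<Longrightarrow> f (t e) = T e"
proof -
  interpret B: cstar_algebra B by fact
  let ?B' = "B.transport g" and ?u = "inv_into (carrier B) g"
  note iso = B.star_iso_transport[OF g] and B' = B.cstar_algebra_transport[OF g]
  have "toeplitz_family E ?B' (\<lambda>v. g (Q v)) (\<lambda>e. g (T e))"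
    using iso by (intro toeplitz_family_image[OF B B' _ fin fam]) (simp add: star_iso_def)
  then obtain f where f: "star_hom A ?B' f" "\<And>v. v \<in> verts E \<Longrightarrow> f (q v) = g (Q v)" "\<And>e. e \<in> arcs E \<Longrightarrow> f (t e) = g (T e)"
    using A B' unfolding toeplitz_algebra_def by blast
  have u: "star_hom ?B' B ?u" using star_iso_inv[OF B iso] by (simp add: star_iso_def)
  have Tc: "T e \<in> carrier B" if "e \<in> arcs E" for e using toeplitz_familyD(3)[OF fam that] by (simp add: partial_isometry_def)
  have Qc: "Q v \<in> carrier B" if "v \<in> verts E" for v using toeplitz_familyD(1)[OF fam that] by (simp add: projection_def)
  show ?thesis
    by (rule that[OF star_hom_comp[OF f(1) u]]) (auto simp: f(2,3) g Tc Qc)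
qed

section \<open>Operators on a Hilbert space\<close>

typedef 'i ell2 = "{f :: 'i \<Rightarrow> complex. (\<lambda>i. (cmod (f i))\<^sup>2) summable_on UNIV}"
  by (intro exI[of _ "\<lambda>_. 0"]) auto

setup_lifting type_definition_ell2

lemma square_summable_add:
  fixes f g :: "'i \<Rightarrow> complex"
  assumes "(\<lambda>i. (cmod (f i))\<^sup>2) summable_on UNIV" "(\<lambda>i. (cmod (g i))\<^sup>2) summable_on UNIV"
  shows "(\<lambda>i. (cmod (f i + g i))\<^sup>2) summable_on UNIV"
proof (rule summable_on_comparison_test)
  show "(\<lambda>i. 2 * (cmod (f i))\<^sup>2 + 2 * (cmod (g i))\<^sup>2) summable_on UNIV"
    using assms by (intro summable_on_add summable_on_cmult_right)
  fix i
  have "(cmod (f i + g i))\<^sup>2 \<le> (cmod (f i) + cmod (g i))\<^sup>2"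
    by (intro power_mono norm_triangle_ineq) auto
  also have "\<dots> \<le> 2 * (cmod (f i))\<^sup>2 + 2 * (cmod (g i))\<^sup>2"
    using sum_squares_bound[of "cmod (f i)" "cmod (g i)"] by (simp add: power2_sum)
  finally show "(cmod (f i + g i))\<^sup>2 \<le> 2 * (cmod (f i))\<^sup>2 + 2 * (cmod (g i))\<^sup>2" .
qed simp

lemma square_summable_mult:
  fixes f :: "'i \<Rightarrow> complex"
  shows "(\<lambda>i. (cmod (f i))\<^sup>2) summable_on UNIV \<Longrightarrow> (\<lambda>i. (cmod (c * f i))\<^sup>2) summable_on UNIV"
  by (simp add: norm_mult power_mult_distrib summable_on_cmult_right)

lemma inner_summable:
  fixes f g :: "'i \<Rightarrow> complex"
  assumes "(\<lambda>i. (cmod (f i))\<^sup>2) summable_on UNIV" "(\<lambda>i. (cmod (g i))\<^sup>2) summable_on UNIV"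
  shows "(\<lambda>i. inner (f i) (g i)) summable_on UNIV"
proof (rule abs_summable_summable, rule summable_on_comparison_test)
  show "(\<lambda>i. (cmod (f i))\<^sup>2 + (cmod (g i))\<^sup>2) summable_on UNIV"
    using assms by (intro summable_on_add)
  fix i
  have "\<bar>inner (f i) (g i)\<bar> \<le> cmod (f i) * cmod (g i)" by (rule Cauchy_Schwarz_ineq2)
  also have "\<dots> \<le> (cmod (f i))\<^sup>2 + (cmod (g i))\<^sup>2"
    using sum_squares_bound[of "cmod (f i)" "cmod (g i)"] mult_nonneg_nonneg[OF norm_ge_zero norm_ge_zero, of "f i" "g i"]
    unfolding mult.assoc by linarith
  finally show "norm (inner (f i) (g i)) \<le> (cmod (f i))\<^sup>2 + (cmod (g i))\<^sup>2" by simp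
qed simp

instantiation ell2 :: (type) real_inner
begin

lift_definition zero_ell2 :: "'a ell2" is "\<lambda>_. 0" by simp
lift_definition plus_ell2 :: "'a ell2 \<Rightarrow> 'a ell2 \<Rightarrow> 'a ell2" is "\<lambda>f g i. f i + g i" by (rule square_summable_add)
lift_definition uminus_ell2 :: "'a ell2 \<Rightarrow> 'a ell2" is "\<lambda>f i. - f i" by simp
lift_definition minus_ell2 :: "'a ell2 \<Rightarrow> 'a ell2 \<Rightarrow> 'a ell2" is "\<lambda>f g i. f i - g i"
  using square_summable_add[of _ "\<lambda>i. - g i" for g] by fastforce
lift_definition scaleR_ell2 :: "real \<Rightarrow> 'a ell2 \<Rightarrow> 'a ell2" is "\<lambda>c f i. c *\<^sub>R f i"
  using square_summable_mult by (simp add: scaleR_conv_of_real)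
text \<open>On complex numbers \<open>inner\<close> is the real part of the Hermitian product, so
  this is the real part of the usual inner product. The space is treated as a real Hilbert space on
  which multiplication by \<open>i\<close> is an additional operator.\<close>

lift_definition inner_ell2 :: "'a ell2 \<Rightarrow> 'a ell2 \<Rightarrow> real" is "\<lambda>f g. \<Sum>\<^sub>\<infinity>i. inner (f i) (g i)" .

definition norm_ell2 :: "'a ell2 \<Rightarrow> real" where "norm_ell2 x = sqrt (inner x x)"
definition dist_ell2 :: "'a ell2 \<Rightarrow> 'a ell2 \<Rightarrow> real" where "dist_ell2 x y = norm (x - y)"
definition sgn_ell2 :: "'a ell2 \<Rightarrow> 'a ell2" where "sgn_ell2 x = inverse (norm x) *\<^sub>R x"
definition uniformity_ell2 :: "('a ell2 \<times> 'a ell2) filter" where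
  "uniformity_ell2 = (INF e\<in>{0<..}. principal {(x, y). dist x y < e})"
definition open_ell2 :: "'a ell2 set \<Rightarrow> bool" where
  "open_ell2 U \<longleftrightarrow> (\<forall>x\<in>U. \<forall>\<^sub>F (x', y) in uniformity. x' = x \<longrightarrow> y \<in> U)"

instance
proof
  fix x y z :: "'a ell2" and r s :: real
  show "inner (x + y) z = inner x z + inner y z"
    by transfer (simp add: inner_add_left infsum_add inner_summable)
  show "inner (r *\<^sub>R x) y = r * inner x y"
    by transfer (simp add: infsum_cmult_right')
  show "0 \<le> inner x x"
    by transfer (simp add: infsum_nonneg)
  show "inner x x = 0 \<longleftrightarrow> x = 0"
  proof transfer
    fix f :: "'a \<Rightarrow> complex" assume f: "(\<lambda>i. (cmod (f i))\<^sup>2) summable_on UNIV"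
    have "f i = 0" if "(\<Sum>\<^sub>\<infinity>i. inner (f i) (f i)) = 0" for i
    proof -
      have "(\<Sum>\<^sub>\<infinity>i. (cmod (f i))\<^sup>2) \<le> 0" using that by (simp only: power2_norm_eq_inner order.refl)
      then have "(cmod (f i))\<^sup>2 = 0" by (rule nonneg_infsum_le_0D[OF _ f]) auto
      then show ?thesis by simp
    qed
    then show "(\<Sum>\<^sub>\<infinity>i. inner (f i) (f i)) = 0 \<longleftrightarrow> f = (\<lambda>_. 0)"
      by (intro iffI ext) simp_all
  qed
  show "inner x y = inner y x"
    by transfer (simp add: inner_commute)
  show "x + y + z = x + (y + z)" "x + y = y + x" "0 + x = x" "- x + x = 0" "x - y = x + - y"
    by (transfer; simp add: fun_eq_iff)+
  show "r *\<^sub>R (x + y) = r *\<^sub>R x + r *\<^sub>R y" "(r + s) *\<^sub>R x = r *\<^sub>R x + s *\<^sub>R x"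
    "r *\<^sub>R s *\<^sub>R x = (r * s) *\<^sub>R x" "1 *\<^sub>R x = x"
    by (transfer; simp add: fun_eq_iff scaleR_add_right scaleR_add_left)+
qed (auto simp: norm_ell2_def dist_ell2_def sgn_ell2_def uniformity_ell2_def open_ell2_def)

end

lemma Rep_ell2_simps [simp]:
  "Rep_ell2 (x + y) i = Rep_ell2 x i + Rep_ell2 y i" "Rep_ell2 (x - y) i = Rep_ell2 x i - Rep_ell2 y i"
  "Rep_ell2 0 i = 0" "Rep_ell2 (r *\<^sub>R x) i = r *\<^sub>R Rep_ell2 x i" "Rep_ell2 (- x) i = - Rep_ell2 x i"
  by (simp_all add: plus_ell2.rep_eq minus_ell2.rep_eq zero_ell2.rep_eq scaleR_ell2.rep_eq uminus_ell2.rep_eq)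

lemma Rep_ell2_summable: "(\<lambda>i. (cmod (Rep_ell2 x i))\<^sup>2) summable_on UNIV"
  using Rep_ell2[of x] by simp

lemma norm_ell2_sq: "(norm x)\<^sup>2 = (\<Sum>\<^sub>\<infinity>i. (cmod (Rep_ell2 x i))\<^sup>2)" for x :: "'i ell2"
  by (simp add: power2_norm_eq_inner inner_ell2.rep_eq)

lemma finite_sum_le_norm_ell2_sq: "finite F \<Longrightarrow> (\<Sum>i\<in>F. (cmod (Rep_ell2 x i))\<^sup>2) \<le> (norm x)\<^sup>2"
  unfolding norm_ell2_sq by (intro finite_sum_le_infsum Rep_ell2_summable) auto

lemma ell2_eqI: "(\<And>i. Rep_ell2 x i = Rep_ell2 y i) \<Longrightarrow> x = y"
  by (simp add: Rep_ell2_inject[symmetric] ext)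

text \<open>Each coordinate is bounded by the norm, so the coordinates converge. The bounds on
  finite partial sums survive the coordinatewise limit, and they yield both the square summability
  of the limit and convergence in norm.\<close>

instance ell2 :: (type) banach
proof
  fix X :: "nat \<Rightarrow> 'a ell2" assume "Cauchy X"
  then have Cau: "\<exists>N. \<forall>m\<ge>N. \<forall>n\<ge>N. norm (X m - X n) < e" if "e > 0" for e
    using that by (auto simp: Cauchy_def dist_norm)
  have coord: "cmod (Rep_ell2 x i) \<le> norm x" for x :: "'a ell2" and i
    using finite_sum_le_norm_ell2_sq[of "{i}" x] by (simp add: power_mono_iff[of _ _ 2])
  have "Cauchy (\<lambda>n. Rep_ell2 (X n) i)" for i
    unfolding Cauchy_def dist_norm
  proof (intro allI impI)
    fix e :: real assume "e > 0"
    then obtain N where N: "\<forall>m\<ge>N. \<forall>n\<ge>N. norm (X m - X n) < e" using Cau by blast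
    have "cmod (Rep_ell2 (X m) i - Rep_ell2 (X n) i) < e" if "m \<ge> N" "n \<ge> N" for m n
      using N that coord[of "X m - X n" i] by fastforce
    then show "\<exists>M. \<forall>m\<ge>M. \<forall>n\<ge>M. cmod (Rep_ell2 (X m) i - Rep_ell2 (X n) i) < e" by blast
  qed
  then have "\<exists>l. (\<lambda>n. Rep_ell2 (X n) i) \<longlonglongrightarrow> l" for i
    using Cauchy_convergent convergent_def by blast
  then obtain f where f: "\<And>i. (\<lambda>n. Rep_ell2 (X n) i) \<longlonglongrightarrow> f i" by metis
  have tail_le: "(\<Sum>i\<in>F. (cmod (Rep_ell2 (X m) i - f i))\<^sup>2) \<le> e\<^sup>2"
    if N: "\<forall>m\<ge>N. \<forall>n\<ge>N. norm (X m - X n) < e" and m: "m \<ge> N" and F: "finite F" for e N m F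
  proof (rule tendsto_upperbound)
    show "(\<lambda>n. \<Sum>i\<in>F. (cmod (Rep_ell2 (X m) i - Rep_ell2 (X n) i))\<^sup>2) \<longlonglongrightarrow> (\<Sum>i\<in>F. (cmod (Rep_ell2 (X m) i - f i))\<^sup>2)"
      by (intro tendsto_sum tendsto_power tendsto_norm tendsto_diff tendsto_const f)
    have "(\<Sum>i\<in>F. (cmod (Rep_ell2 (X m) i - Rep_ell2 (X n) i))\<^sup>2) \<le> e\<^sup>2" if "n \<ge> N" for n
    proof -
      have "(\<Sum>i\<in>F. (cmod (Rep_ell2 (X m - X n) i))\<^sup>2) \<le> (norm (X m - X n))\<^sup>2"
        by (rule finite_sum_le_norm_ell2_sq[OF F])
      also have "\<dots> \<le> e\<^sup>2" using N m that by (intro power_mono) (auto intro: less_imp_le)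
      finally show ?thesis by simp
    qed
    then show "\<forall>\<^sub>F n in sequentially. (\<Sum>i\<in>F. (cmod (Rep_ell2 (X m) i - Rep_ell2 (X n) i))\<^sup>2) \<le> e\<^sup>2"
      by (auto simp: eventually_sequentially)
  qed simp
  have diff: "(\<lambda>i. (cmod (Rep_ell2 (X m) i - f i))\<^sup>2) summable_on UNIV"
    if N: "\<forall>m\<ge>N. \<forall>n\<ge>N. norm (X m - X n) < e" and m: "m \<ge> N" for e N m
    using tail_le[OF N m] by (intro nonneg_bdd_above_summable_on) (auto simp: bdd_above_def)
  obtain N where N: "\<forall>m\<ge>N. \<forall>n\<ge>N. norm (X m - X n) < 1" using Cau[of 1] by auto
  have "(\<lambda>i. (cmod (Rep_ell2 (X N) i + - 1 * (Rep_ell2 (X N) i - f i)))\<^sup>2) summable_on UNIV"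
    by (rule square_summable_add[OF Rep_ell2_summable square_summable_mult[OF diff[OF N order.refl]]])
  then have "(\<lambda>i. (cmod (f i))\<^sup>2) summable_on UNIV" by simp
  then have Rf: "Rep_ell2 (Abs_ell2 f) = f" by (simp add: Abs_ell2_inverse)
  have "X \<longlonglongrightarrow> Abs_ell2 f"
  proof (rule metric_LIMSEQ_I)
    fix r :: real assume r: "r > 0"
    obtain N where N: "\<forall>m\<ge>N. \<forall>n\<ge>N. norm (X m - X n) < r / 2" using Cau[of "r / 2"] r by auto
    have "norm (X m - Abs_ell2 f) < r" if m: "m \<ge> N" for m
    proof -
      have "(norm (X m - Abs_ell2 f))\<^sup>2 \<le> (r / 2)\<^sup>2"
        unfolding norm_ell2_sq using tail_le[OF N m] diff[OF N m] by (intro infsum_le_finite_sums) (auto simp: Rf)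
      then have "norm (X m - Abs_ell2 f) \<le> r / 2" by (rule power2_le_imp_le) (use r in simp)
      then show ?thesis using r by simp
    qed
    then show "\<exists>no. \<forall>n\<ge>no. dist (X n) (Abs_ell2 f) < r" by (auto simp: dist_norm)
  qed
  then show "convergent X" by (auto simp: convergent_def)
qed

section \<open>Complex structure and adjoints\<close>

lift_definition times_i :: "'i ell2 \<Rightarrow> 'i ell2" is "\<lambda>f i. \<i> * f i"
  by (rule square_summable_mult)

lemma inner_times_i: "inner (times_i x) y = - inner x (times_i y)"
proof -
  have *: "inner (\<i> * a) b = - inner a (\<i> * b)" for a b :: complex by (simp add: inner_complex_def)
  show ?thesis by transfer (simp add: * infsum_uminus)
qed

lemma times_i_times_i [simp]: "times_i (times_i x) = - x"
  by (rule ell2_eqI) (simp add: times_i.rep_eq)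

lemma norm_times_i [simp]: "norm (times_i x) = norm x"
  by (simp add: norm_eq_sqrt_inner inner_times_i)

lemma bounded_linear_times_i: "bounded_linear times_i"
  by (rule bounded_linear_intro[where K = 1])
    (auto intro!: ell2_eqI simp: times_i.rep_eq algebra_simps)

definition iop :: "'i ell2 \<Rightarrow>\<^sub>L 'i ell2" where "iop = Blinfun times_i"

lemma iop_apply [simp]: "blinfun_apply iop x = times_i x"
  by (simp add: iop_def bounded_linear_Blinfun_apply bounded_linear_times_i)

text \<open>A relation rather than an operation: having an adjoint becomes a condition for
  membership in the operator algebra, and only uniqueness has to be proved.\<close>

definition is_adjoint :: "('i ell2 \<Rightarrow>\<^sub>L 'i ell2) \<Rightarrow> ('i ell2 \<Rightarrow>\<^sub>L 'i ell2) \<Rightarrow> bool" where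
  "is_adjoint T S \<longleftrightarrow> (\<forall>x y. inner (blinfun_apply T x) y = inner x (blinfun_apply S y))"

lemma is_adjointD: "is_adjoint T S \<Longrightarrow> inner (blinfun_apply T x) y = inner x (blinfun_apply S y)"
  by (simp add: is_adjoint_def)

lemma is_adjoint_sym: "is_adjoint T S \<Longrightarrow> is_adjoint S T"
  unfolding is_adjoint_def by (metis inner_commute)

lemma is_adjoint_unique:
  assumes "is_adjoint T S" "is_adjoint T S'" shows "S = S'"
proof (rule blinfun_eqI)
  fix y
  have "inner x (blinfun_apply S y) = inner x (blinfun_apply S' y)" for x
    using is_adjointD[OF assms(1), of x y] is_adjointD[OF assms(2), of x y] by simp
  then show "blinfun_apply S y = blinfun_apply S' y" using vector_eq_ldot by blast
qed

text \<open>For \<open>z = S y\<close> the square of the norm of \<open>z\<close> is the inner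
  product of \<open>T z\<close> and \<open>y\<close>, to which the Cauchy-Schwarz inequality
  applies.\<close>

lemma is_adjoint_norm_le:
  assumes "is_adjoint T S" shows "norm S \<le> norm T"
proof (rule norm_blinfun_bound)
  fix y
  let ?z = "blinfun_apply S y"
  have "norm ?z * norm ?z = inner (blinfun_apply T ?z) y"
    using is_adjointD[OF assms, of ?z y] by (simp add: power2_norm_eq_inner[symmetric] power2_eq_square)
  also have "\<dots> \<le> norm (blinfun_apply T ?z) * norm y" using Cauchy_Schwarz_ineq2[of "blinfun_apply T ?z" y] by simp
  also have "\<dots> \<le> (norm T * norm ?z) * norm y" by (intro mult_right_mono norm_blinfun) auto
  finally have "norm ?z * norm ?z \<le> norm ?z * (norm T * norm y)" by (simp add: mult_ac)
  then show "norm ?z \<le> norm T * norm y"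
    by (cases "norm ?z = 0") auto
qed simp

lemma is_adjoint_norm_eq: "is_adjoint T S \<Longrightarrow> norm S = norm T"
  using is_adjoint_norm_le is_adjoint_sym by (metis order_antisym)

lemma is_adjoint_norm_compose:
  assumes "is_adjoint T S" shows "norm (S o\<^sub>L T) = (norm T)\<^sup>2"
proof (rule antisym)
  show "norm (S o\<^sub>L T) \<le> (norm T)\<^sup>2"
    using norm_blinfun_compose[of S T] is_adjoint_norm_eq[OF assms] by (simp add: power2_eq_square)
  have "norm T \<le> sqrt (norm (S o\<^sub>L T))"
  proof (rule norm_blinfun_bound)
    fix x
    have "(norm (blinfun_apply T x))\<^sup>2 = inner x (blinfun_apply (S o\<^sub>L T) x)"
      using is_adjointD[OF assms, of x "blinfun_apply T x"] by (simp add: power2_norm_eq_inner)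
    also have "\<dots> \<le> norm x * norm (blinfun_apply (S o\<^sub>L T) x)" using Cauchy_Schwarz_ineq2 by (metis abs_ge_self order_trans)
    also have "\<dots> \<le> norm x * (norm (S o\<^sub>L T) * norm x)" by (intro mult_left_mono norm_blinfun) auto
    also have "\<dots> = (sqrt (norm (S o\<^sub>L T)) * norm x)\<^sup>2" by (simp add: power_mult_distrib power2_eq_square[of "norm x"])
    finally show "norm (blinfun_apply T x) \<le> sqrt (norm (S o\<^sub>L T)) * norm x" by (rule power2_le_imp_le) simp
  qed simp
  then have "(norm T)\<^sup>2 \<le> (sqrt (norm (S o\<^sub>L T)))\<^sup>2" by (intro power_mono) auto
  then show "(norm T)\<^sup>2 \<le> norm (S o\<^sub>L T)" by simp
qed

definition complex_linear :: "('i ell2 \<Rightarrow>\<^sub>L 'i ell2) \<Rightarrow> bool" where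
  "complex_linear T \<longleftrightarrow> (\<forall>x. blinfun_apply T (times_i x) = times_i (blinfun_apply T x))"

text \<open>Multiplication by \<open>i\<close> is skew-adjoint. It crosses the inner product once
  before and once after \<open>T\<close> is moved over, so the two signs cancel.\<close>

lemma complex_linear_adjoint:
  assumes "is_adjoint T S" "complex_linear T" shows "complex_linear S"
  unfolding complex_linear_def
proof
  fix y
  have "inner x (blinfun_apply S (times_i y)) = inner x (times_i (blinfun_apply S y))" for x
  proof -
    have "inner x (blinfun_apply S (times_i y)) = - inner (times_i (blinfun_apply T x)) y"
      using is_adjointD[OF assms(1), of x "times_i y"] by (simp add: inner_times_i)
    also have "\<dots> = - inner (times_i x) (blinfun_apply S y)"
      using is_adjointD[OF assms(1), of "times_i x" y] assms(2) by (simp add: complex_linear_def)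
    finally show ?thesis by (simp add: inner_times_i)
  qed
  then show "blinfun_apply S (times_i y) = times_i (blinfun_apply S y)" using vector_eq_ldot by blast
qed

text \<open>A bounded real-linear operator that commutes with multiplication by \<open>i\<close> and has an adjoint for the
  real inner product is the same as an adjointable complex-linear operator.\<close>

definition operator_algebra :: "('i ell2 \<Rightarrow>\<^sub>L 'i ell2) cstar" where
  "operator_algebra = \<lparr>carrier = {T. complex_linear T \<and> (\<exists>S. is_adjoint T S)},
    monoid.mult = (o\<^sub>L), one = id_blinfun, zero = 0, add = (+),
    smult = (\<lambda>c T. Re c *\<^sub>R T + Im c *\<^sub>R (iop o\<^sub>L T)), adj = (\<lambda>T. THE S. is_adjoint T S), nrm = norm\<rparr>"

lemma operator_algebra_simps:
  "carrier operator_algebra = {T. complex_linear T \<and> (\<exists>S. is_adjoint T S)}"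
  "S \<otimes>\<^bsub>operator_algebra\<^esub> T = S o\<^sub>L T" "S \<oplus>\<^bsub>operator_algebra\<^esub> T = S + T" "\<zero>\<^bsub>operator_algebra\<^esub> = 0"
  "c \<odot>\<^bsub>operator_algebra\<^esub> T = Re c *\<^sub>R T + Im c *\<^sub>R (iop o\<^sub>L T)" "nrm operator_algebra T = norm T"
  by (simp_all add: operator_algebra_def)

lemma operator_algebra_adj: "is_adjoint T S \<Longrightarrow> adj operator_algebra T = S"
  unfolding operator_algebra_def using is_adjoint_unique by (auto intro: the_equality)

lemma is_adjoint_ops:
  "is_adjoint T S \<Longrightarrow> is_adjoint T' S' \<Longrightarrow> is_adjoint (T + T') (S + S')"
  "is_adjoint T S \<Longrightarrow> is_adjoint T' S' \<Longrightarrow> is_adjoint (T o\<^sub>L T') (S' o\<^sub>L S)"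
  "is_adjoint T S \<Longrightarrow> complex_linear T \<Longrightarrow> is_adjoint (c \<odot>\<^bsub>operator_algebra\<^esub> T) (cnj c \<odot>\<^bsub>operator_algebra\<^esub> S)"
  "is_adjoint 0 0" "is_adjoint T S \<Longrightarrow> is_adjoint (- T) (- S)"
proof -
  show "is_adjoint (c \<odot>\<^bsub>operator_algebra\<^esub> T) (cnj c \<odot>\<^bsub>operator_algebra\<^esub> S)" if "is_adjoint T S" "complex_linear T"
    using is_adjointD[OF that(1)] complex_linear_adjoint[OF that] that(2) unfolding is_adjoint_def complex_linear_def
    by (simp add: operator_algebra_simps blinfun.bilinear_simps inner_add_left inner_add_right inner_diff_right inner_times_i)
qed (auto simp: is_adjoint_def blinfun.bilinear_simps inner_add_left inner_add_right)

lemma complex_linear_ops: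
  "complex_linear T \<Longrightarrow> complex_linear T' \<Longrightarrow> complex_linear (T + T')"
  "complex_linear T \<Longrightarrow> complex_linear T' \<Longrightarrow> complex_linear (T o\<^sub>L T')"
  "complex_linear T \<Longrightarrow> complex_linear (c \<odot>\<^bsub>operator_algebra\<^esub> T)"
  "complex_linear 0" "complex_linear T \<Longrightarrow> complex_linear (- T)"
  unfolding complex_linear_def operator_algebra_simps
  by (auto intro!: ell2_eqI simp: blinfun.bilinear_simps times_i.rep_eq algebra_simps)

text \<open>The vectors \<open>x\<close> and \<open>times_i x\<close> have the same length and are
  orthogonal for the real inner product, so this is the theorem of Pythagoras.\<close>

lemma norm_complex_scale:
  fixes x :: "'i ell2" shows "norm (Re c *\<^sub>R x + Im c *\<^sub>R times_i x) = cmod c * norm x"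
proof -
  have 0: "inner x (times_i x) = 0"
    using inner_times_i[of x x] inner_commute[of "times_i x" x] by simp
  have "(norm (Re c *\<^sub>R x + Im c *\<^sub>R times_i x))\<^sup>2 = (Re c)\<^sup>2 * (norm x)\<^sup>2 + (Im c)\<^sup>2 * (norm x)\<^sup>2"
    unfolding power2_norm_eq_inner using 0 inner_commute[of "times_i x" x]
    by (simp add: inner_add_left inner_add_right inner_times_i power2_eq_square algebra_simps)
  also have "\<dots> = (cmod c * norm x)\<^sup>2" by (simp add: cmod_power2 power_mult_distrib algebra_simps)
  finally show ?thesis by (rule power2_eq_imp_eq) auto
qed

lemma cstar_algebra_operator_algebra: "cstar_algebra (operator_algebra :: ('i ell2 \<Rightarrow>\<^sub>L 'i ell2) cstar)"
proof -
  let ?B = "operator_algebra :: ('i ell2 \<Rightarrow>\<^sub>L 'i ell2) cstar"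
  note ops = operator_algebra_simps
  have ag: "abelian_group ?B"
  proof (rule abelian_groupI)
    fix T assume "T \<in> carrier ?B"
    then show "\<exists>S\<in>carrier ?B. S \<oplus>\<^bsub>?B\<^esub> T = \<zero>\<^bsub>?B\<^esub>"
      by (intro bexI[of _ "- T"]) (auto simp: ops complex_linear_ops intro: is_adjoint_ops)
  qed (auto simp: ops complex_linear_ops intro: is_adjoint_ops)
  interpret B: abelian_group ?B by (rule ag)
  have minus: "S \<ominus>\<^bsub>?B\<^esub> T = S - T" if "T \<in> carrier ?B" for S T
  proof -
    have "\<ominus>\<^bsub>?B\<^esub> T = - T" using that by (intro B.minus_equality) (auto simp: ops complex_linear_ops intro: is_adjoint_ops)
    then show ?thesis by (simp add: B.minus_eq ops)
  qed
  have adjE: "\<exists>S. is_adjoint T S \<and> adj ?B T = S \<and> complex_linear S" if "T \<in> carrier ?B" for T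
    using that operator_algebra_adj complex_linear_adjoint by (auto simp: ops)
  show ?thesis
  proof unfold_locales
    fix T c d
    assume T: "T \<in> carrier ?B"
    obtain T' where T': "is_adjoint T T'" "adj ?B T = T'" "complex_linear T'" using adjE[OF T] by blast
    have Tl: "complex_linear T" using T by (simp add: ops)
    show "c \<odot>\<^bsub>?B\<^esub> T \<in> carrier ?B"
      using is_adjoint_ops(3)[OF T'(1) Tl, of c] complex_linear_ops(3)[OF Tl, of c] by (auto simp: ops(1))
    show "(c + d) \<odot>\<^bsub>?B\<^esub> T = c \<odot>\<^bsub>?B\<^esub> T \<oplus>\<^bsub>?B\<^esub> d \<odot>\<^bsub>?B\<^esub> T"
      by (simp add: ops algebra_simps)
    show "(c * d) \<odot>\<^bsub>?B\<^esub> T = c \<odot>\<^bsub>?B\<^esub> (d \<odot>\<^bsub>?B\<^esub> T)"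
      by (rule blinfun_eqI, rule ell2_eqI)
        (simp add: ops blinfun.bilinear_simps times_i.rep_eq algebra_simps scaleR_conv_of_real)
    show "1 \<odot>\<^bsub>?B\<^esub> T = T" by (simp add: ops)
    show "adj ?B T \<in> carrier ?B" using T' is_adjoint_sym by (auto simp: ops(1))
    show "adj ?B (adj ?B T) = T" using T' operator_algebra_adj[OF is_adjoint_sym[OF T'(1)]] by simp
    show "adj ?B (c \<odot>\<^bsub>?B\<^esub> T) = cnj c \<odot>\<^bsub>?B\<^esub> adj ?B T"
      unfolding T'(2) by (rule operator_algebra_adj[OF is_adjoint_ops(3)[OF T'(1) Tl]])
    show "nrm ?B T = 0 \<longleftrightarrow> T = \<zero>\<^bsub>?B\<^esub>" by (simp add: ops)
    show "nrm ?B (adj ?B T \<otimes>\<^bsub>?B\<^esub> T) = (nrm ?B T)\<^sup>2"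
      using is_adjoint_norm_compose[OF T'(1)] T'(2) by (simp add: ops)
    show "nrm ?B (c \<odot>\<^bsub>?B\<^esub> T) = cmod c * nrm ?B T"
    proof -
      have app: "blinfun_apply (c \<odot>\<^bsub>?B\<^esub> T) x = Re c *\<^sub>R blinfun_apply T x + Im c *\<^sub>R times_i (blinfun_apply T x)" for x c
        by (simp add: ops blinfun.bilinear_simps)
      have le: "norm (c \<odot>\<^bsub>?B\<^esub> T) \<le> cmod c * norm T" for c
        by (rule norm_blinfun_bound) (auto simp: app norm_complex_scale mult.assoc intro!: mult_left_mono norm_blinfun)
      show ?thesis
      proof (cases "c = 0")
        case True then show ?thesis by (simp add: ops)
      next
        case False
        have "norm T \<le> norm (c \<odot>\<^bsub>?B\<^esub> T) / cmod c"
        proof (rule norm_blinfun_bound)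
          fix x
          have "cmod c * norm (blinfun_apply T x) \<le> norm (c \<odot>\<^bsub>?B\<^esub> T) * norm x"
            using norm_blinfun[of "c \<odot>\<^bsub>?B\<^esub> T" x] by (simp only: app norm_complex_scale)
          then show "norm (blinfun_apply T x) \<le> norm (c \<odot>\<^bsub>?B\<^esub> T) / cmod c * norm x"
            using False by (simp add: field_simps)
        qed simp
        then have "cmod c * norm T \<le> norm (c \<odot>\<^bsub>?B\<^esub> T)" using False by (simp add: field_simps)
        then show ?thesis using le[of c] by (simp only: ops(6) antisym)
      qed
    qed
    fix S assume S: "S \<in> carrier ?B"
    obtain S' where S': "is_adjoint S S'" "adj ?B S = S'" "complex_linear S'" using adjE[OF S] by blast
    have Sl: "complex_linear S" using S by (simp add: ops)
    show "c \<odot>\<^bsub>?B\<^esub> (T \<oplus>\<^bsub>?B\<^esub> S) = c \<odot>\<^bsub>?B\<^esub> T \<oplus>\<^bsub>?B\<^esub> c \<odot>\<^bsub>?B\<^esub> S"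
      by (rule blinfun_eqI, rule ell2_eqI) (simp add: ops blinfun.bilinear_simps times_i.rep_eq algebra_simps)
    show "T \<otimes>\<^bsub>?B\<^esub> S \<in> carrier ?B"
      using is_adjoint_ops(2)[OF T'(1) S'(1)] complex_linear_ops(2)[OF Tl Sl] by (auto simp: ops)
    show "adj ?B (T \<oplus>\<^bsub>?B\<^esub> S) = adj ?B T \<oplus>\<^bsub>?B\<^esub> adj ?B S"
      unfolding T'(2) S'(2) ops by (rule operator_algebra_adj[OF is_adjoint_ops(1)[OF T'(1) S'(1)]])
    show "adj ?B (T \<otimes>\<^bsub>?B\<^esub> S) = adj ?B S \<otimes>\<^bsub>?B\<^esub> adj ?B T"
      unfolding T'(2) S'(2) ops by (rule operator_algebra_adj[OF is_adjoint_ops(2)[OF T'(1) S'(1)]])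
    show "(c \<odot>\<^bsub>?B\<^esub> T) \<otimes>\<^bsub>?B\<^esub> S = c \<odot>\<^bsub>?B\<^esub> (T \<otimes>\<^bsub>?B\<^esub> S)"
      by (rule blinfun_eqI) (simp add: ops blinfun.bilinear_simps)
    show "T \<otimes>\<^bsub>?B\<^esub> (c \<odot>\<^bsub>?B\<^esub> S) = c \<odot>\<^bsub>?B\<^esub> (T \<otimes>\<^bsub>?B\<^esub> S)"
      using Tl by (intro blinfun_eqI) (simp add: ops blinfun.bilinear_simps complex_linear_def)
    show "nrm ?B (T \<oplus>\<^bsub>?B\<^esub> S) \<le> nrm ?B T + nrm ?B S" by (simp add: ops norm_triangle_ineq)
    show "nrm ?B (T \<otimes>\<^bsub>?B\<^esub> S) \<le> nrm ?B T * nrm ?B S" by (simp add: ops norm_blinfun_compose)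
    fix R assume R: "R \<in> carrier ?B"
    show "(T \<otimes>\<^bsub>?B\<^esub> S) \<otimes>\<^bsub>?B\<^esub> R = T \<otimes>\<^bsub>?B\<^esub> (S \<otimes>\<^bsub>?B\<^esub> R)" by (rule blinfun_eqI) (simp add: ops)
    show "(T \<oplus>\<^bsub>?B\<^esub> S) \<otimes>\<^bsub>?B\<^esub> R = T \<otimes>\<^bsub>?B\<^esub> R \<oplus>\<^bsub>?B\<^esub> S \<otimes>\<^bsub>?B\<^esub> R"
      by (rule blinfun_eqI) (simp add: ops blinfun.bilinear_simps)
    show "R \<otimes>\<^bsub>?B\<^esub> (T \<oplus>\<^bsub>?B\<^esub> S) = R \<otimes>\<^bsub>?B\<^esub> T \<oplus>\<^bsub>?B\<^esub> R \<otimes>\<^bsub>?B\<^esub> S"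
      by (rule blinfun_eqI) (simp add: ops blinfun.bilinear_simps)
  next
    fix X :: "nat \<Rightarrow> 'i ell2 \<Rightarrow>\<^sub>L 'i ell2" assume X: "\<And>n. X n \<in> carrier ?B"
      and Cau: "\<And>e. e > 0 \<Longrightarrow> \<exists>N. \<forall>m\<ge>N. \<forall>n\<ge>N. nrm ?B (X m \<ominus>\<^bsub>?B\<^esub> X n) < e"
    have Cau': "\<exists>N. \<forall>m\<ge>N. \<forall>n\<ge>N. norm (X m - X n) < e" if "e > 0" for e
      using Cau[OF that] by (simp add: minus[OF X] ops)
    then have "Cauchy X" by (simp add: Cauchy_def dist_norm)
    then obtain T where T: "X \<longlonglongrightarrow> T" using Cauchy_convergent convergent_def by blast
    have "\<exists>S. is_adjoint (X n) S" for n using X[of n] by (auto simp: ops)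
    then obtain Y where Y: "\<And>n. is_adjoint (X n) (Y n)" by metis
    \<comment> \<open>Taking adjoints is isometric, so the adjoints form a Cauchy sequence too.
      Their limit is an adjoint of the limit of the operators, which keeps the limit in the
      carrier.\<close>
    have YX: "norm (Y m - Y n) = norm (X m - X n)" for m n
      using is_adjoint_norm_eq[OF is_adjoint_ops(1)[OF Y[of m] is_adjoint_ops(5)[OF Y[of n]]]] by simp
    have "Cauchy Y" using Cau' by (simp add: Cauchy_def dist_norm YX)
    then obtain S where S: "Y \<longlonglongrightarrow> S" using Cauchy_convergent convergent_def by blast
    have app: "(\<lambda>n. blinfun_apply (X n) x) \<longlonglongrightarrow> blinfun_apply T x" "(\<lambda>n. blinfun_apply (Y n) x) \<longlonglongrightarrow> blinfun_apply S x" for x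
      using T S by (auto intro: blinfun.tendsto)
    have "is_adjoint T S" unfolding is_adjoint_def
    proof (intro allI)
      fix x y
      have "(\<lambda>n. inner (blinfun_apply (X n) x) y) \<longlonglongrightarrow> inner (blinfun_apply T x) y"
        "(\<lambda>n. inner x (blinfun_apply (Y n) y)) \<longlonglongrightarrow> inner x (blinfun_apply S y)"
        by (intro tendsto_inner app tendsto_const)+
      then show "inner (blinfun_apply T x) y = inner x (blinfun_apply S y)"
        using is_adjointD[OF Y] LIMSEQ_unique by fastforce
    qed
    moreover have "complex_linear T" unfolding complex_linear_def
    proof
      fix x
      have "(\<lambda>n. times_i (blinfun_apply (X n) x)) \<longlonglongrightarrow> times_i (blinfun_apply T x)"
        by (rule bounded_linear.tendsto[OF bounded_linear_times_i app(1)])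
      moreover have "times_i (blinfun_apply (X n) x) = blinfun_apply (X n) (times_i x)" for n
        using X[of n] by (simp add: ops complex_linear_def)
      ultimately show "blinfun_apply T (times_i x) = times_i (blinfun_apply T x)"
        using app(1)[of "times_i x"] LIMSEQ_unique by auto
    qed
    ultimately have Tc: "T \<in> carrier ?B" by (auto simp: ops)
    have "(\<lambda>n. norm (X n - T)) \<longlonglongrightarrow> 0" using T by (simp add: LIM_zero tendsto_norm_zero)
    then show "\<exists>x\<in>carrier ?B. (\<lambda>n. nrm ?B (X n \<ominus>\<^bsub>?B\<^esub> x)) \<longlonglongrightarrow> 0"
      using Tc by (intro bexI[of _ T]) (auto simp: minus ops)
  qed
qed

section \<open>Operators induced by partial injections of the index set\<close>

definition mutual_inverse :: "('i \<Rightarrow> 'i option) \<Rightarrow> ('i \<Rightarrow> 'i option) \<Rightarrow> bool" where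
  "mutual_inverse h k \<longleftrightarrow> (\<forall>i j. h i = Some j \<longleftrightarrow> k j = Some i)"

text \<open>If \<open>h\<close> is a partial injection with inverse \<open>k\<close>, pulling back
  along \<open>h\<close> is a partial isometry. It sends the basis vector at \<open>j\<close> to the
  one at \<open>i\<close> with \<open>h i = Some j\<close>, so basis vectors move in the direction
  of \<open>k\<close>.\<close>

definition pullback_fun :: "('i \<Rightarrow> 'i option) \<Rightarrow> ('i \<Rightarrow> complex) \<Rightarrow> 'i \<Rightarrow> complex" where
  "pullback_fun h f i = (case h i of None \<Rightarrow> 0 | Some j \<Rightarrow> f j)"

lemma mutual_inverse_sym: "mutual_inverse h k \<Longrightarrow> mutual_inverse k h"
  by (auto simp: mutual_inverse_def)

lemma mutual_inverseD: "mutual_inverse h k \<Longrightarrow> h i = Some j \<Longrightarrow> k j = Some i"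
  by (auto simp: mutual_inverse_def)

lemma mutual_inverse_bij:
  assumes hk: "mutual_inverse h k" shows "bij_betw (\<lambda>i. the (h i)) (dom h) (dom k)"
proof -
  have *: "\<And>h k i. mutual_inverse h k \<Longrightarrow> i \<in> dom h \<Longrightarrow> the (k (the (h i))) = i \<and> the (h i) \<in> dom k"
    by (auto dest: mutual_inverseD)
  show ?thesis
    by (rule bij_betw_byWitness[where f' = "\<lambda>j. the (k j)"])
      (use *[OF hk] *[OF mutual_inverse_sym[OF hk]] in blast)+
qed

text \<open>Reindexing from \<open>dom h\<close> to \<open>dom k\<close> preserves the sum. The
  coordinates outside \<open>dom k\<close> are lost, hence the inequality.\<close>

lemma pullback_fun_summable:
  assumes hk: "mutual_inverse h k" and f: "(\<lambda>i. (cmod (f i))\<^sup>2) summable_on UNIV"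
  shows "(\<lambda>i. (cmod (pullback_fun h f i))\<^sup>2) summable_on UNIV"
    and "(\<Sum>\<^sub>\<infinity>i. (cmod (pullback_fun h f i))\<^sup>2) \<le> (\<Sum>\<^sub>\<infinity>i. (cmod (f i))\<^sup>2)"
proof -
  have s: "(\<lambda>j. (cmod (f j))\<^sup>2) summable_on dom k" using f by (rule summable_on_subset_banach) simp
  have e: "(cmod (pullback_fun h f i))\<^sup>2 = (cmod (f (the (h i))))\<^sup>2" if "i \<in> dom h" for i
    using that by (auto simp: pullback_fun_def)
  have z: "(cmod (pullback_fun h f i))\<^sup>2 = 0" if "i \<notin> dom h" for i
    using that by (auto simp: pullback_fun_def domIff)
  have "(\<lambda>i. (cmod (f (the (h i))))\<^sup>2) summable_on dom h"
    using s by (simp add: summable_on_reindex_bij_betw[OF mutual_inverse_bij[OF hk], of "\<lambda>j. (cmod (f j))\<^sup>2"])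
  then show s1: "(\<lambda>i. (cmod (pullback_fun h f i))\<^sup>2) summable_on UNIV"
    using summable_on_cong_neutral[of "dom h" UNIV "\<lambda>i. (cmod (f (the (h i))))\<^sup>2" "\<lambda>i. (cmod (pullback_fun h f i))\<^sup>2"] e z
    by simp
  have "(\<Sum>\<^sub>\<infinity>i. (cmod (pullback_fun h f i))\<^sup>2) = (\<Sum>\<^sub>\<infinity>i\<in>dom h. (cmod (f (the (h i))))\<^sup>2)"
    by (rule infsum_cong_neutral) (use e z in auto)
  also have "\<dots> = (\<Sum>\<^sub>\<infinity>j\<in>dom k. (cmod (f j))\<^sup>2)"
    by (rule infsum_reindex_bij_betw[OF mutual_inverse_bij[OF hk]])
  also have "\<dots> \<le> (\<Sum>\<^sub>\<infinity>j. (cmod (f j))\<^sup>2)"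
    using s f by (intro infsum_mono_neutral) auto
  finally show "(\<Sum>\<^sub>\<infinity>i. (cmod (pullback_fun h f i))\<^sup>2) \<le> (\<Sum>\<^sub>\<infinity>i. (cmod (f i))\<^sup>2)" .
qed

definition pullback :: "('i \<Rightarrow> 'i option) \<Rightarrow> 'i ell2 \<Rightarrow>\<^sub>L 'i ell2" where
  "pullback h = Blinfun (\<lambda>x. Abs_ell2 (pullback_fun h (Rep_ell2 x)))"

lemma Rep_pullback:
  assumes "mutual_inverse h k"
  shows "Rep_ell2 (blinfun_apply (pullback h) x) = pullback_fun h (Rep_ell2 x)"
proof -
  have r: "Rep_ell2 (Abs_ell2 (pullback_fun h (Rep_ell2 x))) = pullback_fun h (Rep_ell2 x)" for x
    using pullback_fun_summable(1)[OF assms Rep_ell2_summable] by (intro Abs_ell2_inverse) simp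
  have "bounded_linear (\<lambda>x. Abs_ell2 (pullback_fun h (Rep_ell2 x)))"
  proof (rule bounded_linear_intro[where K = 1])
    fix x :: "'a ell2"
    have "(norm (Abs_ell2 (pullback_fun h (Rep_ell2 x))))\<^sup>2 \<le> (norm x)\<^sup>2"
      unfolding norm_ell2_sq r by (rule pullback_fun_summable(2)[OF assms Rep_ell2_summable])
    then show "norm (Abs_ell2 (pullback_fun h (Rep_ell2 x))) \<le> norm x * 1"
      using power2_le_imp_le[OF _ norm_ge_zero] by simp
  qed (auto intro!: ell2_eqI simp: r pullback_fun_def split: option.split)
  then show ?thesis by (simp add: pullback_def bounded_linear_Blinfun_apply r)
qed

text \<open>Both inner products are the sum over matched pairs of indices, taken once over
  \<open>dom h\<close> and once over \<open>dom k\<close>.\<close>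

lemma is_adjoint_pullback:
  assumes hk: "mutual_inverse h k" shows "is_adjoint (pullback h) (pullback k)"
  unfolding is_adjoint_def
proof (intro allI)
  fix x y
  let ?g = "\<lambda>j. inner (Rep_ell2 x j) (Rep_ell2 y (the (k j)))"
  have "inner (blinfun_apply (pullback h) x) y = (\<Sum>\<^sub>\<infinity>i\<in>dom h. ?g (the (h i)))"
    unfolding inner_ell2.rep_eq Rep_pullback[OF hk]
  proof (rule infsum_cong_neutral)
    fix i assume "i \<in> UNIV \<inter> dom h"
    then obtain j where j: "h i = Some j" by auto
    then show "inner (pullback_fun h (Rep_ell2 x) i) (Rep_ell2 y i) = ?g (the (h i))"
      using mutual_inverseD[OF hk j] by (simp add: pullback_fun_def)
  qed (auto simp: pullback_fun_def domIff)
  also have "\<dots> = (\<Sum>\<^sub>\<infinity>j\<in>dom k. ?g j)" by (rule infsum_reindex_bij_betw[OF mutual_inverse_bij[OF hk]])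
  also have "\<dots> = inner x (blinfun_apply (pullback k) y)"
    unfolding inner_ell2.rep_eq Rep_pullback[OF mutual_inverse_sym[OF hk]]
    by (rule infsum_cong_neutral) (auto simp: pullback_fun_def domIff)
  finally show "inner (blinfun_apply (pullback h) x) y = inner x (blinfun_apply (pullback k) y)" .
qed

lemma complex_linear_pullback: "mutual_inverse h k \<Longrightarrow> complex_linear (pullback h)"
  unfolding complex_linear_def
  by (auto intro!: ell2_eqI simp: Rep_pullback times_i.rep_eq pullback_fun_def split: option.split)

lemma pullback_carrier: "mutual_inverse h k \<Longrightarrow> pullback h \<in> carrier operator_algebra"
  using is_adjoint_pullback complex_linear_pullback by (auto simp: operator_algebra_simps)

lemma adj_pullback: "mutual_inverse h k \<Longrightarrow> adj operator_algebra (pullback h) = pullback k"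
  by (intro operator_algebra_adj is_adjoint_pullback)

lemma mutual_inverse_comp: "mutual_inverse h k \<Longrightarrow> mutual_inverse h' k' \<Longrightarrow> mutual_inverse (h' \<circ>\<^sub>m h) (k \<circ>\<^sub>m k')"
  by (auto simp: mutual_inverse_def map_comp_Some_iff)

text \<open>Pullback is contravariant, which explains the reversed order of the partial
  maps.\<close>

lemma pullback_mult:
  assumes "mutual_inverse h k" "mutual_inverse h' k'"
  shows "pullback h \<otimes>\<^bsub>operator_algebra\<^esub> pullback h' = pullback (h' \<circ>\<^sub>m h)"
  by (intro blinfun_eqI ell2_eqI)
    (simp add: operator_algebra_simps Rep_pullback[OF assms(1)] Rep_pullback[OF assms(2)]
      Rep_pullback[OF mutual_inverse_comp[OF assms]], simp add: pullback_fun_def map_comp_def split: option.split)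

definition restr :: "'i set \<Rightarrow> 'i \<Rightarrow> 'i option" where
  "restr S i = (if i \<in> S then Some i else None)"

lemma mutual_inverse_restr: "mutual_inverse (restr S) (restr S)"
  by (auto simp: mutual_inverse_def restr_def)

lemma pullback_restr_simps:
  "Rep_ell2 (blinfun_apply (pullback (restr S)) x) i = (if i \<in> S then Rep_ell2 x i else 0)"
  by (simp add: Rep_pullback[OF mutual_inverse_restr] pullback_fun_def restr_def)

lemma pullback_restr_mult: "pullback (restr S) \<otimes>\<^bsub>operator_algebra\<^esub> pullback (restr T) = pullback (restr (S \<inter> T))"
  by (intro blinfun_eqI ell2_eqI) (simp add: operator_algebra_simps pullback_restr_simps)

lemma pullback_restr_empty: "pullback (restr {}) = \<zero>\<^bsub>operator_algebra\<^esub>"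
  by (intro blinfun_eqI ell2_eqI) (simp add: operator_algebra_simps pullback_restr_simps)

lemma pullback_restr_Un:
  "S \<inter> T = {} \<Longrightarrow> pullback (restr (S \<union> T)) = pullback (restr S) \<oplus>\<^bsub>operator_algebra\<^esub> pullback (restr T)"
  by (intro blinfun_eqI ell2_eqI) (auto simp: operator_algebra_simps pullback_restr_simps blinfun.bilinear_simps)

lemma summable_delta: "(\<lambda>j. (cmod (if j = i then 1 else 0))\<^sup>2) summable_on UNIV"
proof -
  have "(\<lambda>j. (cmod (if j = i then 1 else 0))\<^sup>2) summable_on UNIV \<longleftrightarrow> (\<lambda>j. (1::real)) summable_on {i}"
    by (rule summable_on_cong_neutral) auto
  then show ?thesis by simp
qed

lemma Rep_delta: "Rep_ell2 (Abs_ell2 (\<lambda>j. if j = i then 1 else 0)) = (\<lambda>j. if j = i then 1 else 0)"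
  by (rule Abs_ell2_inverse, rule CollectI, rule summable_delta)

lemma pullback_restr_eqD:
  assumes "pullback (restr S) = \<zero>\<^bsub>operator_algebra\<^esub>" shows "S = {}"
proof (rule equals0I)
  fix i assume i: "i \<in> S"
  let ?d = "Abs_ell2 (\<lambda>j. if j = i then 1 else 0) :: 'a ell2"
  have "Rep_ell2 ?d i = 1" by (simp add: Rep_delta)
  then have "Rep_ell2 (blinfun_apply (pullback (restr S)) ?d) i = 1" using i by (simp add: pullback_restr_simps)
  then show False using assms by (simp add: operator_algebra_simps)
qed

lemma projection_pullback_restr: "projection operator_algebra (pullback (restr S))"
  by (simp add: projection_def pullback_carrier[OF mutual_inverse_restr] adj_pullback[OF mutual_inverse_restr]
      pullback_restr_mult)

text \<open>The matrix entries determine an operator on the basis vectors and, by complex linearity,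
  on their multiples by \<open>i\<close>. The real and imaginary parts of the coordinates of the
  adjoint at \<open>y\<close> are the inner products of \<open>y\<close> with these values. So the
  adjoints coincide, and with them the operators.\<close>

lemma operator_algebra_inj_on_matrices:
  "\<exists>g :: (('i::countable) ell2 \<Rightarrow>\<^sub>L 'i ell2) \<Rightarrow> nat \<Rightarrow> nat \<Rightarrow> complex. inj_on g (carrier operator_algebra)"
proof -
  define d :: "'i \<Rightarrow> 'i ell2" where "d i = Abs_ell2 (\<lambda>j. if j = i then 1 else 0)" for i
  have dR: "Rep_ell2 (d i) = (\<lambda>j. if j = i then 1 else 0)" for i
    by (simp add: d_def Rep_delta)
  have inner_d: "inner (d i) x = Re (Rep_ell2 x i)" "inner (times_i (d i)) x = Im (Rep_ell2 x i)" for i x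
  proof -
    have "inner (d i) x = (\<Sum>\<^sub>\<infinity>j\<in>{i}. Re (Rep_ell2 x j))"
      unfolding inner_ell2.rep_eq by (rule infsum_cong_neutral) (auto simp: dR inner_complex_def)
    then show "inner (d i) x = Re (Rep_ell2 x i)" by simp
    have "inner (times_i (d i)) x = (\<Sum>\<^sub>\<infinity>j\<in>{i}. Im (Rep_ell2 x j))"
      unfolding inner_ell2.rep_eq by (rule infsum_cong_neutral) (auto simp: dR times_i.rep_eq inner_complex_def)
    then show "inner (times_i (d i)) x = Im (Rep_ell2 x i)" by simp
  qed
  define g :: "('i ell2 \<Rightarrow>\<^sub>L 'i ell2) \<Rightarrow> nat \<Rightarrow> nat \<Rightarrow> complex" where
    "g T = (\<lambda>m n. Rep_ell2 (blinfun_apply T (d (from_nat m))) (from_nat n))" for T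
  have "S = T" if S: "S \<in> carrier operator_algebra" and T: "T \<in> carrier operator_algebra" and eq: "g S = g T" for S T
  proof -
    obtain S' T' where S': "is_adjoint S S'" "complex_linear S'" and T': "is_adjoint T T'" "complex_linear T'"
      using S T complex_linear_adjoint by (auto simp: operator_algebra_simps)
    have "Rep_ell2 (blinfun_apply S (d j)) i = Rep_ell2 (blinfun_apply T (d j)) i" for i j
      using fun_cong[OF fun_cong[OF eq], of "to_nat j" "to_nat i"] by (simp add: g_def)
    then have Sd: "blinfun_apply S (d j) = blinfun_apply T (d j)" for j by (rule ell2_eqI)
    have Sd': "blinfun_apply S (times_i (d j)) = blinfun_apply T (times_i (d j))" for j
      using S T Sd[of j] by (simp add: operator_algebra_simps complex_linear_def)
    have "blinfun_apply S' y = blinfun_apply T' y" for y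
    proof (rule ell2_eqI, rule complex_eqI)
      fix j
      show "Re (Rep_ell2 (blinfun_apply S' y) j) = Re (Rep_ell2 (blinfun_apply T' y) j)"
        using is_adjointD[OF S'(1), of "d j" y] is_adjointD[OF T'(1), of "d j" y] Sd[of j] by (simp add: inner_d)
      show "Im (Rep_ell2 (blinfun_apply S' y) j) = Im (Rep_ell2 (blinfun_apply T' y) j)"
        using is_adjointD[OF S'(1), of "times_i (d j)" y] is_adjointD[OF T'(1), of "times_i (d j)" y] Sd'[of j]
        by (simp add: inner_d)
    qed
    then have "S' = T'" by (rule blinfun_eqI)
    then show "S = T" using is_adjoint_sym[OF S'(1)] is_adjoint_sym[OF T'(1)] is_adjoint_unique by blast
  qed
  then show ?thesis by (auto simp: inj_on_def)
qed

section \<open>A concrete Toeplitz family\<close>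

text \<open>The generator of an edge \<open>e\<close> maps the basis vector \<open>(s e, l)\<close> to \<open>(r e, e # l)\<close>, with
  vertices and edges coded as numbers. No basis vector \<open>(v, [])\<close> is in the range of a generator.\<close>

lemma exists_toeplitz_family_with_gaps:
  fixes E :: "('v, 'e) pre_digraph"
  assumes E: "fin_digraph E"
  obtains B :: "((nat \<times> nat list) ell2 \<Rightarrow>\<^sub>L (nat \<times> nat list) ell2) cstar" and Q T
    and g :: "((nat \<times> nat list) ell2 \<Rightarrow>\<^sub>L (nat \<times> nat list) ell2) \<Rightarrow> nat \<Rightarrow> nat \<Rightarrow> complex"
  where "cstar_algebra B" "toeplitz_family E B Q T" "inj_on g (carrier B)"
    "\<And>v. v \<in> verts E \<Longrightarrow> (\<Oplus>\<^bsub>B\<^esub>e\<in>in_arcs E v. T e \<otimes>\<^bsub>B\<^esub> adj B (T e)) \<noteq> Q v"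
proof -
  interpret fin_digraph E by fact
  let ?B = "operator_algebra :: ((nat \<times> nat list) ell2 \<Rightarrow>\<^sub>L (nat \<times> nat list) ell2) cstar"
  interpret B: cstar_algebra ?B by (rule cstar_algebra_operator_algebra)
  obtain a :: "'v \<Rightarrow> nat" where a: "inj_on a (verts E)"
    using finite_imp_inj_to_nat_seg[OF finite_verts] by blast
  obtain b :: "'e \<Rightarrow> nat" where b: "inj_on b (arcs E)"
    using finite_imp_inj_to_nat_seg[OF finite_arcs] by blast
  \<comment> \<open>\<open>X v\<close> and \<open>Y e\<close> are the index sets that carry the
    projection of \<open>v\<close> and the range projection of \<open>e\<close>. The second
    component runs over all lists, paths or not, since its leading entry already separates the
    ranges.\<close>
  define X where "X v = {a v} \<times> (UNIV :: nat list set)" for v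
  define Y where "Y e = {a (head E e)} \<times> ((#) (b e) ` UNIV)" for e
  \<comment> \<open>\<open>h e\<close> removes the leading code of \<open>e\<close>. Pullback
    reverses direction, so the operator along \<open>h e\<close> prepends it.\<close>
  define h where "h e = (\<lambda>(w, l). case l of [] \<Rightarrow> None | x # l' \<Rightarrow>
      if w = a (head E e) \<and> x = b e then Some (a (tail E e), l') else None)" for e
  define k where "k e = (\<lambda>(w, l). if w = a (tail E e) then Some (a (head E e), b e # l) else None)" for e
  define Q where "Q v = pullback (restr (X v))" for v
  define T where "T e = pullback (h e)" for e
  have hk: "mutual_inverse (h e) (k e)" for e
    by (auto simp: mutual_inverse_def h_def k_def split: list.splits if_splits)
  have kh: "h e \<circ>\<^sub>m k e = restr (X (tail E e))" and hk': "k e \<circ>\<^sub>m h e = restr (Y e)" for e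
    by (auto simp: map_comp_def h_def k_def restr_def X_def Y_def fun_eq_iff split: list.splits)
  have TT: "adj ?B (T e) \<otimes>\<^bsub>?B\<^esub> T e = Q (tail E e)" for e
    unfolding T_def Q_def adj_pullback[OF hk] pullback_mult[OF mutual_inverse_sym[OF hk] hk] kh ..
  have TT': "T e \<otimes>\<^bsub>?B\<^esub> adj ?B (T e) = pullback (restr (Y e))" for e
    unfolding T_def adj_pullback[OF hk] pullback_mult[OF hk mutual_inverse_sym[OF hk]] hk' ..
  have Tc: "T e \<in> carrier ?B" for e unfolding T_def by (rule pullback_carrier[OF hk])
  have pc: "pullback (restr S) \<in> carrier ?B" for S by (rule pullback_carrier[OF mutual_inverse_restr])
  have sum: "(\<Oplus>\<^bsub>?B\<^esub>e\<in>I. T e \<otimes>\<^bsub>?B\<^esub> adj ?B (T e)) = pullback (restr (\<Union>e\<in>I. Y e))" if "finite I" "I \<subseteq> arcs E" for I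
    using that
  proof (induction I rule: finite_induct)
    case empty then show ?case by (simp add: pullback_restr_empty)
  next
    case (insert e I)
    have "Y e \<inter> (\<Union>e\<in>I. Y e) = {}"
      using insert.hyps(2) insert.prems inj_onD[OF b] by (auto simp: Y_def)
    then have "pullback (restr (Y e \<union> (\<Union>e\<in>I. Y e))) = pullback (restr (Y e)) \<oplus>\<^bsub>?B\<^esub> pullback (restr (\<Union>e\<in>I. Y e))"
      by (rule pullback_restr_Un)
    then show ?case using insert by (simp add: TT' pc)
  qed
  have gap: "Q v \<ominus>\<^bsub>?B\<^esub> (\<Oplus>\<^bsub>?B\<^esub>e\<in>in_arcs E v. T e \<otimes>\<^bsub>?B\<^esub> adj ?B (T e)) = pullback (restr (X v - (\<Union>e\<in>in_arcs E v. Y e)))"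
    if v: "v \<in> verts E" for v
  proof -
    let ?U = "\<Union>e\<in>in_arcs E v. Y e"
    have sub: "?U \<subseteq> X v" by (auto simp: X_def Y_def in_arcs_def)
    have "(X v - ?U) \<union> ?U = X v" "(X v - ?U) \<inter> ?U = {}" using sub by blast+
    then have "Q v = pullback (restr (X v - ?U)) \<oplus>\<^bsub>?B\<^esub> pullback (restr ?U)"
      unfolding Q_def using pullback_restr_Un[of "X v - ?U" ?U] by (simp only:)
    moreover have "(\<Oplus>\<^bsub>?B\<^esub>e\<in>in_arcs E v. T e \<otimes>\<^bsub>?B\<^esub> adj ?B (T e)) = pullback (restr ?U)"
      by (rule sum) (auto simp: in_arcs_def)
    ultimately show ?thesis using pc by (simp add: B.minus_eq B.a_assoc B.r_neg)
  qed
  have "toeplitz_family E ?B Q T"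
    unfolding toeplitz_family_def
  proof (intro conjI ballI impI)
    fix v assume v: "v \<in> verts E"
    show "projection ?B (Q v)" unfolding Q_def by (rule projection_pullback_restr)
    show "cstar_le ?B (\<Oplus>\<^bsub>?B\<^esub>e\<in>in_arcs E v. T e \<otimes>\<^bsub>?B\<^esub> adj ?B (T e)) (Q v)"
      unfolding cstar_le_def gap[OF v] using pc
      by (intro bexI[of _ "pullback (restr (X v - (\<Union>e\<in>in_arcs E v. Y e)))"])
        (simp_all add: adj_pullback[OF mutual_inverse_restr] pullback_restr_mult)
  next
    fix v w assume "v \<in> verts E" "w \<in> verts E" "v \<noteq> w"
    then have "X v \<inter> X w = {}" using a by (auto simp: X_def inj_on_eq_iff)
    then show "Q v \<otimes>\<^bsub>?B\<^esub> Q w = \<zero>\<^bsub>?B\<^esub>" unfolding Q_def pullback_restr_mult by (simp add: pullback_restr_empty)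
  next
    fix e
    show "partial_isometry ?B (T e)"
    proof -
      have "T e \<otimes>\<^bsub>?B\<^esub> adj ?B (T e) \<otimes>\<^bsub>?B\<^esub> T e = pullback (h e \<circ>\<^sub>m restr (Y e))"
        unfolding TT' unfolding T_def by (rule pullback_mult[OF mutual_inverse_restr hk])
      also have "h e \<circ>\<^sub>m restr (Y e) = h e"
        by (auto simp: map_comp_def restr_def Y_def h_def fun_eq_iff split: list.splits)
      finally show ?thesis using Tc by (simp add: partial_isometry_def T_def)
    qed
    show "adj ?B (T e) \<otimes>\<^bsub>?B\<^esub> T e = Q (tail E e)" by (rule TT)
  qed
  moreover have "(\<Oplus>\<^bsub>?B\<^esub>e\<in>in_arcs E v. T e \<otimes>\<^bsub>?B\<^esub> adj ?B (T e)) \<noteq> Q v" if v: "v \<in> verts E" for v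
  proof
    assume e: "(\<Oplus>\<^bsub>?B\<^esub>e\<in>in_arcs E v. T e \<otimes>\<^bsub>?B\<^esub> adj ?B (T e)) = Q v"
    have "pullback (restr (X v - (\<Union>e\<in>in_arcs E v. Y e))) = \<zero>\<^bsub>?B\<^esub>"
      unfolding gap[OF v, symmetric] e by (rule B.minus_self) (simp add: Q_def pc)
    then have "X v - (\<Union>e\<in>in_arcs E v. Y e) = {}" by (rule pullback_restr_eqD)
    moreover have "(a v, []) \<in> X v - (\<Union>e\<in>in_arcs E v. Y e)" by (auto simp: X_def Y_def)
    ultimately show False by blast
  qed
  moreover obtain g :: "((nat \<times> nat list) ell2 \<Rightarrow>\<^sub>L (nat \<times> nat list) ell2) \<Rightarrow> nat \<Rightarrow> nat \<Rightarrow> complex"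
    where "inj_on g (carrier ?B)" using operator_algebra_inj_on_matrices by blast
  ultimately show ?thesis using that B.cstar_algebra_axioms by blast
qed

section \<open>The structure of Toeplitz algebras\<close>

locale toeplitz = cstar_algebra A for A :: "'a cstar" (structure) +
  fixes E :: "('v, 'e) pre_digraph" and q :: "'v \<Rightarrow> 'a" and t :: "'e \<Rightarrow> 'a"
  assumes fin_digraph: "fin_digraph E" and toeplitz_algebra: "toeplitz_algebra E A q t"
begin

sublocale G: fin_digraph E by (rule fin_digraph)

lemma family: "toeplitz_family E A q t" and generated: "cstar_generated_by A (q ` verts E \<union> t ` arcs E)"
  using toeplitz_algebra by (auto simp: toeplitz_algebra_def)

section \<open>Relations between the generators\<close>

lemma q_closed [simp]: "v \<in> verts E \<Longrightarrow> q v \<in> carrier A"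
  and q_adj: "v \<in> verts E \<Longrightarrow> adj A (q v) = q v"
  and q_idem: "v \<in> verts E \<Longrightarrow> q v \<otimes> q v = q v"
  using toeplitz_familyD(1)[OF family] by (auto simp: projection_def)

lemma q_mult: "v \<in> verts E \<Longrightarrow> w \<in> verts E \<Longrightarrow> q v \<otimes> q w = (if v = w then q v else \<zero>)"
  using toeplitz_familyD(2)[OF family] q_idem by auto

lemma t_closed [simp]: "e \<in> arcs E \<Longrightarrow> t e \<in> carrier A"
  and t_adj_t: "e \<in> arcs E \<Longrightarrow> t e \<otimes> adj A (t e) \<otimes> t e = t e"
  using toeplitz_familyD(3)[OF family] by (auto simp: partial_isometry_def)

lemma adj_t_t: "e \<in> arcs E \<Longrightarrow> adj A (t e) \<otimes> t e = q (tail E e)"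
  using toeplitz_familyD(4)[OF family] by auto

lemma t_tail: "e \<in> arcs E \<Longrightarrow> t e \<otimes> q (tail E e) = t e"
  using t_adj_t[of e] adj_t_t[of e] by (simp add: mult_assoc adj_closed)

lemma range_projection: "e \<in> arcs E \<Longrightarrow> projection A (t e \<otimes> adj A (t e))"
  by (simp add: projection_def mult_closed adj_closed adj_mult adj_adj mult_assoc[symmetric] t_adj_t)

text \<open>Here the order relation in the definition of a Toeplitz family is turned into identities
  between projections; its witness \<open>b\<close> does not appear afterwards.\<close>

lemma
  assumes v: "v \<in> verts E"
  shows range_projection_absorb: "e \<in> in_arcs E v \<Longrightarrow> q v \<otimes> (t e \<otimes> adj A (t e)) = t e \<otimes> adj A (t e)"
    and range_projection_orthogonal: "e \<in> in_arcs E v \<Longrightarrow> f \<in> in_arcs E v \<Longrightarrow> e \<noteq> f \<Longrightarrow>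
      (t e \<otimes> adj A (t e)) \<otimes> (t f \<otimes> adj A (t f)) = \<zero>"
proof -
  obtain b where b: "b \<in> carrier A" "q v \<ominus> (\<Oplus>e\<in>in_arcs E v. t e \<otimes> adj A (t e)) = adj A b \<otimes> b"
    using toeplitz_familyD(5)[OF family v] by (auto simp: cstar_le_def)
  have f: "finite (in_arcs E v)" and p: "\<And>e. e \<in> in_arcs E v \<Longrightarrow> projection A (t e \<otimes> adj A (t e))"
    by (auto simp: in_arcs_def range_projection)
  note * = projection_sum_le_absorb[OF toeplitz_familyD(1)[OF family v] f p b]
    projection_sum_le_orthogonal[OF toeplitz_familyD(1)[OF family v] f p b]
  show "e \<in> in_arcs E v \<Longrightarrow> q v \<otimes> (t e \<otimes> adj A (t e)) = t e \<otimes> adj A (t e)" by (rule *(1))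
  show "e \<in> in_arcs E v \<Longrightarrow> f \<in> in_arcs E v \<Longrightarrow> e \<noteq> f \<Longrightarrow>
      (t e \<otimes> adj A (t e)) \<otimes> (t f \<otimes> adj A (t f)) = \<zero>" by (rule *(2))
qed

lemma t_head: assumes e: "e \<in> arcs E" shows "q (head E e) \<otimes> t e = t e"
proof -
  have "q (head E e) \<otimes> (t e \<otimes> adj A (t e)) \<otimes> t e = (t e \<otimes> adj A (t e)) \<otimes> t e"
    using range_projection_absorb[of "head E e" e] e by simp
  then show ?thesis using e t_adj_t[OF e] by (simp add: mult_assoc mult_closed adj_closed)
qed

lemma q_t:
  assumes "v \<in> verts E" "e \<in> arcs E" shows "q v \<otimes> t e = (if v = head E e then t e else \<zero>)"
proof -
  have "q v \<otimes> t e = (q v \<otimes> q (head E e)) \<otimes> t e" using assms t_head by (simp add: mult_assoc)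
  then show ?thesis using assms t_head by (simp add: q_mult)
qed

lemma adj_t_q:
  assumes "v \<in> verts E" "e \<in> arcs E" shows "adj A (t e) \<otimes> q v = (if v = head E e then adj A (t e) else \<zero>)"
  using arg_cong[OF q_t[OF assms], of "adj A"] assms by (auto simp: adj_mult q_adj split: if_splits)

text \<open>For distinct edges with the same head, the orthogonality of the range projections is
  multiplied by \<open>adj A (t e)\<close> on the left and \<open>t f\<close> on the right. For
  different heads the two vertex projections between the factors are orthogonal.\<close>

lemma adj_t_t':
  assumes e: "e \<in> arcs E" and f: "f \<in> arcs E"
  shows "adj A (t e) \<otimes> t f = (if e = f then q (tail E e) else \<zero>)"
proof (cases "e = f")
  case True then show ?thesis using adj_t_t e by simp
next
  case False
  have hv: "q (head E f) \<in> carrier A" using f by simp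
  have eq: "adj A (t e) \<otimes> t f = (adj A (t e) \<otimes> q (head E f)) \<otimes> t f"
    using e f t_head[OF f] by (simp add: mult_assoc adj_closed)
  have same_head: "adj A (t e) \<otimes> t f = \<zero>" if h: "head E f = head E e"
  proof -
    have "(t e \<otimes> adj A (t e)) \<otimes> (t f \<otimes> adj A (t f)) = \<zero>"
      using range_projection_orthogonal[of "head E e" e f] e f h False by simp
    then have "\<zero> = adj A (t e) \<otimes> ((t e \<otimes> adj A (t e)) \<otimes> (t f \<otimes> adj A (t f))) \<otimes> t f"
      using e f by (simp add: adj_closed)
    also have "\<dots> = adj A (t e \<otimes> adj A (t e) \<otimes> t e) \<otimes> (t f \<otimes> adj A (t f) \<otimes> t f)"
      using t_closed[OF e] t_closed[OF f] by algebra
    also have "\<dots> = adj A (t e) \<otimes> t f" by (simp only: t_adj_t e f)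
    finally show ?thesis ..
  qed
  show ?thesis
  proof (cases "head E f = head E e")
    case True
    then show ?thesis using same_head False by simp
  next
    case heads: False
    then have "adj A (t e) \<otimes> q (head E f) = \<zero>" using adj_t_q[of "head E f" e] e f by simp
    then show ?thesis using eq False f by (simp only: if_False mult_zero_left t_closed)
  qed
qed

section \<open>Gap projections\<close>

definition gap :: "'v \<Rightarrow> 'a" where
  "gap v = q v \<ominus> (\<Oplus>e\<in>in_arcs E v. t e \<otimes> adj A (t e))"

lemma finite_in_arcs' [simp]: "finite (in_arcs E v)"
  by (simp add: in_arcs_def)

lemma range_sum_closed: "(\<Oplus>e\<in>in_arcs E v. t e \<otimes> adj A (t e)) \<in> carrier A"
  by (rule finsum_closed') (auto simp: in_arcs_def mult_closed adj_closed)

lemma gap_closed [simp]: "v \<in> verts E \<Longrightarrow> gap v \<in> carrier A"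
  by (simp add: gap_def range_sum_closed)

text \<open>The subtracted projections act through some \<open>adj A (t e)\<close> and so kill
  \<open>x\<close>. Together with \<open>adj_t_image_gap\<close> this will place the image of a gap
  projection below a gap projection.\<close>

lemma gap_absorb:
  assumes v: "v \<in> verts E" and x: "x \<in> carrier A" "\<And>e. e \<in> arcs E \<Longrightarrow> adj A (t e) \<otimes> x = \<zero>"
  shows "gap v \<otimes> x = q v \<otimes> x"
proof -
  have "(\<Oplus>e\<in>in_arcs E v. t e \<otimes> adj A (t e)) \<otimes> x = (\<Oplus>e\<in>in_arcs E v. (t e \<otimes> adj A (t e)) \<otimes> x)"
    using x by (intro finsum_mult_right) (auto simp: in_arcs_def mult_closed adj_closed)
  also have "\<dots> = \<zero>" using x by (intro finsum_zero') (auto simp: in_arcs_def mult_assoc adj_closed)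
  finally show ?thesis using v x range_sum_closed[of v]
    by (simp add: gap_def minus_eq mult_l_distr mult_minus_left minus_zero mult_closed)
qed

lemma adj_t_gap:
  assumes e: "e \<in> arcs E" and v: "v \<in> verts E" shows "adj A (t e) \<otimes> gap v = \<zero>"
proof -
  have s: "adj A (t e) \<otimes> (\<Oplus>f\<in>in_arcs E v. t f \<otimes> adj A (t f)) = (\<Oplus>f\<in>in_arcs E v. adj A (t e) \<otimes> (t f \<otimes> adj A (t f)))"
    using e by (intro finsum_mult_right) (auto simp: in_arcs_def mult_closed adj_closed)
  have z: "adj A (t e) \<otimes> (t f \<otimes> adj A (t f)) = \<zero>" if "f \<in> in_arcs E v" "f \<noteq> e" for f
    using that e by (simp add: in_arcs_def mult_assoc[symmetric] adj_t_t' adj_closed)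
  have "(\<Oplus>f\<in>in_arcs E v. adj A (t e) \<otimes> (t f \<otimes> adj A (t f))) = adj A (t e) \<otimes> q v"
  proof (cases "head E e = v")
    case True
    have "adj A (t e) \<otimes> (t e \<otimes> adj A (t e)) = adj A (t e)"
      using arg_cong[OF t_adj_t[OF e], of "adj A"] e by (simp add: adj_mult adj_adj mult_closed adj_closed mult_assoc)
    then show ?thesis using finsum_single[of "in_arcs E v" e] z e v True adj_t_q[OF v e] by (simp add: adj_closed)
  next
    case False
    then show ?thesis using adj_t_q[OF v e] z by (auto intro!: finsum_zero' simp: in_arcs_def)
  qed
  then show ?thesis using e v s range_sum_closed[of v]
    by (simp add: gap_def minus_eq mult_r_distr mult_minus_right adj_closed r_neg mult_closed)
qed

lemma q_gap:
  assumes w: "w \<in> verts E" and v: "v \<in> verts E" shows "q w \<otimes> gap v = (if w = v then gap v else \<zero>)"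
proof -
  have s: "q w \<otimes> (\<Oplus>f\<in>in_arcs E v. t f \<otimes> adj A (t f)) = (\<Oplus>f\<in>in_arcs E v. q w \<otimes> (t f \<otimes> adj A (t f)))"
    using w by (intro finsum_mult_right) (auto simp: in_arcs_def mult_closed adj_closed)
  have "(\<Oplus>f\<in>in_arcs E v. q w \<otimes> (t f \<otimes> adj A (t f))) = (if w = v then (\<Oplus>f\<in>in_arcs E v. t f \<otimes> adj A (t f)) else \<zero>)"
    using w by (auto intro!: finsum_zero' finsum_cong' simp: in_arcs_def mult_assoc[symmetric] q_t mult_closed adj_closed)
  then show ?thesis using s w v range_sum_closed[of v]
    by (simp add: gap_def minus_eq mult_r_distr mult_minus_right q_mult minus_zero)
qed

lemma gap_adj: 
  assumes v: "v \<in> verts E" shows "adj A (gap v) = gap v"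
proof -
  have "adj A (\<Oplus>f\<in>in_arcs E v. t f \<otimes> adj A (t f)) = (\<Oplus>f\<in>in_arcs E v. adj A (t f \<otimes> adj A (t f)))"
    using abelian_group_axioms by (intro finsum_additive[of _ _ "adj A" A]) (auto simp: in_arcs_def mult_closed adj_closed adj_add)
  also have "\<dots> = (\<Oplus>f\<in>in_arcs E v. t f \<otimes> adj A (t f))"
    by (intro finsum_cong') (auto simp: in_arcs_def mult_closed adj_closed adj_mult adj_adj)
  finally show ?thesis using v range_sum_closed[of v] by (simp add: gap_def minus_eq adj_add adj_minus q_adj)
qed

lemma gap_idem: "v \<in> verts E \<Longrightarrow> gap v \<otimes> gap v = gap v"
  using gap_absorb[of v "gap v"] adj_t_gap q_gap by simp

lemma gap_t:
  assumes "e \<in> arcs E" "v \<in> verts E" shows "gap v \<otimes> t e = \<zero>"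
  using arg_cong[OF adj_t_gap[OF assms], of "adj A"] assms by (simp add: adj_mult adj_adj gap_adj adj_closed)

lemma gap_q:
  assumes "w \<in> verts E" "v \<in> verts E" shows "gap v \<otimes> q w = (if w = v then gap v else \<zero>)"
  using arg_cong[OF q_gap[OF assms], of "adj A"] assms by (auto simp: adj_mult gap_adj q_adj split: if_splits)

text \<open>A relation in the universal algebra holds in every Toeplitz family, by applying the
  induced homomorphism; the concrete family on a Hilbert space violates this one.\<close>

lemma gap_neq_zero:
  assumes v: "v \<in> verts E" shows "gap v \<noteq> \<zero>"
proof
  assume "gap v = \<zero>"
  then have eq: "q v = (\<Oplus>e\<in>in_arcs E v. t e \<otimes> adj A (t e))"
    unfolding gap_def by (rule minus_eq_zeroD[OF q_closed[OF v] range_sum_closed])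
  obtain B :: "((nat \<times> nat list) ell2 \<Rightarrow>\<^sub>L (nat \<times> nat list) ell2) cstar" and Q T
    and g :: "((nat \<times> nat list) ell2 \<Rightarrow>\<^sub>L (nat \<times> nat list) ell2) \<Rightarrow> nat \<Rightarrow> nat \<Rightarrow> complex"
    where B: "cstar_algebra B" "toeplitz_family E B Q T" "inj_on g (carrier B)"
    and ne: "\<And>v. v \<in> verts E \<Longrightarrow> (\<Oplus>\<^bsub>B\<^esub>e\<in>in_arcs E v. T e \<otimes>\<^bsub>B\<^esub> adj B (T e)) \<noteq> Q v"
    by (rule exists_toeplitz_family_with_gaps[OF fin_digraph], rule that)
  obtain f where f: "star_hom A B f" "\<And>v. v \<in> verts E \<Longrightarrow> f (q v) = Q v" "\<And>e. e \<in> arcs E \<Longrightarrow> f (t e) = T e"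
    by (rule toeplitz_algebra_universal[OF toeplitz_algebra G.finite_arcs B], rule that)
  interpret B: cstar_algebra B by (rule B(1))
  interpret f: star_homomorphism A B f by unfold_locales (rule f(1))
  have Tc: "T e \<in> carrier B" if "e \<in> arcs E" for e using f(3)[OF that] f.closed t_closed that by metis
  have "Q v = f (\<Oplus>e\<in>in_arcs E v. t e \<otimes> adj A (t e))" using f(2)[OF v] eq by simp
  also have "\<dots> = (\<Oplus>\<^bsub>B\<^esub>e\<in>in_arcs E v. f (t e \<otimes> adj A (t e)))"
    by (intro f.finsum) (auto simp: in_arcs_def mult_closed adj_closed)
  also have "\<dots> = (\<Oplus>\<^bsub>B\<^esub>e\<in>in_arcs E v. T e \<otimes>\<^bsub>B\<^esub> adj B (T e))"
    by (intro B.finsum_cong') (auto simp: in_arcs_def f.mult f.adj f(3) Tc adj_closed B.mult_closed B.adj_closed)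
  finally show False using ne[OF v] by simp
qed

lemma q_neq_zero: "v \<in> verts E \<Longrightarrow> q v \<noteq> \<zero>"
  using gap_neq_zero[of v] q_gap[of v v] by auto

text \<open>The induction runs over the elements for which \<open>P\<close> holds at the element and
  at its adjoint. So \<open>P\<close> may fail to be stable under adjoints; the price is the
  separate case for \<open>adj A (t e)\<close>.\<close>

lemma generated_induct [consumes 1, case_names q t t_adj zero add mult smult lim]:
  assumes x: "x \<in> carrier A"
    and q: "\<And>v. v \<in> verts E \<Longrightarrow> P (q v)" and t: "\<And>e. e \<in> arcs E \<Longrightarrow> P (t e)" "\<And>e. e \<in> arcs E \<Longrightarrow> P (adj A (t e))"
    and zero: "P \<zero>"
    and add: "\<And>x y. x \<in> carrier A \<Longrightarrow> y \<in> carrier A \<Longrightarrow> P x \<Longrightarrow> P y \<Longrightarrow> P (x \<oplus> y)"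
    and mult: "\<And>x y. x \<in> carrier A \<Longrightarrow> y \<in> carrier A \<Longrightarrow> P x \<Longrightarrow> P y \<Longrightarrow> P (x \<otimes> y)"
    and smult: "\<And>c x. x \<in> carrier A \<Longrightarrow> P x \<Longrightarrow> P (c \<odot> x)"
    and lim: "\<And>X x. clim X x \<Longrightarrow> (\<And>n. P (X n)) \<Longrightarrow> P x"
  shows "P x"
proof -
  let ?S = "{x \<in> carrier A. P x \<and> P (adj A x)}"
  have "cstar_subalgebra A ?S"
    unfolding cstar_subalgebra_def
  proof (intro conjI ballI allI impI)
    fix X x assume X: "\<forall>n. X n \<in> ?S" and x: "x \<in> carrier A" "(\<lambda>n. nrm A (X n \<ominus> x)) \<longlonglongrightarrow> 0"
    then have c: "clim X x" by (simp add: clim_def)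
    show "x \<in> ?S" using x(1) lim[OF c] lim[OF clim_adj[OF c]] X by auto
  qed (auto simp: zero add mult smult mult_closed adj_closed smult_closed adj_add adj_mult adj_smult adj_adj)
  moreover have "q ` verts E \<union> t ` arcs E \<subseteq> ?S" by (auto simp: q t q_adj)
  ultimately have "?S = carrier A" using generated unfolding cstar_generated_by_def by blast
  then show ?thesis using x by blast
qed

text \<open>Every generator and its adjoint absorb a vertex projection on the left, so
  \<open>x a = 0\<close> for all \<open>a\<close>, in particular for the adjoint of
  \<open>x\<close>. In effect the sum of the vertex projections is a unit.\<close>

lemma eq_zero_if_mult_q_eq_zero:
  assumes x: "x \<in> carrier A" "\<And>v. v \<in> verts E \<Longrightarrow> x \<otimes> q v = \<zero>"
  shows "x = \<zero>"
proof -
  have "x \<otimes> a = \<zero>" if "a \<in> carrier A" for a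
    using that
  proof (rule generated_induct)
    fix e assume e: "e \<in> arcs E"
    have "x \<otimes> t e = x \<otimes> q (head E e) \<otimes> t e" using x(1) e t_head by (simp add: mult_assoc)
    then show "x \<otimes> t e = \<zero>" using x e by simp
    have "adj A (t e) = q (tail E e) \<otimes> adj A (t e)"
      using arg_cong[OF t_tail[OF e], of "adj A"] e by (simp add: adj_mult q_adj)
    then have "x \<otimes> adj A (t e) = x \<otimes> q (tail E e) \<otimes> adj A (t e)" using x(1) e by (simp add: mult_assoc adj_closed)
    then show "x \<otimes> adj A (t e) = \<zero>" using x e by (simp add: adj_closed)
  next
    fix X a assume X: "clim X a" "\<And>n. x \<otimes> X n = \<zero>"
    then have "clim (\<lambda>n. \<zero>) (x \<otimes> a)" using clim_mult[OF clim_const[OF x(1)] X(1)] by simp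
    then show "x \<otimes> a = \<zero>" using clim_const[OF zero_closed] clim_unique by blast
  qed (use x in \<open>auto simp: mult_r_distr mult_assoc[symmetric] smult_mult_right\<close>)
  then have "adj A (adj A x) \<otimes> adj A x = \<zero>" using x by (simp add: adj_adj adj_closed)
  then have "adj A x = \<zero>" using adj_mult_eq_zero adj_closed x(1) by blast
  then show ?thesis using adj_adj[OF x(1)] by simp
qed

text \<open>A path \<open>e\<^sub>1 \<dots> e\<^sub>n\<close> is read as in the paper, from right to left: it leaves its source \<open>v\<close> through
  \<open>e\<^sub>n\<close>. The elements \<open>path_elem v \<mu>\<close>, which are \<open>t\<^sub>\<mu> gap\<^sub>v\<close>, form an orthonormal basis of the
  left ideal generated by \<open>gap\<^sub>v\<close>.\<close>

primrec rng :: "'v \<Rightarrow> 'e list \<Rightarrow> 'v" where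
  "rng v [] = v" | "rng v (e # \<mu>) = head E e"

primrec is_path :: "'v \<Rightarrow> 'e list \<Rightarrow> bool" where
  "is_path v [] \<longleftrightarrow> v \<in> verts E"
| "is_path v (e # \<mu>) \<longleftrightarrow> e \<in> arcs E \<and> tail E e = rng v \<mu> \<and> is_path v \<mu>"

primrec path_elem :: "'v \<Rightarrow> 'e list \<Rightarrow> 'a" where
  "path_elem v [] = gap v" | "path_elem v (e # \<mu>) = t e \<otimes> path_elem v \<mu>"

lemma path_verts: "is_path v \<mu> \<Longrightarrow> v \<in> verts E"
  by (induction \<mu>) auto

lemma rng_verts: "is_path v \<mu> \<Longrightarrow> rng v \<mu> \<in> verts E"
  by (cases \<mu>) auto

lemma path_elem_closed [simp]: "is_path v \<mu> \<Longrightarrow> path_elem v \<mu> \<in> carrier A"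
  by (induction \<mu>) (auto simp: mult_closed)

lemma q_path_elem:
  "is_path v \<mu> \<Longrightarrow> w \<in> verts E \<Longrightarrow> q w \<otimes> path_elem v \<mu> = (if w = rng v \<mu> then path_elem v \<mu> else \<zero>)"
  by (cases \<mu>) (auto simp: q_gap q_t mult_assoc[symmetric])

lemma t_path_elem:
  assumes "is_path v \<mu>" "e \<in> arcs E"
  shows "t e \<otimes> path_elem v \<mu> = (if is_path v (e # \<mu>) then path_elem v (e # \<mu>) else \<zero>)"
proof -
  have "t e \<otimes> (q (tail E e) \<otimes> path_elem v \<mu>) = t e \<otimes> path_elem v \<mu>"
    using assms t_tail by (simp add: mult_assoc[symmetric])
  moreover have "t e \<otimes> (q (tail E e) \<otimes> path_elem v \<mu>) = (if is_path v (e # \<mu>) then path_elem v (e # \<mu>) else \<zero>)"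
    using assms by (auto simp: q_path_elem)
  ultimately show ?thesis by simp
qed

lemma adj_t_path_elem:
  assumes "is_path v \<mu>" "e \<in> arcs E"
  shows "adj A (t e) \<otimes> path_elem v \<mu> = (if \<exists>\<nu>. \<mu> = e # \<nu> then path_elem v (tl \<mu>) else \<zero>)"
proof (cases \<mu>)
  case Nil then show ?thesis using assms adj_t_gap by simp
next
  case (Cons f \<nu>)
  have "adj A (t e) \<otimes> path_elem v \<mu> = (adj A (t e) \<otimes> t f) \<otimes> path_elem v \<nu>"
    using assms Cons by (simp add: mult_assoc adj_closed)
  then show ?thesis using assms Cons by (auto simp: adj_t_t' q_path_elem)
qed

text \<open>Equal leading edges cancel to a vertex projection, distinct ones have orthogonal ranges.
  If one path ends before the other, a gap projection meets a generator or its adjoint and the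
  product is zero.\<close>

lemma path_elem_orthonormal:
  "is_path v \<mu> \<Longrightarrow> is_path v \<nu> \<Longrightarrow> adj A (path_elem v \<mu>) \<otimes> path_elem v \<nu> = (if \<mu> = \<nu> then gap v else \<zero>)"
proof (induction \<mu> arbitrary: \<nu>)
  case Nil
  then show ?case
    by (cases \<nu>) (auto simp: gap_adj gap_idem gap_t mult_assoc[symmetric])
next
  case (Cons e \<mu>)
  have "adj A (path_elem v (e # \<mu>)) \<otimes> path_elem v \<nu> = adj A (path_elem v \<mu>) \<otimes> (adj A (t e) \<otimes> path_elem v \<nu>)"
    using Cons.prems by (simp add: adj_mult mult_assoc adj_closed)
  also have "\<dots> = (if e # \<mu> = \<nu> then gap v else \<zero>)"
  proof (cases "\<exists>\<nu>'. \<nu> = e # \<nu>'")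
    case True
    then obtain \<nu>' where \<nu>: "\<nu> = e # \<nu>'" by blast
    then show ?thesis
      using Cons.IH[of \<nu>'] Cons.prems adj_t_path_elem[OF Cons.prems(2), of e] by (simp del: path_elem.simps)
  next
    case False
    then show ?thesis using Cons.prems adj_t_path_elem[OF Cons.prems(2), of e] by (auto simp: adj_closed)
  qed
  finally show ?case .
qed

lemma path_elem_gap: "is_path v \<mu> \<Longrightarrow> path_elem v \<mu> \<otimes> gap v = path_elem v \<mu>"
  by (induction \<mu>) (auto simp: gap_idem mult_assoc path_verts)

text \<open>The set \<open>M\<close> of elements whose coefficients at all paths are scalar
  multiples of \<open>gap v\<close> contains \<open>gap v\<close>. Moving a generator to the path
  element by taking adjoints turns that element into another path element or zero, so
  \<open>M\<close> is stable under left multiplication by generators and their adjoints. The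
  induction keeps \<open>y\<close> arbitrary, which makes products two applications of the
  hypothesis; limits use \<open>clim_line\<close>.\<close>

lemma path_coefficient_exists:
  assumes x: "x \<in> carrier A" and \<mu>: "is_path v \<mu>"
  shows "\<exists>c. adj A (path_elem v \<mu>) \<otimes> (x \<otimes> gap v) = c \<odot> gap v"
proof -
  have v: "v \<in> verts E" using \<mu> path_verts by blast
  define M where "M = {y \<in> carrier A. \<forall>\<mu>. is_path v \<mu> \<longrightarrow> (\<exists>c. adj A (path_elem v \<mu>) \<otimes> y = c \<odot> gap v)}"
  have Mc: "M \<subseteq> carrier A" by (auto simp: M_def)
  have MI: "y \<in> M" if "y \<in> carrier A" "\<And>\<mu>. is_path v \<mu> \<Longrightarrow> \<exists>c. adj A (path_elem v \<mu>) \<otimes> y = c \<odot> gap v" for y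
    using that by (auto simp: M_def)
  have MD: "\<exists>c. adj A (path_elem v \<mu>) \<otimes> y = c \<odot> gap v" if "y \<in> M" "is_path v \<mu>" for y \<mu>
    using that by (auto simp: M_def)
  have 0: "\<exists>c. \<zero> = c \<odot> gap v" using v by (intro exI[of _ 0]) simp
  have "x \<otimes> y \<in> M" if "y \<in> M" for y
    using x that
  proof (induction arbitrary: y rule: generated_induct)
    case (q w)
    have "adj A (path_elem v \<mu>) \<otimes> (q w \<otimes> y) = adj A (q w \<otimes> path_elem v \<mu>) \<otimes> y" if "is_path v \<mu>" for \<mu>
      using that q.hyps q.prems Mc by (auto simp: adj_mult q_adj mult_assoc adj_closed)
    moreover have "y \<in> carrier A" using q.prems Mc by blast
    ultimately show ?case using q.hyps q.prems MD by (intro MI) (auto intro: 0 simp: q_path_elem mult_closed)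
  next
    case (t e)
    have "adj A (path_elem v \<mu>) \<otimes> (t e \<otimes> y) = adj A (adj A (t e) \<otimes> path_elem v \<mu>) \<otimes> y" if "is_path v \<mu>" for \<mu>
      using that t.hyps t.prems Mc by (auto simp: adj_mult adj_adj mult_assoc adj_closed)
    moreover have "y \<in> carrier A" using t.prems Mc by blast
    ultimately show ?case using t.hyps t.prems MD by (intro MI) (auto intro: 0 simp: adj_t_path_elem mult_closed)
  next
    case (t_adj e)
    have "adj A (path_elem v \<mu>) \<otimes> (adj A (t e) \<otimes> y) = adj A (t e \<otimes> path_elem v \<mu>) \<otimes> y" if "is_path v \<mu>" for \<mu>
      using that t_adj.hyps t_adj.prems Mc by (auto simp: adj_mult adj_adj mult_assoc adj_closed)
    moreover have "y \<in> carrier A" using t_adj.prems Mc by blast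
    ultimately show ?case using t_adj.hyps t_adj.prems MD by (intro MI) (auto intro: 0 simp: t_path_elem mult_closed adj_closed simp del: path_elem.simps is_path.simps)
  next
    case zero
    then show ?case using zero.prems Mc 0 by (intro MI) (auto simp: adj_closed subset_iff)
  next
    case (add a b)
    show ?case
    proof (rule MI)
      fix \<mu> assume \<mu>: "is_path v \<mu>"
      obtain c d where "adj A (path_elem v \<mu>) \<otimes> (a \<otimes> y) = c \<odot> gap v" "adj A (path_elem v \<mu>) \<otimes> (b \<otimes> y) = d \<odot> gap v"
        using MD[OF add.IH(1)[OF add.prems] \<mu>] MD[OF add.IH(2)[OF add.prems] \<mu>] by blast
      then show "\<exists>c. adj A (path_elem v \<mu>) \<otimes> ((a \<oplus> b) \<otimes> y) = c \<odot> gap v"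
        using add.hyps add.prems Mc \<mu> v by (intro exI[of _ "c + d"]) (auto simp: mult_l_distr mult_r_distr mult_closed adj_closed smult_l_distr)
    qed (use add.hyps add.prems Mc in \<open>auto simp: mult_closed\<close>)
  next
    case (mult a b)
    have "a \<otimes> (b \<otimes> y) \<in> M" using mult.IH(1)[OF mult.IH(2)[OF mult.prems]] .
    then show ?case using mult.hyps mult.prems Mc by (auto simp: mult_assoc subset_iff)
  next
    case (smult c a)
    show ?case
    proof (rule MI)
      fix \<mu> assume \<mu>: "is_path v \<mu>"
      obtain d where "adj A (path_elem v \<mu>) \<otimes> (a \<otimes> y) = d \<odot> gap v" using MD[OF smult.IH[OF smult.prems] \<mu>] by blast
      then show "\<exists>d. adj A (path_elem v \<mu>) \<otimes> ((c \<odot> a) \<otimes> y) = d \<odot> gap v"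
        using smult.hyps smult.prems Mc \<mu> v by (intro exI[of _ "c * d"]) (auto simp: smult_mult_left smult_mult_right mult_closed adj_closed smult_assoc)
    qed (use smult.hyps smult.prems Mc in \<open>auto simp: mult_closed smult_closed\<close>)
  next
    case (lim X a)
    have y: "y \<in> carrier A" using lim.prems Mc by blast
    show ?case
    proof (rule MI)
      fix \<mu> assume \<mu>: "is_path v \<mu>"
      have "\<exists>c. adj A (path_elem v \<mu>) \<otimes> (X n \<otimes> y) = c \<odot> gap v" for n using MD[OF lim.IH[OF lim.prems] \<mu>] .
      then obtain c where c: "\<And>n. adj A (path_elem v \<mu>) \<otimes> (X n \<otimes> y) = c n \<odot> gap v" by metis
      have "clim (\<lambda>n. adj A (path_elem v \<mu>) \<otimes> (X n \<otimes> y)) (adj A (path_elem v \<mu>) \<otimes> (a \<otimes> y))"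
        by (intro clim_mult clim_const lim.hyps) (use \<mu> y in \<open>auto simp: adj_closed\<close>)
      then show "\<exists>c. adj A (path_elem v \<mu>) \<otimes> (a \<otimes> y) = c \<odot> gap v"
        unfolding c by (rule clim_line[OF gap_closed[OF v]])
    qed (use y climD(2)[OF lim.hyps] in \<open>auto simp: mult_closed\<close>)
  qed
  moreover have "gap v \<in> M"
  proof (rule MI)
    fix \<mu> assume "is_path v \<mu>"
    then have "adj A (path_elem v \<mu>) \<otimes> gap v = (if \<mu> = [] then gap v else \<zero>)"
      using path_elem_orthonormal[of v \<mu> "[]"] v by simp
    then show "\<exists>c. adj A (path_elem v \<mu>) \<otimes> gap v = c \<odot> gap v"
      using 0 v smult_one[OF gap_closed[OF v]] by (cases "\<mu> = []") metis+
  qed (use v in simp)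
  ultimately show ?thesis using MD \<mu> by blast
qed

text \<open>The set \<open>Z\<close> of elements that kill all path elements from \<open>v\<close>
  is stable under right multiplication by the algebra, because generators map path elements to path
  elements or zero. The assumption on the coefficients puts the adjoint of \<open>x\<close> into
  \<open>Z\<close>, hence also \<open>x\<^sup>* x\<close>. At the empty path this says
  \<open>x\<^sup>* x gap\<^sub>v = 0\<close>, and the left side is
  \<open>x\<^sup>* x\<close>.\<close>

lemma eq_zero_if_path_coefficients_eq_zero:
  assumes v: "v \<in> verts E" and x: "x \<in> carrier A" "x \<otimes> gap v = x"
    and coeff: "\<And>\<mu>. is_path v \<mu> \<Longrightarrow> adj A (path_elem v \<mu>) \<otimes> x = \<zero>"
  shows "x = \<zero>"
proof -
  define Z where "Z = {z \<in> carrier A. \<forall>\<mu>. is_path v \<mu> \<longrightarrow> z \<otimes> path_elem v \<mu> = \<zero>}"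
  have Zc: "Z \<subseteq> carrier A" by (auto simp: Z_def)
  have ZI: "z \<in> Z" if "z \<in> carrier A" "\<And>\<mu>. is_path v \<mu> \<Longrightarrow> z \<otimes> path_elem v \<mu> = \<zero>" for z
    using that by (auto simp: Z_def)
  have ZD: "z \<otimes> path_elem v \<mu> = \<zero>" if "z \<in> Z" "is_path v \<mu>" for z \<mu>
    using that by (auto simp: Z_def)
  have step: "z \<otimes> a \<in> Z" if "a \<in> carrier A" "z \<in> Z" for a z
    using that
  proof (induction arbitrary: z rule: generated_induct)
    case (q w)
    then show ?case using Zc ZD by (intro ZI) (auto simp: mult_assoc q_path_elem mult_closed subset_iff)
  next
    case (t e)
    then show ?case using Zc ZD
      by (intro ZI) (auto simp: mult_assoc t_path_elem mult_closed subset_iff simp del: path_elem.simps is_path.simps)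
  next
    case (t_adj e)
    then show ?case using Zc ZD
      by (intro ZI) (auto simp: mult_assoc adj_t_path_elem mult_closed adj_closed subset_iff)
  next
    case zero
    then show ?case using Zc by (intro ZI) (auto simp: subset_iff)
  next
    case (add a b)
    have "z \<otimes> a \<in> Z" "z \<otimes> b \<in> Z" using add.IH add.prems by auto
    then show ?case using add.hyps add.prems Zc ZD by (intro ZI) (auto simp: mult_r_distr mult_l_distr mult_closed subset_iff)
  next
    case (mult a b)
    have "(z \<otimes> a) \<otimes> b \<in> Z" using mult.IH mult.prems by auto
    then show ?case using mult.hyps mult.prems Zc by (auto simp: mult_assoc subset_iff)
  next
    case (smult c a)
    have "z \<otimes> a \<in> Z" using smult.IH smult.prems by auto
    then show ?case using smult.hyps smult.prems Zc ZD
      by (intro ZI) (auto simp: smult_mult_left smult_mult_right mult_closed smult_closed subset_iff)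
  next
    case (lim X a)
    have z: "z \<in> carrier A" using lim.prems Zc by blast
    show ?case
    proof (rule ZI)
      fix \<mu> assume \<mu>: "is_path v \<mu>"
      have c: "clim (\<lambda>n. (z \<otimes> X n) \<otimes> path_elem v \<mu>) ((z \<otimes> a) \<otimes> path_elem v \<mu>)"
        by (intro clim_mult clim_const lim.hyps) (use \<mu> z in auto)
      have "(z \<otimes> X n) \<otimes> path_elem v \<mu> = \<zero>" for n using ZD[OF lim.IH[OF lim.prems] \<mu>] .
      then have "clim (\<lambda>n. \<zero>) ((z \<otimes> a) \<otimes> path_elem v \<mu>)" using c by simp
      then show "(z \<otimes> a) \<otimes> path_elem v \<mu> = \<zero>" using clim_const[OF zero_closed] clim_unique by blast
    qed (use z climD(2)[OF lim.hyps] in \<open>auto simp: mult_closed\<close>)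
  qed
  have "adj A x \<in> Z"
  proof (rule ZI)
    fix \<mu> assume \<mu>: "is_path v \<mu>"
    have "adj A x \<otimes> path_elem v \<mu> = adj A (adj A (path_elem v \<mu>) \<otimes> x)"
      using x \<mu> by (simp add: adj_mult adj_adj adj_closed)
    then show "adj A x \<otimes> path_elem v \<mu> = \<zero>" using coeff[OF \<mu>] by simp
  qed (use x in \<open>simp add: adj_closed\<close>)
  then have "(adj A x \<otimes> x) \<otimes> path_elem v [] = \<zero>" using ZD[OF step[OF x(1)], of "adj A x" "[]"] v by simp
  then have "adj A x \<otimes> x = \<zero>" using x v by (simp add: mult_assoc adj_closed)
  then show ?thesis using adj_mult_eq_zero x(1) by blast
qed

text \<open>Both sides have the same coefficients at every path, so their difference vanishes. With
  coefficients supported on a finite set the sum is algebraic and involves no limit.\<close>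

lemma expansion:
  assumes v: "v \<in> verts E" and x: "x \<in> carrier A" "x \<otimes> gap v = x"
    and J: "finite J" "\<And>\<mu>. \<mu> \<in> J \<Longrightarrow> is_path v \<mu>"
    and off: "\<And>\<mu>. is_path v \<mu> \<Longrightarrow> \<mu> \<notin> J \<Longrightarrow> adj A (path_elem v \<mu>) \<otimes> x = \<zero>"
    and a: "\<And>\<mu>. \<mu> \<in> J \<Longrightarrow> adj A (path_elem v \<mu>) \<otimes> x = a \<mu> \<odot> gap v"
  shows "x = (\<Oplus>\<mu>\<in>J. a \<mu> \<odot> path_elem v \<mu>)"
proof -
  let ?s = "\<Oplus>\<mu>\<in>J. a \<mu> \<odot> path_elem v \<mu>"
  have sc: "?s \<in> carrier A" using J by (intro finsum_closed') (auto simp: smult_closed)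
  have "?s \<otimes> gap v = (\<Oplus>\<mu>\<in>J. (a \<mu> \<odot> path_elem v \<mu>) \<otimes> gap v)"
    using J v by (intro finsum_mult_right) (auto simp: smult_closed)
  also have "\<dots> = ?s" using J v by (intro finsum_cong') (auto simp: smult_mult_left path_elem_gap smult_closed)
  finally have sg: "?s \<otimes> gap v = ?s" .
  have "adj A (path_elem v \<nu>) \<otimes> (x \<ominus> ?s) = \<zero>" if \<nu>: "is_path v \<nu>" for \<nu>
  proof -
    have o: "adj A (path_elem v \<nu>) \<otimes> (a \<mu> \<odot> path_elem v \<mu>) = (if \<nu> = \<mu> then a \<mu> \<odot> gap v else \<zero>)" if "\<mu> \<in> J" for \<mu>
      using that J \<nu> by (simp add: smult_mult_right adj_closed path_elem_orthonormal)
    have "adj A (path_elem v \<nu>) \<otimes> ?s = (\<Oplus>\<mu>\<in>J. adj A (path_elem v \<nu>) \<otimes> (a \<mu> \<odot> path_elem v \<mu>))"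
      using J \<nu> by (intro finsum_mult_right) (auto simp: smult_closed adj_closed)
    also have "\<dots> = adj A (path_elem v \<nu>) \<otimes> x"
    proof (cases "\<nu> \<in> J")
      case True
      have "(\<Oplus>\<mu>\<in>J. adj A (path_elem v \<nu>) \<otimes> (a \<mu> \<odot> path_elem v \<mu>)) = adj A (path_elem v \<nu>) \<otimes> (a \<nu> \<odot> path_elem v \<nu>)"
        using J True v by (intro finsum_single) (auto simp: o smult_closed)
      then show ?thesis using True o a by simp
    next
      case False
      then show ?thesis using off[OF \<nu> False] by (auto simp: o intro!: finsum_zero')
    qed
    finally show ?thesis using x sc \<nu> by (simp add: minus_eq mult_r_distr mult_minus_right adj_closed r_neg mult_closed)
  qed
  moreover have "(x \<ominus> ?s) \<otimes> gap v = x \<ominus> ?s"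
    using x sc v sg by (simp add: minus_eq mult_l_distr mult_minus_left)
  ultimately have "x \<ominus> ?s = \<zero>" using eq_zero_if_path_coefficients_eq_zero[OF v, of "x \<ominus> ?s"] x sc by auto
  then show ?thesis using minus_eq_zeroD x sc by blast
qed

lemma smult_gap_inj: "v \<in> verts E \<Longrightarrow> c \<odot> gap v = d \<odot> gap v \<Longrightarrow> c = d"
  using smult_cancel gap_neq_zero gap_closed by blast

text \<open>Substituting the expansion for the right factor of \<open>adj A x \<otimes> x\<close>
  yields \<open>gap v\<close> times the sum of the squared moduli, and \<open>gap v\<close> is not
  zero.\<close>

lemma parseval:
  assumes v: "v \<in> verts E" and x: "x \<in> carrier A" "x \<otimes> gap v = x" "adj A x \<otimes> x = gap v"
    and J: "finite J" "\<And>\<mu>. \<mu> \<in> J \<Longrightarrow> is_path v \<mu>"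
    and off: "\<And>\<mu>. is_path v \<mu> \<Longrightarrow> \<mu> \<notin> J \<Longrightarrow> adj A (path_elem v \<mu>) \<otimes> x = \<zero>"
    and a: "\<And>\<mu>. \<mu> \<in> J \<Longrightarrow> adj A (path_elem v \<mu>) \<otimes> x = a \<mu> \<odot> gap v"
  shows "(\<Sum>\<mu>\<in>J. (cmod (a \<mu>))\<^sup>2) = 1"
proof -
  have summand: "adj A x \<otimes> (a \<mu> \<odot> path_elem v \<mu>) = (a \<mu> * cnj (a \<mu>)) \<odot> gap v" if \<mu>: "\<mu> \<in> J" for \<mu>
  proof -
    have "adj A x \<otimes> path_elem v \<mu> = adj A (adj A (path_elem v \<mu>) \<otimes> x)"
      using x J \<mu> by (simp add: adj_mult adj_adj adj_closed)
    also have "\<dots> = cnj (a \<mu>) \<odot> gap v" using a[OF \<mu>] v by (simp add: adj_smult gap_adj)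
    finally show ?thesis using x J \<mu> v by (simp add: smult_mult_right adj_closed smult_assoc)
  qed
  have "gap v = adj A x \<otimes> (\<Oplus>\<mu>\<in>J. a \<mu> \<odot> path_elem v \<mu>)"
    using expansion[OF v x(1,2) J off a] x(3) by simp
  also have "\<dots> = (\<Oplus>\<mu>\<in>J. adj A x \<otimes> (a \<mu> \<odot> path_elem v \<mu>))"
    using J x by (intro finsum_mult_right) (auto simp: smult_closed adj_closed)
  also have "\<dots> = (\<Oplus>\<mu>\<in>J. (a \<mu> * cnj (a \<mu>)) \<odot> gap v)" using v by (intro finsum_cong') (auto simp: summand smult_closed)
  also have "\<dots> = (\<Sum>\<mu>\<in>J. a \<mu> * cnj (a \<mu>)) \<odot> gap v"
    using J(1) v by (induction J rule: finite_induct) (auto simp: smult_closed smult_l_distr)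
  finally have "1 \<odot> gap v = (\<Sum>\<mu>\<in>J. a \<mu> * cnj (a \<mu>)) \<odot> gap v" using v by (simp add: smult_one)
  then have "1 = (\<Sum>\<mu>\<in>J. a \<mu> * cnj (a \<mu>))" by (rule smult_gap_inj[OF v])
  also have "\<dots> = of_real (\<Sum>\<mu>\<in>J. (cmod (a \<mu>))\<^sup>2)" by (simp only: of_real_sum complex_norm_square)
  finally show ?thesis by (metis of_real_eq_1_iff)
qed

section \<open>Scaling automorphisms\<close>

lemma countable_generators: "countable (q ` verts E \<union> t ` arcs E)"
  by (intro countable_finite) auto

lemma universal:
  fixes B :: "'b cstar"
  assumes B: "cstar_algebra B" and fam: "toeplitz_family E B Q T" and gen: "cstar_generated_by B H" "countable H"
  obtains f where "star_hom A B f" "\<And>v. v \<in> verts E \<Longrightarrow> f (q v) = Q v" "\<And>e. e \<in> arcs E \<Longrightarrow> f (t e) = T e"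
proof -
  obtain g :: "'b \<Rightarrow> nat \<Rightarrow> nat \<Rightarrow> complex" where "inj_on g (carrier B)"
    using cstar_algebra.inj_on_matrices_if_countably_generated[OF B gen] by blast
  then show ?thesis
    by (rule toeplitz_algebra_universal[OF toeplitz_algebra G.finite_arcs B fam]) (rule that)
qed

lemma hom_eqI:
  assumes "cstar_algebra B" "star_hom A B f" "star_hom A B g"
    and "\<And>v. v \<in> verts E \<Longrightarrow> f (q v) = g (q v)" "\<And>e. e \<in> arcs E \<Longrightarrow> f (t e) = g (t e)" "x \<in> carrier A"
  shows "f x = g x"
  by (rule star_hom_eqI[OF generated, of B f g]) (use assms in auto)

lemma scaled_range:
  assumes "cmod c = 1" "e \<in> arcs E"
  shows "(c \<odot> t e) \<otimes> adj A (c \<odot> t e) = t e \<otimes> adj A (t e)"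
    and "adj A (c \<odot> t e) \<otimes> (c \<odot> t e) = q (tail E e)"
proof -
  have c: "c * cnj c = 1" "cnj c * c = 1" using assms(1) complex_norm_square[of c] by (simp_all add: mult.commute)
  show "(c \<odot> t e) \<otimes> adj A (c \<odot> t e) = t e \<otimes> adj A (t e)" "adj A (c \<odot> t e) \<otimes> (c \<odot> t e) = q (tail E e)"
    using assms c by (simp_all add: adj_smult smult_mult_left smult_mult_right smult_closed mult_closed adj_closed
      smult_assoc[symmetric] smult_one adj_t_t)
qed

lemma scaled_family:
  assumes c: "\<And>e. e \<in> arcs E \<Longrightarrow> cmod (c e) = 1"
  shows "toeplitz_family E A q (\<lambda>e. c e \<odot> t e)"
  unfolding toeplitz_family_def
proof (intro conjI ballI impI)
  fix v assume v: "v \<in> verts E"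
  show "projection A (q v)" by (rule toeplitz_familyD(1)[OF family v])
  have "(\<Oplus>e\<in>in_arcs E v. (c e \<odot> t e) \<otimes> adj A (c e \<odot> t e)) = (\<Oplus>e\<in>in_arcs E v. t e \<otimes> adj A (t e))"
    by (intro finsum_cong') (auto simp: in_arcs_def c scaled_range mult_closed adj_closed)
  then show "cstar_le A (\<Oplus>e\<in>in_arcs E v. (c e \<odot> t e) \<otimes> adj A (c e \<odot> t e)) (q v)"
    using toeplitz_familyD(5)[OF family v] by simp
next
  fix v w assume "v \<in> verts E" "w \<in> verts E" "v \<noteq> w"
  then show "q v \<otimes> q w = \<zero>" by (simp add: q_mult)
next
  fix e assume e: "e \<in> arcs E"
  show "adj A (c e \<odot> t e) \<otimes> (c e \<odot> t e) = q (tail E e)" by (rule scaled_range(2)[OF c[OF e] e])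
  show "partial_isometry A (c e \<odot> t e)"
    using e by (simp add: partial_isometry_def scaled_range(1)[OF c[OF e] e] smult_closed smult_mult_right mult_closed adj_closed t_adj_t)
qed

text \<open>The scaled generators form a Toeplitz family, so they induce an endomorphism. The
  endomorphism for the conjugate scalars is its inverse, since both composites fix the generators.
  Agreement on generators and extensionality give uniqueness, so the definite description denotes
  this map.\<close>

lemma
  assumes c: "\<And>e. e \<in> arcs E \<Longrightarrow> cmod (c e) = 1"
  shows scaling_star_iso: "star_iso A A (scaling_automorphism E A q t c)"
    and scaling_q: "v \<in> verts E \<Longrightarrow> scaling_automorphism E A q t c (q v) = q v"
    and scaling_t: "e \<in> arcs E \<Longrightarrow> scaling_automorphism E A q t c (t e) = c e \<odot> t e"
proof -
  let ?P = "\<lambda>\<alpha>. star_iso A A \<alpha> \<and> \<alpha> \<in> extensional (carrier A) \<and>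
    (\<forall>v\<in>verts E. \<alpha> (q v) = q v) \<and> (\<forall>e\<in>arcs E. \<alpha> (t e) = c e \<odot> t e)"
  note A = cstar_algebra_axioms
  have c': "cmod (cnj (c e)) = 1" if "e \<in> arcs E" for e using c[OF that] by simp
  obtain f where f: "star_hom A A f" "\<And>v. v \<in> verts E \<Longrightarrow> f (q v) = q v" "\<And>e. e \<in> arcs E \<Longrightarrow> f (t e) = c e \<odot> t e"
    by (rule universal[OF A scaled_family[OF c] generated countable_generators], assumption, rule that)
  obtain f' where f': "star_hom A A f'" "\<And>v. v \<in> verts E \<Longrightarrow> f' (q v) = q v" "\<And>e. e \<in> arcs E \<Longrightarrow> f' (t e) = cnj (c e) \<odot> t e"
    by (rule universal[OF A scaled_family[OF c'] generated countable_generators], assumption, rule that)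
  interpret f: star_homomorphism A A f by unfold_locales (rule f(1))
  interpret f': star_homomorphism A A f' by unfold_locales (rule f'(1))
  have cc: "c e * cnj (c e) = 1" "cnj (c e) * c e = 1" if "e \<in> arcs E" for e
    using c[OF that] complex_norm_square[of "c e"] by (simp_all add: mult.commute)
  have inv1: "f' (f x) = x" if "x \<in> carrier A" for x
    using hom_eqI[OF A star_hom_comp[OF f(1) f'(1)] star_hom_id _ _ that]
    by (simp add: f f' f'.smult smult_assoc[symmetric] cc smult_one)
  have inv2: "f (f' x) = x" if "x \<in> carrier A" for x
    using hom_eqI[OF A star_hom_comp[OF f'(1) f(1)] star_hom_id _ _ that]
    by (simp add: f f' f.smult smult_assoc[symmetric] cc smult_one)
  have "star_hom A A (restrict f (carrier A))"
    using f(1) unfolding star_hom_def by (auto simp: mult_closed smult_closed adj_closed)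
  moreover have "bij_betw (restrict f (carrier A)) (carrier A) (carrier A)"
    by (rule bij_betw_byWitness[where f' = f']) (auto simp: inv1 inv2 f.closed f'.closed)
  ultimately have P: "?P (restrict f (carrier A))" by (auto simp: star_iso_def f)
  have unique: "\<alpha> = restrict f (carrier A)" if "?P \<alpha>" for \<alpha>
  proof (rule extensionalityI)
    fix x assume x: "x \<in> carrier A"
    show "\<alpha> x = restrict f (carrier A) x"
      using hom_eqI[OF A _ _ _ _ x, of \<alpha> "restrict f (carrier A)"] that P by (simp add: star_iso_def del: restrict_apply)
  qed (use that in auto)
  have "?P (scaling_automorphism E A q t c)"
    unfolding scaling_automorphism_def by (rule theI[where P = ?P, OF P unique])
  then show "star_iso A A (scaling_automorphism E A q t c)"
    "v \<in> verts E \<Longrightarrow> scaling_automorphism E A q t c (q v) = q v"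
    "e \<in> arcs E \<Longrightarrow> scaling_automorphism E A q t c (t e) = c e \<odot> t e" by blast+
qed

lemma scaling_star_hom:
  "(\<And>e. e \<in> arcs E \<Longrightarrow> cmod (c e) = 1) \<Longrightarrow> star_homomorphism A A (scaling_automorphism E A q t c)"
  using scaling_star_iso by (unfold_locales) (auto simp: star_iso_def)

section \<open>Weights of paths and homogeneous elements\<close>

definition weight :: "('e \<Rightarrow> complex) \<Rightarrow> 'e list \<Rightarrow> complex" where
  "weight c \<mu> = prod_list (map c \<mu>)"

lemma weight_simps [simp]: "weight c [] = 1" "weight c (e # \<mu>) = c e * weight c \<mu>" "weight (\<lambda>e. z) \<mu> = z ^ length \<mu>"
  by (simp_all add: weight_def map_replicate_const)

lemma cmod_weight:
  assumes "\<And>e. e \<in> arcs E \<Longrightarrow> cmod (c e) = 1" shows "is_path v \<mu> \<Longrightarrow> cmod (weight c \<mu>) = 1"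
  using assms by (induction \<mu>) (auto simp: norm_mult)

lemma scaling_path_elem:
  assumes c: "\<And>e. e \<in> arcs E \<Longrightarrow> cmod (c e) = 1"
  shows "is_path v \<mu> \<Longrightarrow> scaling_automorphism E A q t c (path_elem v \<mu>) = weight c \<mu> \<odot> path_elem v \<mu>"
proof -
  interpret s: star_homomorphism A A "scaling_automorphism E A q t c" using c by (rule scaling_star_hom)
  let ?s = "scaling_automorphism E A q t c"
  have gap: "?s (gap v) = gap v" if v: "v \<in> verts E" for v
  proof -
    have "?s (\<Oplus>e\<in>in_arcs E v. t e \<otimes> adj A (t e)) = (\<Oplus>e\<in>in_arcs E v. ?s (t e \<otimes> adj A (t e)))"
      by (intro s.finsum) (auto simp: in_arcs_def mult_closed adj_closed)
    also have "\<dots> = (\<Oplus>e\<in>in_arcs E v. t e \<otimes> adj A (t e))"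
      by (intro finsum_cong') (auto simp: in_arcs_def s.mult s.adj scaling_t[OF c] scaled_range c mult_closed adj_closed)
    finally show ?thesis using v range_sum_closed by (simp add: gap_def s.minus scaling_q[OF c])
  qed
  show "is_path v \<mu> \<Longrightarrow> ?s (path_elem v \<mu>) = weight c \<mu> \<odot> path_elem v \<mu>"
    by (induction \<mu>) (auto simp: gap smult_one s.mult scaling_t[OF c] smult_mult_left smult_mult_right
        smult_closed mult_closed smult_assoc[symmetric] mult.commute)
qed

text \<open>The coefficient is a multiple of \<open>gap v\<close>, which every scaling automorphism
  fixes. On the other hand the automorphism multiplies it by
  \<open>cnj (weight c \<mu>) * k\<close>, and this differs from 1 because the weight has modulus
  one.\<close>

lemma coefficient_eq_zero_if_weight_neq:
  assumes c: "\<And>e. e \<in> arcs E \<Longrightarrow> cmod (c e) = 1"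
    and x: "x \<in> carrier A" "scaling_automorphism E A q t c x = k \<odot> x"
    and \<mu>: "is_path v \<mu>" "weight c \<mu> \<noteq> k"
  shows "adj A (path_elem v \<mu>) \<otimes> (x \<otimes> gap v) = \<zero>"
proof -
  interpret s: star_homomorphism A A "scaling_automorphism E A q t c" using c by (rule scaling_star_hom)
  let ?s = "scaling_automorphism E A q t c" and ?w = "weight c \<mu>"
  note v = path_verts[OF \<mu>(1)]
  obtain a where a: "adj A (path_elem v \<mu>) \<otimes> (x \<otimes> gap v) = a \<odot> gap v"
    using path_coefficient_exists[OF x(1) \<mu>(1)] by blast
  have g: "?s (gap v) = gap v" using scaling_path_elem[OF c, where v = v and \<mu> = "[]"] v by (simp add: smult_one)
  have "a \<odot> gap v = ?s (adj A (path_elem v \<mu>) \<otimes> (x \<otimes> gap v))"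
    using v by (simp add: a s.smult g)
  also have "\<dots> = adj A (?w \<odot> path_elem v \<mu>) \<otimes> ((k \<odot> x) \<otimes> gap v)"
    using x \<mu>(1) v by (simp add: s.mult s.adj adj_closed mult_closed g scaling_path_elem[OF c])
  also have "\<dots> = (cnj ?w * k) \<odot> (a \<odot> gap v)"
    using x(1) \<mu>(1) v by (simp add: a[symmetric] adj_smult smult_mult_left smult_mult_right smult_closed mult_closed
      adj_closed smult_assoc[symmetric] mult.commute)
  finally have "a \<odot> gap v = (cnj ?w * k * a) \<odot> gap v" using v by (simp add: smult_assoc[symmetric])
  then have "a = cnj ?w * k * a" by (rule smult_gap_inj[OF v])
  moreover have "cnj ?w * k \<noteq> 1"
  proof
    assume "cnj ?w * k = 1"
    then have "?w * cnj ?w * k = ?w" by (simp add: mult.assoc)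
    moreover have "?w * cnj ?w = 1" using cmod_weight[OF c \<mu>(1)] complex_norm_square[of ?w] by simp
    ultimately show False using \<mu>(2) by simp
  qed
  ultimately have "a = 0" by (metis mult_cancel_right1)
  then show ?thesis using a v by simp
qed

end

section \<open>Isomorphisms of Toeplitz algebras\<close>

text \<open>For \<open>m < n\<close> the number \<open>z\<close> is chosen such that
  \<open>z ^ (n - m) = - 1\<close>.\<close>

lemma circle_power_neq:
  assumes "m \<noteq> n" shows "\<exists>z\<in>circle. z ^ m \<noteq> z ^ n"
proof -
  have *: "\<exists>z\<in>circle. z ^ m \<noteq> z ^ n" if "m < n" for m n :: nat
  proof (intro bexI)
    let ?z = "cis (pi / real (n - m))"
    have "?z ^ (n - m) = cis pi" using that by (simp add: DeMoivre)
    moreover have "?z ^ n = ?z ^ m * ?z ^ (n - m)" using that by (simp flip: power_add)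
    ultimately have "?z ^ n = - (?z ^ m)" by simp
    moreover have "w \<noteq> - w" if "w \<noteq> 0" for w :: complex
      using that by (simp add: eq_neg_iff_add_eq_0 flip: mult_2)
    ultimately show "?z ^ m \<noteq> ?z ^ n" by (metis cis_neq_zero power_not_zero)
    show "?z \<in> circle" by (simp add: circle_def)
  qed
  show ?thesis using *[of m n] *[of n m] assms by (metis nat_neq_iff)
qed

locale toeplitz_iso = A: toeplitz A E qE tE + B: toeplitz B F qF tF
  for A :: "'a cstar" and E :: "('v, 'e) pre_digraph" and qE tE
    and B :: "'b cstar" and F :: "('w, 'f) pre_digraph" and qF tF +
  fixes \<rho> :: "'a \<Rightarrow> 'b"
  assumes iso: "star_iso A B \<rho>"
begin

sublocale h: star_homomorphism A B \<rho>
  using iso by unfold_locales (simp add: star_iso_def)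

definition inv\<rho> :: "'b \<Rightarrow> 'a" where "inv\<rho> = inv_into (carrier A) \<rho>"

lemma bij: "bij_betw \<rho> (carrier A) (carrier B)"
  using iso by (simp add: star_iso_def)

lemma inj: "x \<in> carrier A \<Longrightarrow> y \<in> carrier A \<Longrightarrow> \<rho> x = \<rho> y \<Longrightarrow> x = y"
  using bij by (auto simp: bij_betw_def inj_on_def)

lemma eq_zeroD: "x \<in> carrier A \<Longrightarrow> \<rho> x = \<zero>\<^bsub>B\<^esub> \<Longrightarrow> x = \<zero>\<^bsub>A\<^esub>"
  using inj[of x "\<zero>\<^bsub>A\<^esub>"] by (simp add: h.zero)

lemma inv_simps [simp]:
  "x \<in> carrier A \<Longrightarrow> inv\<rho> (\<rho> x) = x" "y \<in> carrier B \<Longrightarrow> \<rho> (inv\<rho> y) = y" "y \<in> carrier B \<Longrightarrow> inv\<rho> y \<in> carrier A"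
  using bij unfolding inv\<rho>_def by (auto simp: bij_betw_def f_inv_into_f inv_into_into)

lemma inv_iso: "toeplitz_iso B F qF tF A E qE tE inv\<rho>"
  using star_iso_inv[OF A.cstar_algebra_axioms iso] unfolding inv\<rho>_def
  by (intro toeplitz_iso.intro toeplitz_iso_axioms.intro A.toeplitz_axioms B.toeplitz_axioms)

text \<open>The coefficients form a matrix with rows in \<open>I\<close> and columns in
  \<open>J\<close>. The assumption \<open>off\<close> keeps the expansions of rows and columns
  inside the block, so by Parseval all rows and columns have length one. Adding the squared moduli
  by rows and by columns counts both index sets.\<close>

lemma card_eq_if_coefficients_block:
  assumes v: "v \<in> verts E" and w: "w \<in> verts F" and g: "\<rho> (A.gap v) = B.gap w"
    and I: "finite I" "\<And>\<mu>. \<mu> \<in> I \<Longrightarrow> A.is_path v \<mu>" and J: "finite J" "\<And>\<nu>. \<nu> \<in> J \<Longrightarrow> B.is_path w \<nu>"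
    and off: "\<And>\<mu> \<nu>. A.is_path v \<mu> \<Longrightarrow> B.is_path w \<nu> \<Longrightarrow> (\<mu> \<in> I) \<noteq> (\<nu> \<in> J) \<Longrightarrow>
      adj B (B.path_elem w \<nu>) \<otimes>\<^bsub>B\<^esub> \<rho> (A.path_elem v \<mu>) = \<zero>\<^bsub>B\<^esub>"
  shows "card I = card J"
proof -
  have xg: "\<rho> (A.path_elem v \<mu>) \<otimes>\<^bsub>B\<^esub> B.gap w = \<rho> (A.path_elem v \<mu>)" if "A.is_path v \<mu>" for \<mu>
    using that v A.path_elem_gap[OF that] by (simp flip: g h.mult)
  have "\<exists>a. adj B (B.path_elem w \<nu>) \<otimes>\<^bsub>B\<^esub> \<rho> (A.path_elem v \<mu>) = a \<odot>\<^bsub>B\<^esub> B.gap w" if "\<mu> \<in> I" "\<nu> \<in> J" for \<mu> \<nu>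
    using B.path_coefficient_exists[OF _ J(2)[OF that(2)], of "\<rho> (A.path_elem v \<mu>)"] xg I(2)[OF that(1)]
    by (simp add: h.closed)
  then obtain a where a: "\<And>\<mu> \<nu>. \<mu> \<in> I \<Longrightarrow> \<nu> \<in> J \<Longrightarrow>
      adj B (B.path_elem w \<nu>) \<otimes>\<^bsub>B\<^esub> \<rho> (A.path_elem v \<mu>) = a \<mu> \<nu> \<odot>\<^bsub>B\<^esub> B.gap w" by metis
  have row: "(\<Sum>\<nu>\<in>J. (cmod (a \<mu> \<nu>))\<^sup>2) = 1" if \<mu>: "\<mu> \<in> I" for \<mu>
  proof (rule B.parseval[OF w])
    have "\<rho> (adj A (A.path_elem v \<mu>) \<otimes>\<^bsub>A\<^esub> A.path_elem v \<mu>) = B.gap w"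
      using A.path_elem_orthonormal[of v \<mu> \<mu>] I(2)[OF \<mu>] g by simp
    then show "adj B (\<rho> (A.path_elem v \<mu>)) \<otimes>\<^bsub>B\<^esub> \<rho> (A.path_elem v \<mu>) = B.gap w"
      using I(2)[OF \<mu>] by (simp add: h.mult h.adj A.adj_closed)
  qed (use xg I(2)[OF \<mu>] J \<mu> off a h.closed in auto)
  \<comment> \<open>The coefficients of the inverse isomorphism are the conjugates with exchanged
    indices, so the columns are covered by Parseval in \<open>A\<close>.\<close>
  have flip: "\<rho> (adj A (A.path_elem v \<mu>) \<otimes>\<^bsub>A\<^esub> inv\<rho> (B.path_elem w \<nu>))
      = adj B (adj B (B.path_elem w \<nu>) \<otimes>\<^bsub>B\<^esub> \<rho> (A.path_elem v \<mu>))" if "A.is_path v \<mu>" "B.is_path w \<nu>" for \<mu> \<nu>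
    using that by (simp add: h.mult h.adj h.closed A.adj_closed B.adj_mult B.adj_adj B.adj_closed)
  have column: "(\<Sum>\<mu>\<in>I. (cmod (cnj (a \<mu> \<nu>)))\<^sup>2) = 1" if \<nu>: "\<nu> \<in> J" for \<nu>
  proof (rule A.parseval[OF v])
    let ?y = "inv\<rho> (B.path_elem w \<nu>)"
    have y: "?y \<in> carrier A" "\<rho> ?y = B.path_elem w \<nu>" using J(2)[OF \<nu>] by auto
    then show "?y \<in> carrier A" by simp
    show "?y \<otimes>\<^bsub>A\<^esub> A.gap v = ?y"
      using y v B.path_elem_gap[OF J(2)[OF \<nu>]] by (intro inj) (auto simp: h.mult g A.mult_closed)
    show "adj A ?y \<otimes>\<^bsub>A\<^esub> ?y = A.gap v"
      using y v B.path_elem_orthonormal[OF J(2)[OF \<nu>] J(2)[OF \<nu>]]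
      by (intro inj) (auto simp: h.mult h.adj g A.mult_closed A.adj_closed)
    fix \<mu> assume \<mu>: "A.is_path v \<mu>"
    show "adj A (A.path_elem v \<mu>) \<otimes>\<^bsub>A\<^esub> ?y = \<zero>\<^bsub>A\<^esub>" if "\<mu> \<notin> I"
      using flip[OF \<mu> J(2)[OF \<nu>]] off[OF \<mu> J(2)[OF \<nu>]] that \<nu> y \<mu>
      by (intro eq_zeroD) (auto simp: A.mult_closed A.adj_closed)
  next
    fix \<mu> assume \<mu>: "\<mu> \<in> I"
    show "adj A (A.path_elem v \<mu>) \<otimes>\<^bsub>A\<^esub> inv\<rho> (B.path_elem w \<nu>) = cnj (a \<mu> \<nu>) \<odot>\<^bsub>A\<^esub> A.gap v"
      using flip[OF I(2)[OF \<mu>] J(2)[OF \<nu>]] a[OF \<mu> \<nu>] I(2)[OF \<mu>] J(2)[OF \<nu>] v w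
      by (intro inj) (auto simp: A.mult_closed A.adj_closed A.smult_closed h.smult g B.adj_smult B.gap_adj)
  qed (use I in auto)
  have "real (card I) = (\<Sum>\<mu>\<in>I. \<Sum>\<nu>\<in>J. (cmod (a \<mu> \<nu>))\<^sup>2)" by (simp add: row)
  also have "\<dots> = (\<Sum>\<nu>\<in>J. \<Sum>\<mu>\<in>I. (cmod (a \<mu> \<nu>))\<^sup>2)" by (rule sum.swap)
  also have "\<dots> = real (card J)" using column by simp
  finally show ?thesis by simp
qed

text \<open>Stated for arbitrary scalars \<open>c\<close> and \<open>d\<close> of modulus one, so
  that it serves the gauge action and the generalised one alike: the image of a path element is
  homogeneous of the weight of the path.\<close>

lemma coefficient_eq_zero_if_weights_neq:
  assumes c: "\<And>e. e \<in> arcs E \<Longrightarrow> cmod (c e) = 1" and d: "\<And>f. f \<in> arcs F \<Longrightarrow> cmod (d f) = 1"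
    and intertwine: "\<And>x. x \<in> carrier A \<Longrightarrow>
      \<rho> (scaling_automorphism E A qE tE c x) = scaling_automorphism F B qF tF d (\<rho> x)"
    and \<mu>: "A.is_path v \<mu>" and \<nu>: "B.is_path w \<nu>" and neq: "B.weight d \<nu> \<noteq> A.weight c \<mu>"
  shows "adj B (B.path_elem w \<nu>) \<otimes>\<^bsub>B\<^esub> (\<rho> (A.path_elem v \<mu>) \<otimes>\<^bsub>B\<^esub> B.gap w) = \<zero>\<^bsub>B\<^esub>"
proof (rule B.coefficient_eq_zero_if_weight_neq[OF d _ _ \<nu> neq])
  show "scaling_automorphism F B qF tF d (\<rho> (A.path_elem v \<mu>)) = A.weight c \<mu> \<odot>\<^bsub>B\<^esub> \<rho> (A.path_elem v \<mu>)"
    using \<mu> intertwine[of "A.path_elem v \<mu>"] by (simp add: A.scaling_path_elem[OF c] h.smult)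
qed (use \<mu> h.closed in auto)

lemma gauge_inv:
  assumes "intertwines_gauge E A qE tE F B qF tF \<rho>" shows "intertwines_gauge F B qF tF E A qE tE inv\<rho>"
  unfolding intertwines_gauge_def
proof (intro ballI)
  fix z y assume z: "z \<in> circle" and y: "y \<in> carrier B"
  interpret sA: star_homomorphism A A "gauge_action E A qE tE z"
    unfolding gauge_action_def using z by (intro A.scaling_star_hom) (simp add: circle_def)
  have "\<rho> (gauge_action E A qE tE z (inv\<rho> y)) = gauge_action F B qF tF z y"
    using assms z y by (simp add: intertwines_gauge_def)
  then have "inv\<rho> (\<rho> (gauge_action E A qE tE z (inv\<rho> y))) = inv\<rho> (gauge_action F B qF tF z y)" by simp
  then show "inv\<rho> (gauge_action F B qF tF z y) = gauge_action E A qE tE z (inv\<rho> y)"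
    using y sA.closed by simp
qed

text \<open>An element of degree \<open>-1\<close> kills every gap projection, because paths have degree at least \<open>0\<close>,
  so all its coefficients vanish.\<close>

lemma adj_t_image_gap:
  assumes ga: "intertwines_gauge E A qE tE F B qF tF \<rho>" and v: "v \<in> verts E" and f: "f \<in> arcs F"
  shows "adj B (tF f) \<otimes>\<^bsub>B\<^esub> \<rho> (A.gap v) = \<zero>\<^bsub>B\<^esub>"
proof -
  define x where "x = inv\<rho> (adj B (tF f))"
  have x: "x \<in> carrier A" "\<rho> x = adj B (tF f)" using f by (auto simp: x_def B.adj_closed)
  have "x \<otimes>\<^bsub>A\<^esub> A.gap v = \<zero>\<^bsub>A\<^esub>"
  proof (rule A.eq_zero_if_path_coefficients_eq_zero[OF v])
    fix \<mu> assume \<mu>: "A.is_path v \<mu>"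
    \<comment> \<open>\<open>cnj z\<close> is the inverse of \<open>z\<close>, so the weight of
      \<open>\<mu>\<close> equals it only if \<open>z ^ Suc (length \<mu>) = 1\<close>; the choice
      of \<open>z\<close> excludes this.\<close>
    obtain z where z: "z \<in> circle" "z ^ Suc (length \<mu>) \<noteq> z ^ 0" using circle_power_neq by blast
    then have c: "cmod z = 1" by (simp add: circle_def)
    interpret sA: star_homomorphism A A "gauge_action E A qE tE z"
      unfolding gauge_action_def using c by (intro A.scaling_star_hom)
    interpret sB: star_homomorphism B B "gauge_action F B qF tF z"
      unfolding gauge_action_def using c by (intro B.scaling_star_hom)
    have "\<rho> (gauge_action E A qE tE z x) = gauge_action F B qF tF z (adj B (tF f))"
      using ga z(1) x by (simp add: intertwines_gauge_def)
    also have "\<dots> = cnj z \<odot>\<^bsub>B\<^esub> adj B (tF f)"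
      using f B.scaling_t[of "\<lambda>_. z" f] c sB.adj[of "tF f"] by (simp add: B.adj_smult gauge_action_def)
    finally have "gauge_action E A qE tE z x = cnj z \<odot>\<^bsub>A\<^esub> x"
      using x sA.closed by (intro inj) (auto simp: h.smult A.smult_closed)
    moreover have "A.weight (\<lambda>_. z) \<mu> \<noteq> cnj z"
    proof
      assume "A.weight (\<lambda>_. z) \<mu> = cnj z"
      then have "z * z ^ length \<mu> = z * cnj z" by simp
      also have "\<dots> = 1" using c complex_norm_square[of z] by simp
      finally show False using z(2) by simp
    qed
    ultimately show "adj A (A.path_elem v \<mu>) \<otimes>\<^bsub>A\<^esub> (x \<otimes>\<^bsub>A\<^esub> A.gap v) = \<zero>\<^bsub>A\<^esub>"
      using c x(1) \<mu> by (intro A.coefficient_eq_zero_if_weight_neq[of "\<lambda>_. z"]) (auto simp: gauge_action_def)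
  qed (use x v in \<open>auto simp: A.mult_closed A.mult_assoc A.gap_idem\<close>)
  then have "\<rho> (x \<otimes>\<^bsub>A\<^esub> A.gap v) = \<zero>\<^bsub>B\<^esub>" by (simp add: h.zero)
  then show ?thesis using x v by (simp add: h.mult)
qed

lemma lengths_eq_if_coefficient_neq_zero:
  assumes ga: "intertwines_gauge E A qE tE F B qF tF \<rho>"
    and \<mu>: "A.is_path v \<mu>" and \<nu>: "B.is_path w \<nu>"
    and neq: "adj B (B.path_elem w \<nu>) \<otimes>\<^bsub>B\<^esub> (\<rho> (A.path_elem v \<mu>) \<otimes>\<^bsub>B\<^esub> B.gap w) \<noteq> \<zero>\<^bsub>B\<^esub>"
  shows "length \<mu> = length \<nu>"
proof (rule ccontr)
  assume "length \<mu> \<noteq> length \<nu>"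
  then obtain z where z: "z \<in> circle" "z ^ length \<nu> \<noteq> z ^ length \<mu>" using circle_power_neq by metis
  then have "adj B (B.path_elem w \<nu>) \<otimes>\<^bsub>B\<^esub> (\<rho> (A.path_elem v \<mu>) \<otimes>\<^bsub>B\<^esub> B.gap w) = \<zero>\<^bsub>B\<^esub>"
    using ga \<mu> \<nu> by (intro coefficient_eq_zero_if_weights_neq[of "\<lambda>_. z" "\<lambda>_. z"])
      (auto simp: circle_def intertwines_gauge_def gauge_action_def)
  then show False using neq by simp
qed

end

section \<open>Recovering the graph\<close>

text \<open>The edges are partitioned by the ordered pairs of their ends. A bijection is chosen for
  each pair separately, and the choices are glued.\<close>

lemma digraph_iso_if_card_eq:
  assumes E: "fin_digraph E" and F: "fin_digraph F" and \<phi>: "bij_betw \<phi> (verts E) (verts F)"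
    and card: "\<And>v w. v \<in> verts E \<Longrightarrow> w \<in> verts E \<Longrightarrow>
      card {e \<in> arcs E. tail E e = v \<and> head E e = w} = card {f \<in> arcs F. tail F f = \<phi> v \<and> head F f = \<phi> w}"
  shows "digraph_iso E F"
proof -
  interpret E: fin_digraph E by fact
  interpret F: fin_digraph F by fact
  let ?A = "\<lambda>v w. {e \<in> arcs E. tail E e = v \<and> head E e = w}"
  let ?B = "\<lambda>v w. {f \<in> arcs F. tail F f = \<phi> v \<and> head F f = \<phi> w}"
  have "\<exists>h. bij_betw h (?A v w) (?B v w)" if "v \<in> verts E" "w \<in> verts E" for v w
    using card[OF that] by (intro finite_same_card_bij) auto
  note ex = this
  define h where "h v w = (SOME h. bij_betw h (?A v w) (?B v w))" for v w
  have h: "bij_betw (h v w) (?A v w) (?B v w)" if "v \<in> verts E" "w \<in> verts E" for v w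
    unfolding h_def by (rule someI_ex[OF ex[OF that]])
  define \<psi> where "\<psi> e = h (tail E e) (head E e) e" for e
  have \<psi>B: "\<psi> e \<in> ?B (tail E e) (head E e)" if "e \<in> arcs E" for e
    using h[of "tail E e" "head E e"] that unfolding \<psi>_def bij_betw_def by auto
  have inj\<phi>: "inj_on \<phi> (verts E)" and im\<phi>: "\<phi> ` verts E = verts F" using \<phi> by (auto simp: bij_betw_def)
  have inj: "inj_on \<psi> (arcs E)"
  proof (rule inj_onI)
    fix e e' assume e: "e \<in> arcs E" "e' \<in> arcs E" "\<psi> e = \<psi> e'"
    then have t: "tail E e = tail E e'" "head E e = head E e'"
      using \<psi>B[OF e(1)] \<psi>B[OF e(2)] inj_onD[OF inj\<phi>] by auto
    then show "e = e'" using e h[of "tail E e" "head E e"] unfolding \<psi>_def bij_betw_def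
      by (auto dest: inj_onD)
  qed
  have "\<psi> ` arcs E = arcs F"
  proof (intro equalityI subsetI)
    fix f assume f: "f \<in> arcs F"
    then have "tail F f \<in> \<phi> ` verts E" "head F f \<in> \<phi> ` verts E" unfolding im\<phi> by auto
    then obtain v w where v: "v \<in> verts E" "w \<in> verts E" "tail F f = \<phi> v" "head F f = \<phi> w" by auto
    then have "f \<in> h v w ` ?A v w" using h[OF v(1,2)] f by (auto simp: bij_betw_def)
    then show "f \<in> \<psi> ` arcs E" by (auto simp: \<psi>_def)
  qed (use \<psi>B in auto)
  then have eq: "F = app_iso \<lparr>iso_verts = \<phi>, iso_arcs = \<psi>, iso_head = head F, iso_tail = tail F\<rparr> E"
    by (intro pre_digraph.equality) (auto simp: im\<phi>)
  have "pre_digraph.digraph_isomorphism E \<lparr>iso_verts = \<phi>, iso_arcs = \<psi>, iso_head = head F, iso_tail = tail F\<rparr>"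
    using inj inj\<phi> \<psi>B E.wf_digraph_axioms by (auto simp: pre_digraph.digraph_isomorphism_def)
  then show ?thesis unfolding digraph_iso_def using eq by blast
qed

context toeplitz
begin

text \<open>The span acts diagonally on the vertex projections, on the left and on the right by the
  same scalars. This makes the vertex projections its minimal idempotents.\<close>

lemma vertex_spanD:
  assumes "x \<in> vertex_span E A q"
  obtains c where "x \<in> carrier A" "\<And>w. w \<in> verts E \<Longrightarrow> x \<otimes> q w = c w \<odot> q w" "\<And>w. w \<in> verts E \<Longrightarrow> q w \<otimes> x = c w \<odot> q w"
proof -
  obtain c where x: "x = (\<Oplus>v\<in>verts E. c v \<odot> q v)" using assms by (auto simp: vertex_span_def)
  have cl: "c v \<odot> q v \<in> carrier A" if "v \<in> verts E" for v using that by (simp add: smult_closed)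
  have "x \<in> carrier A" unfolding x using cl by (intro finsum_closed') auto
  moreover have "x \<otimes> q w = c w \<odot> q w" if w: "w \<in> verts E" for w
  proof -
    have "x \<otimes> q w = (\<Oplus>v\<in>verts E. (c v \<odot> q v) \<otimes> q w)"
      unfolding x using cl w by (intro finsum_mult_right) auto
    also have "\<dots> = (c w \<odot> q w) \<otimes> q w"
      using w cl by (intro finsum_single) (auto simp: mult_closed smult_mult_left q_mult)
    finally show ?thesis using w by (simp add: smult_mult_left q_idem)
  qed
  moreover have "q w \<otimes> x = c w \<odot> q w" if w: "w \<in> verts E" for w
  proof -
    have "q w \<otimes> x = (\<Oplus>v\<in>verts E. q w \<otimes> (c v \<odot> q v))"
      unfolding x using cl w by (intro finsum_mult_right) auto
    also have "\<dots> = q w \<otimes> (c w \<odot> q w)"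
      using w cl by (intro finsum_single) (auto simp: mult_closed smult_mult_right q_mult)
    finally show ?thesis using w by (simp add: smult_mult_right q_idem)
  qed
  ultimately show ?thesis using that by blast
qed

lemma q_in_vertex_span:
  assumes v: "v \<in> verts E" shows "q v \<in> vertex_span E A q"
proof -
  have "(\<Oplus>w\<in>verts E. (if w = v then 1 else 0) \<odot> q w) = (if v = v then 1 else 0) \<odot> q v"
    using v by (intro finsum_single) (auto simp: smult_closed)
  then have "q v = (\<Oplus>w\<in>verts E. (if w = v then 1 else 0) \<odot> q w)" using v by (simp add: smult_one)
  then show ?thesis unfolding vertex_span_def by (intro CollectI exI[of _ "\<lambda>w. if w = v then 1 else 0"]) simp
qed

end

lemma scaling_cong:
  "(\<And>e. e \<in> arcs E \<Longrightarrow> c e = d e) \<Longrightarrow> scaling_automorphism E A q t c = scaling_automorphism E A q t d"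
  unfolding scaling_automorphism_def by (auto intro!: arg_cong[where f = The] simp: fun_eq_iff)

context toeplitz_iso
begin

text \<open>Some product of the image of \<open>qE v\<close> with a vertex projection
  \<open>qF w\<close> is not zero. Computed in the span of \<open>F\<close> it is a multiple of
  \<open>qF w\<close>; computed for the preimage of \<open>qF w\<close> in the span of
  \<open>E\<close> it is a multiple of the image of \<open>qE v\<close>. Proportional non-zero
  idempotents are equal.\<close>

lemma image_q_if_vertex_span:
  assumes span: "\<rho> ` vertex_span E A qE = vertex_span F B qF" and v: "v \<in> verts E"
  shows "\<exists>w\<in>verts F. \<rho> (qE v) = qF w"
proof -
  let ?x = "\<rho> (qE v)"
  have x: "?x \<in> carrier B" "?x \<noteq> \<zero>\<^bsub>B\<^esub>" "?x \<otimes>\<^bsub>B\<^esub> ?x = ?x"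
    using v A.q_neq_zero[OF v] eq_zeroD[of "qE v"] A.q_idem[OF v] by (auto simp: h.closed simp flip: h.mult)
  have "?x \<in> vertex_span F B qF" using A.q_in_vertex_span[OF v] span by blast
  then obtain c where c: "\<And>w. w \<in> verts F \<Longrightarrow> ?x \<otimes>\<^bsub>B\<^esub> qF w = c w \<odot>\<^bsub>B\<^esub> qF w"
    by (rule B.vertex_spanD) blast
  obtain w where w: "w \<in> verts F" "?x \<otimes>\<^bsub>B\<^esub> qF w \<noteq> \<zero>\<^bsub>B\<^esub>"
    using B.eq_zero_if_mult_q_eq_zero[OF x(1)] x(2) by blast
  obtain y where y: "y \<in> vertex_span E A qE" "\<rho> y = qF w"
    using B.q_in_vertex_span[OF w(1)] span by (metis imageE)
  obtain d where d: "y \<in> carrier A" "\<And>u. u \<in> verts E \<Longrightarrow> qE u \<otimes>\<^bsub>A\<^esub> y = d u \<odot>\<^bsub>A\<^esub> qE u"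
    using y(1) by (rule A.vertex_spanD) blast
  have "?x \<otimes>\<^bsub>B\<^esub> qF w = d v \<odot>\<^bsub>B\<^esub> ?x"
    using arg_cong[OF d(2)[OF v], of \<rho>] d(1) v y(2) by (simp add: h.mult h.smult)
  then have e: "d v \<odot>\<^bsub>B\<^esub> ?x = c w \<odot>\<^bsub>B\<^esub> qF w" using c[OF w(1)] by simp
  have "d v \<noteq> 0" using w(2) \<open>?x \<otimes>\<^bsub>B\<^esub> qF w = d v \<odot>\<^bsub>B\<^esub> ?x\<close> x(1) by auto
  then have "?x = (1 / d v * d v) \<odot>\<^bsub>B\<^esub> ?x" using x(1) by (simp add: B.smult_one)
  also have "\<dots> = (1 / d v) \<odot>\<^bsub>B\<^esub> (c w \<odot>\<^bsub>B\<^esub> qF w)" using x(1) e by (simp only: B.smult_assoc)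
  also have "\<dots> = (1 / d v * c w) \<odot>\<^bsub>B\<^esub> qF w" using w(1) by (simp only: B.smult_assoc B.q_closed)
  finally have "?x = qF w"
    using B.idempotent_multiple[OF B.q_closed[OF w(1)] B.q_neq_zero[OF w(1)] B.q_idem[OF w(1)] _ x(2,3)] by blast
  then show ?thesis using w(1) by blast
qed

text \<open>The image of \<open>A.gap v\<close> is killed by all adjoint generators of
  \<open>B\<close>, so \<open>B.gap w\<close> absorbs it just as \<open>qF w\<close> does. The same
  argument for the inverse isomorphism gives the absorption in the other direction, and the two
  products agree after taking adjoints.\<close>

lemma image_gap_if_image_q:
  assumes ga: "intertwines_gauge E A qE tE F B qF tF \<rho>"
    and v: "v \<in> verts E" and w: "w \<in> verts F" and q: "\<rho> (qE v) = qF w"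
  shows "\<rho> (A.gap v) = B.gap w"
proof -
  interpret I: toeplitz_iso B F qF tF A E qE tE inv\<rho> by (rule inv_iso)
  let ?y = "\<rho> (A.gap v)" and ?z = "inv\<rho> (B.gap w)"
  have y: "?y \<in> carrier B" "adj B ?y = ?y" using v by (auto simp: h.closed A.gap_adj simp flip: h.adj)
  have z: "?z \<in> carrier A" "\<rho> ?z = B.gap w" using w by auto
  have q': "inv\<rho> (qF w) = qE v" using v by (simp flip: q)
  have "B.gap w \<otimes>\<^bsub>B\<^esub> ?y = qF w \<otimes>\<^bsub>B\<^esub> ?y"
    by (rule B.gap_absorb[OF w y(1) adj_t_image_gap[OF ga v]])
  also have "\<dots> = ?y" using v A.q_gap[OF v v] by (simp flip: q h.mult)
  finally have 1: "B.gap w \<otimes>\<^bsub>B\<^esub> ?y = ?y" .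
  have "A.gap v \<otimes>\<^bsub>A\<^esub> ?z = qE v \<otimes>\<^bsub>A\<^esub> ?z"
    by (rule A.gap_absorb[OF v z(1) I.adj_t_image_gap[OF gauge_inv[OF ga] w]])
  also have "\<dots> = ?z" using w B.q_gap[OF w w] by (simp flip: q' I.h.mult)
  finally have "?y \<otimes>\<^bsub>B\<^esub> B.gap w = B.gap w" using v z h.mult[of "A.gap v" ?z] by simp
  from arg_cong[OF this, of "adj B"] have "B.gap w \<otimes>\<^bsub>B\<^esub> ?y = B.gap w"
    using w y by (simp add: B.adj_mult B.gap_adj)
  then show ?thesis using 1 by simp
qed

lemma image_path_elem_gap:
  assumes "A.is_path v \<mu>" "\<rho> (A.gap v) = B.gap w"
  shows "\<rho> (A.path_elem v \<mu>) \<otimes>\<^bsub>B\<^esub> B.gap w = \<rho> (A.path_elem v \<mu>)"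
  using assms A.path_elem_gap[OF assms(1)] A.path_verts[OF assms(1)] by (simp flip: assms(2) h.mult)

text \<open>The block for a pair of vertices consists of the single edges between them. The gauge
  action forces equal lengths, the matched vertex projections force corresponding ranges, and the
  source is fixed by the gap projection.\<close>

lemma digraph_iso_if_gauge_and_vertex_span:
  assumes ga: "intertwines_gauge E A qE tE F B qF tF \<rho>"
    and span: "\<rho> ` vertex_span E A qE = vertex_span F B qF"
  shows "digraph_iso E F"
proof -
  interpret I: toeplitz_iso B F qF tF A E qE tE inv\<rho> by (rule inv_iso)
  have "vertex_span E A qE \<subseteq> carrier A" by (auto elim: A.vertex_spanD)
  then have "inv\<rho> ` vertex_span F B qF = vertex_span E A qE"
    unfolding span[symmetric] image_image by (auto simp: image_iff subset_iff)
  note span' = I.image_q_if_vertex_span[OF this]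
  obtain \<phi> where \<phi>: "\<And>v. v \<in> verts E \<Longrightarrow> \<phi> v \<in> verts F" "\<And>v. v \<in> verts E \<Longrightarrow> \<rho> (qE v) = qF (\<phi> v)"
    using image_q_if_vertex_span[OF span] by metis
  have qA: "v = w" if "v \<in> verts E" "w \<in> verts E" "qE v = qE w" for v w
    using A.q_mult[OF that(1,2)] A.q_idem[OF that(1)] A.q_neq_zero[OF that(1)] that(3) by (auto split: if_splits)
  have qB: "v = w" if "v \<in> verts F" "w \<in> verts F" "qF v = qF w" for v w
    using B.q_mult[OF that(1,2)] B.q_idem[OF that(1)] B.q_neq_zero[OF that(1)] that(3) by (auto split: if_splits)
  have inj: "inj_on \<phi> (verts E)"
  proof (rule inj_onI)
    fix v w assume "v \<in> verts E" "w \<in> verts E" "\<phi> v = \<phi> w"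
    then show "v = w" using \<phi>(2)[of v] \<phi>(2)[of w] by (intro qA inj) auto
  qed
  have "verts F \<subseteq> \<phi> ` verts E"
  proof
    fix w assume w: "w \<in> verts F"
    then obtain v where v: "v \<in> verts E" "inv\<rho> (qF w) = qE v" using span' by blast
    then have "qF w = qF (\<phi> v)" using \<phi>(2)[of v] w inv_simps(2)[of "qF w"] by simp
    then show "w \<in> \<phi> ` verts E" using qB w v \<phi>(1) by blast
  qed
  then have bij: "bij_betw \<phi> (verts E) (verts F)" using inj \<phi>(1) by (auto simp: bij_betw_def)
  show ?thesis
  proof (rule digraph_iso_if_card_eq[OF A.fin_digraph B.fin_digraph bij])
    fix v w assume v: "v \<in> verts E" and w: "w \<in> verts E"
    let ?I = "(\<lambda>e. [e]) ` {e \<in> arcs E. tail E e = v \<and> head E e = w}"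
    let ?J = "(\<lambda>f. [f]) ` {f \<in> arcs F. tail F f = \<phi> v \<and> head F f = \<phi> w}"
    have g: "\<rho> (A.gap v) = B.gap (\<phi> v)" using image_gap_if_image_q[OF ga v] \<phi>[OF v] by blast
    have "card ?I = card ?J"
    proof (rule card_eq_if_coefficients_block[OF v \<phi>(1)[OF v] g])
      fix \<mu> \<nu> assume \<mu>: "A.is_path v \<mu>" and \<nu>: "B.is_path (\<phi> v) \<nu>" and ne: "(\<mu> \<in> ?I) \<noteq> (\<nu> \<in> ?J)"
      show "adj B (B.path_elem (\<phi> v) \<nu>) \<otimes>\<^bsub>B\<^esub> \<rho> (A.path_elem v \<mu>) = \<zero>\<^bsub>B\<^esub>"
      proof (rule ccontr)
        assume nz: "adj B (B.path_elem (\<phi> v) \<nu>) \<otimes>\<^bsub>B\<^esub> \<rho> (A.path_elem v \<mu>) \<noteq> \<zero>\<^bsub>B\<^esub>"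
        then have len: "length \<mu> = length \<nu>"
          using lengths_eq_if_coefficient_neq_zero[OF ga \<mu> \<nu>] image_path_elem_gap[OF \<mu> g] by simp
        let ?r = "A.rng v \<mu>"
        have r: "?r \<in> verts E" using A.rng_verts[OF \<mu>] .
        \<comment> \<open>The vertex projection at the range of \<open>\<mu>\<close> is inserted and
          moved to the other path element, which it kills unless the ranges correspond.\<close>
        have "\<rho> (A.path_elem v \<mu>) = qF (\<phi> ?r) \<otimes>\<^bsub>B\<^esub> \<rho> (A.path_elem v \<mu>)"
          using \<phi>(2)[OF r] A.q_path_elem[OF \<mu> r] r \<mu> h.mult[of "qE ?r" "A.path_elem v \<mu>"] by simp
        then have "adj B (B.path_elem (\<phi> v) \<nu>) \<otimes>\<^bsub>B\<^esub> \<rho> (A.path_elem v \<mu>)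
            = adj B (qF (\<phi> ?r) \<otimes>\<^bsub>B\<^esub> B.path_elem (\<phi> v) \<nu>) \<otimes>\<^bsub>B\<^esub> \<rho> (A.path_elem v \<mu>)"
          using \<phi>(1)[OF r] \<mu> \<nu> h.closed by (metis (no_types, lifting) A.path_elem_closed B.adj_closed B.adj_mult
              B.mult_assoc B.path_elem_closed B.q_adj B.q_closed)
        then have rng: "B.rng (\<phi> v) \<nu> = \<phi> ?r"
          using nz \<mu> h.closed B.q_path_elem[OF \<nu> \<phi>(1)[OF r]] by (auto split: if_splits)
        have "\<mu> \<in> ?I \<longleftrightarrow> \<nu> \<in> ?J"
        proof (cases "length \<mu> = 1")
          case True
          then obtain e f where ef: "\<mu> = [e]" "\<nu> = [f]" using len by (auto simp: length_Suc_conv)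
          then show ?thesis using \<mu> \<nu> rng inj_on_eq_iff[OF inj r w] by auto
        next
          case False
          then show ?thesis using len by auto
        qed
        then show False using ne by simp
      qed
    qed (use v \<phi>(1) in auto)
    then show "card {e \<in> arcs E. tail E e = v \<and> head E e = w} = card {f \<in> arcs F. tail F f = \<phi> v \<and> head F f = \<phi> w}"
      by (simp add: card_image inj_on_def)
  qed
qed

text \<open>Edges from \<open>w\<close> to \<open>v\<close> are counted through paths of length two: \<open>out v\<close> times their number is
  the number of paths from \<open>w\<close> whose last edge leaves \<open>v\<close>, and \<open>out v\<close> is not zero.\<close>

lemma digraph_iso_if_gen_gauge:
  assumes gga: "intertwines_gen_gauge E A qE tE F B qF tF \<rho>"
    and E: "no_sinks E" and F: "no_sinks F"
  shows "digraph_iso E F"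
proof -
  obtain \<phi> where bij: "bij_betw \<phi> (verts E) (verts F)"
    and gg: "\<And>z x. z \<in> verts E \<rightarrow>\<^sub>E circle \<Longrightarrow> x \<in> carrier A \<Longrightarrow>
        \<rho> (gen_gauge_action E A qE tE z x) = gen_gauge_action F B qF tF (induced_torus_map E F \<phi> z) (\<rho> x)"
    using gga by (auto simp: intertwines_gen_gauge_def)
  have \<phi>: "\<phi> v \<in> verts F" if "v \<in> verts E" for v using bij that by (auto simp: bij_betw_def)
  have inj: "inj_on \<phi> (verts E)" using bij by (simp add: bij_betw_def)
  define \<theta> where "\<theta> = inv_into (verts E) \<phi>"
  have \<theta>: "\<theta> w \<in> verts E" "\<phi> (\<theta> w) = w" if "w \<in> verts F" for w
    using bij that by (auto simp: \<theta>_def bij_betw_def f_inv_into_f inv_into_into)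
  have \<theta>\<phi>: "\<theta> (\<phi> v) = v" if "v \<in> verts E" for v using inj that by (simp add: \<theta>_def)
  have twine: "\<rho> (scaling_automorphism E A qE tE (\<lambda>e. z (tail E e)) x) =
      scaling_automorphism F B qF tF (\<lambda>f. z (\<theta> (tail F f))) (\<rho> x)"
    if z: "\<And>v. v \<in> verts E \<Longrightarrow> z v \<in> circle" and x: "x \<in> carrier A" for z x
  proof -
    have "restrict z (verts E) \<in> verts E \<rightarrow>\<^sub>E circle" using z by auto
    from gg[OF this x] have "\<rho> (scaling_automorphism E A qE tE (\<lambda>e. restrict z (verts E) (tail E e)) x) =
        scaling_automorphism F B qF tF (\<lambda>f. induced_torus_map E F \<phi> (restrict z (verts E)) (tail F f)) (\<rho> x)"
      by (simp only: gen_gauge_action_def)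
    moreover have "scaling_automorphism E A qE tE (\<lambda>e. restrict z (verts E) (tail E e)) =
        scaling_automorphism E A qE tE (\<lambda>e. z (tail E e))" by (rule scaling_cong) simp
    moreover have "scaling_automorphism F B qF tF (\<lambda>f. induced_torus_map E F \<phi> (restrict z (verts E)) (tail F f)) =
        scaling_automorphism F B qF tF (\<lambda>f. z (\<theta> (tail F f)))"
      using \<theta>(1) by (intro scaling_cong) (simp add: induced_torus_map_def \<theta>_def)
    ultimately show ?thesis by simp
  qed
  \<comment> \<open>The gauge action is the restriction of the generalised one to the diagonal of
    the torus.\<close>
  have ga: "intertwines_gauge E A qE tE F B qF tF \<rho>"
    unfolding intertwines_gauge_def gauge_action_def using twine[of "\<lambda>_. z" for z] by blast
  have weights: "B.weight (\<lambda>f. z (\<theta> (tail F f))) \<nu> = A.weight (\<lambda>e. z (tail E e)) \<mu>"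
    if z: "\<And>v. v \<in> verts E \<Longrightarrow> z v \<in> circle" and \<mu>: "A.is_path v \<mu>" and \<nu>: "B.is_path w \<nu>"
      and nz: "adj B (B.path_elem w \<nu>) \<otimes>\<^bsub>B\<^esub> (\<rho> (A.path_elem v \<mu>) \<otimes>\<^bsub>B\<^esub> B.gap w) \<noteq> \<zero>\<^bsub>B\<^esub>" for z v \<mu> w \<nu>
    using coefficient_eq_zero_if_weights_neq[of "\<lambda>e. z (tail E e)" "\<lambda>f. z (\<theta> (tail F f))", OF _ _ twine \<mu> \<nu>] nz z \<theta>(1)
    by (auto simp: circle_def)
  have lengths: "length \<mu> = length \<nu>"
    if \<mu>: "A.is_path v \<mu>" and \<nu>: "B.is_path w \<nu>"
      and nz: "adj B (B.path_elem w \<nu>) \<otimes>\<^bsub>B\<^esub> (\<rho> (A.path_elem v \<mu>) \<otimes>\<^bsub>B\<^esub> B.gap w) \<noteq> \<zero>\<^bsub>B\<^esub>" for v \<mu> w \<nu>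
    by (rule lengths_eq_if_coefficient_neq_zero[OF ga \<mu> \<nu> nz])
  \<comment> \<open>A point of the torus that singles out one vertex: the weight of a path is minus
    one to the number of its edges with source \<open>u\<close>.\<close>
  define sgn_at where "sgn_at u = (\<lambda>v. if v = u then - 1 else (1::complex))" for u :: 'v
  have sgn: "sgn_at u v \<in> circle" for u v by (simp add: sgn_at_def circle_def)
  have g: "\<rho> (A.gap v) = B.gap (\<phi> v)" if v: "v \<in> verts E" for v
  proof -
    let ?y = "\<rho> (A.gap v)" and ?w = "\<phi> v"
    have y: "?y \<in> carrier B" "adj B ?y = ?y" "?y \<otimes>\<^bsub>B\<^esub> ?y = ?y" "?y \<noteq> \<zero>\<^bsub>B\<^esub>"
      using v A.gap_neq_zero[OF v] eq_zeroD[of "A.gap v"] by (auto simp: h.closed A.gap_adj A.gap_idem simp flip: h.adj h.mult)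
    have yq: "?y \<otimes>\<^bsub>B\<^esub> qF w = ?y \<otimes>\<^bsub>B\<^esub> B.gap w" if w: "w \<in> verts F" for w
      using arg_cong[OF B.gap_absorb[OF w y(1) adj_t_image_gap[OF ga v]], of "adj B"] w y
      by (simp add: B.adj_mult B.gap_adj B.q_adj)
    have off: "?y \<otimes>\<^bsub>B\<^esub> B.gap w = \<zero>\<^bsub>B\<^esub>" if w: "w \<in> verts F" "w \<noteq> ?w" for w
    proof -
      \<comment> \<open>As \<open>v\<close> is no sink, some edge leaves it, and \<open>?y\<close>
        will be written as the product of \<open>?r\<close> with its adjoint on the left. The
        coefficients of \<open>?r\<close> at \<open>w\<close> sit at single edges, whose source has
        to be matched with \<open>v\<close>; for \<open>w\<close> different from \<open>?w\<close>
        there are none.\<close>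
      obtain e where e: "e \<in> arcs E" "tail E e = v" using E v by (auto simp: no_sinks_def out_arcs_def)
      then have \<mu>: "A.is_path v [e]" using v by simp
      let ?r = "\<rho> (A.path_elem v [e])"
      have rc: "?r \<in> carrier B" using A.path_elem_closed[OF \<mu>] by (rule h.closed)
      have "?r \<otimes>\<^bsub>B\<^esub> B.gap w = \<zero>\<^bsub>B\<^esub>"
      proof (rule B.eq_zero_if_path_coefficients_eq_zero[OF w(1)])
        fix \<nu> assume \<nu>: "B.is_path w \<nu>"
        show "adj B (B.path_elem w \<nu>) \<otimes>\<^bsub>B\<^esub> (?r \<otimes>\<^bsub>B\<^esub> B.gap w) = \<zero>\<^bsub>B\<^esub>"
        proof (rule ccontr)
          assume nz: "adj B (B.path_elem w \<nu>) \<otimes>\<^bsub>B\<^esub> (?r \<otimes>\<^bsub>B\<^esub> B.gap w) \<noteq> \<zero>\<^bsub>B\<^esub>"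
          obtain f where f: "\<nu> = [f]" using lengths[OF \<mu> \<nu> nz] by (cases \<nu>) auto
          have "sgn_at v (\<theta> w) = sgn_at v v" using weights[of "sgn_at v", OF sgn \<mu> \<nu> nz] f \<nu> e by simp
          then have "\<theta> w = v" by (simp add: sgn_at_def split: if_splits)
          then show False using \<theta>(2)[OF w(1)] w(2) by simp
        qed
      qed (use w rc in \<open>auto simp: B.mult_closed B.mult_assoc B.gap_idem simp del: A.path_elem.simps\<close>)
      moreover have "?y = adj B ?r \<otimes>\<^bsub>B\<^esub> ?r"
        using A.path_elem_orthonormal[OF \<mu> \<mu>] A.path_elem_closed[OF \<mu>]
        by (simp add: A.adj_closed del: A.path_elem.simps flip: h.adj h.mult)
      ultimately show ?thesis using rc w by (simp add: B.mult_assoc B.adj_closed del: A.path_elem.simps)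
    qed
    have w: "?w \<in> verts F" by (rule \<phi>[OF v])
    \<comment> \<open>Multiplied by any \<open>qF u\<close> on the right, the two terms agree; for
      \<open>u\<close> other than \<open>?w\<close> both products are zero.\<close>
    have "?y \<ominus>\<^bsub>B\<^esub> ?y \<otimes>\<^bsub>B\<^esub> B.gap ?w = \<zero>\<^bsub>B\<^esub>"
    proof (rule B.eq_zero_if_mult_q_eq_zero)
      fix u assume u: "u \<in> verts F"
      have "(?y \<ominus>\<^bsub>B\<^esub> ?y \<otimes>\<^bsub>B\<^esub> B.gap ?w) \<otimes>\<^bsub>B\<^esub> qF u = ?y \<otimes>\<^bsub>B\<^esub> B.gap u \<ominus>\<^bsub>B\<^esub> ?y \<otimes>\<^bsub>B\<^esub> (B.gap ?w \<otimes>\<^bsub>B\<^esub> qF u)"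
        using u w y(1) by (simp add: B.minus_eq B.mult_l_distr B.mult_minus_left B.mult_assoc B.mult_closed yq)
      also have "\<dots> = \<zero>\<^bsub>B\<^esub>"
        using u w y(1) off[OF u] by (cases "u = ?w") (auto simp: B.gap_q B.minus_self B.mult_closed)
      finally show "(?y \<ominus>\<^bsub>B\<^esub> ?y \<otimes>\<^bsub>B\<^esub> B.gap ?w) \<otimes>\<^bsub>B\<^esub> qF u = \<zero>\<^bsub>B\<^esub>" .
    qed (use y w in \<open>auto simp: B.mult_closed\<close>)
    then have yg: "?y \<otimes>\<^bsub>B\<^esub> B.gap ?w = ?y"
      using B.minus_eq_zeroD[OF y(1) B.mult_closed[OF y(1) B.gap_closed[OF w]]] by simp
    obtain a where a: "adj B (B.path_elem ?w []) \<otimes>\<^bsub>B\<^esub> (?y \<otimes>\<^bsub>B\<^esub> B.gap ?w) = a \<odot>\<^bsub>B\<^esub> B.gap ?w"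
      using B.path_coefficient_exists[OF y(1), of ?w "[]"] w by auto
    \<comment> \<open>\<open>?y\<close> has degree zero, so only the coefficient at the empty path
      survives. Idempotence then fixes the scalar.\<close>
    have "?y = (\<Oplus>\<^bsub>B\<^esub>\<nu>\<in>{[]}. a \<odot>\<^bsub>B\<^esub> B.path_elem ?w \<nu>)"
    proof (rule B.expansion[OF w y(1) yg])
      fix \<nu> assume \<nu>: "B.is_path ?w \<nu>" "\<nu> \<notin> {[]}"
      show "adj B (B.path_elem ?w \<nu>) \<otimes>\<^bsub>B\<^esub> ?y = \<zero>\<^bsub>B\<^esub>"
        using lengths[of v "[]", OF _ \<nu>(1)] \<nu>(2) v yg by auto
    qed (use w a yg in auto)
    then have "?y = a \<odot>\<^bsub>B\<^esub> B.gap ?w" using w by (simp add: B.smult_closed)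
    then show ?thesis
      using B.idempotent_multiple[OF B.gap_closed[OF w] B.gap_neq_zero[OF w] B.gap_idem[OF w] _ y(4,3)] by blast
  qed
  have nz': "adj B (B.path_elem (\<phi> v) \<nu>) \<otimes>\<^bsub>B\<^esub> (\<rho> (A.path_elem v \<mu>) \<otimes>\<^bsub>B\<^esub> B.gap (\<phi> v)) \<noteq> \<zero>\<^bsub>B\<^esub>"
    if "A.is_path v \<mu>" "adj B (B.path_elem (\<phi> v) \<nu>) \<otimes>\<^bsub>B\<^esub> \<rho> (A.path_elem v \<mu>) \<noteq> \<zero>\<^bsub>B\<^esub>" for v \<mu> \<nu>
    using image_path_elem_gap[OF that(1) g[OF A.path_verts[OF that(1)]]] that(2) by simp
  have out: "card {e \<in> arcs E. tail E e = v} = card {f \<in> arcs F. tail F f = \<phi> v}" if v: "v \<in> verts E" for v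
  proof -
    let ?I = "(\<lambda>e. [e]) ` {e \<in> arcs E. tail E e = v}" and ?J = "(\<lambda>f. [f]) ` {f \<in> arcs F. tail F f = \<phi> v}"
    have "card ?I = card ?J"
    proof (rule card_eq_if_coefficients_block[OF v \<phi>[OF v] g[OF v]])
      fix \<mu> \<nu> assume \<mu>: "A.is_path v \<mu>" and \<nu>: "B.is_path (\<phi> v) \<nu>" and ne: "(\<mu> \<in> ?I) \<noteq> (\<nu> \<in> ?J)"
      have "\<mu> \<in> ?I \<longleftrightarrow> length \<mu> = 1" "\<nu> \<in> ?J \<longleftrightarrow> length \<nu> = 1" using \<mu> \<nu> by (auto simp: length_Suc_conv)
      then show "adj B (B.path_elem (\<phi> v) \<nu>) \<otimes>\<^bsub>B\<^esub> \<rho> (A.path_elem v \<mu>) = \<zero>\<^bsub>B\<^esub>"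
        using ne lengths[OF \<mu> \<nu> nz'[OF \<mu>]] by auto
    qed (use v \<phi> in auto)
    then show ?thesis by (simp add: card_image inj_on_def)
  qed
  have "card {e \<in> arcs E. tail E e = w \<and> head E e = v} = card {f \<in> arcs F. tail F f = \<phi> w \<and> head F f = \<phi> v}"
    if w: "w \<in> verts E" and v: "v \<in> verts E" for v w
  proof -
    \<comment> \<open>In a pair \<open>(e, e')\<close> the edge \<open>e'\<close> comes first and
      runs from \<open>w\<close> to \<open>v\<close>; then \<open>e\<close> leaves \<open>v\<close>.
      The head of \<open>e\<close> is left free because the generalised gauge action does not see
      it.\<close>
    let ?S = "{e \<in> arcs E. tail E e = v} \<times> {e \<in> arcs E. tail E e = w \<and> head E e = v}"
    let ?T = "{f \<in> arcs F. tail F f = \<phi> v} \<times> {f \<in> arcs F. tail F f = \<phi> w \<and> head F f = \<phi> v}"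
    let ?I = "(\<lambda>(e, e'). [e, e']) ` ?S" and ?J = "(\<lambda>(f, f'). [f, f']) ` ?T"
    have "card ?I = card ?J"
    proof (rule card_eq_if_coefficients_block[OF w \<phi>[OF w] g[OF w]])
      fix \<mu> \<nu> assume \<mu>: "A.is_path w \<mu>" and \<nu>: "B.is_path (\<phi> w) \<nu>" and ne: "(\<mu> \<in> ?I) \<noteq> (\<nu> \<in> ?J)"
      show "adj B (B.path_elem (\<phi> w) \<nu>) \<otimes>\<^bsub>B\<^esub> \<rho> (A.path_elem w \<mu>) = \<zero>\<^bsub>B\<^esub>"
      proof (rule ccontr)
        assume "adj B (B.path_elem (\<phi> w) \<nu>) \<otimes>\<^bsub>B\<^esub> \<rho> (A.path_elem w \<mu>) \<noteq> \<zero>\<^bsub>B\<^esub>"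
        note nz = nz'[OF \<mu> this]
        note len = lengths[OF \<mu> \<nu> nz]
        have "\<mu> \<in> ?I \<longleftrightarrow> \<nu> \<in> ?J"
        proof (cases "length \<mu> = 2")
          case True
          then obtain e e' f f' where p: "\<mu> = [e, e']" "\<nu> = [f, f']"
            using len by (auto simp: length_Suc_conv numeral_2_eq_2)
          have mem: "\<mu> \<in> ?I \<longleftrightarrow> tail E e = v" "\<nu> \<in> ?J \<longleftrightarrow> tail F f = \<phi> v"
            using \<mu> \<nu> p by (auto simp: image_iff)
          have tf: "tail F f \<in> verts F" "tail E e \<in> verts E" using \<mu> \<nu> p by auto
          \<comment> \<open>Both paths start at corresponding vertices, so the second factors agree
            and cancel. The first factors compare the sources of the last edges.\<close>
          have "sgn_at (tail E e) (\<theta> (tail F f)) * sgn_at (tail E e) w = sgn_at (tail E e) (tail E e) * sgn_at (tail E e) w"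
            using weights[of "sgn_at (tail E e)", OF sgn \<mu> \<nu> nz] p \<mu> \<nu> \<theta>\<phi>[OF w] by simp
          then have "\<theta> (tail F f) = tail E e" by (simp add: sgn_at_def split: if_splits)
          then have "tail F f = \<phi> (tail E e)" using \<theta>(2)[OF tf(1)] by simp
          then show ?thesis using mem inj_on_eq_iff[OF inj tf(2) v] by simp
        next
          case False
          then show ?thesis using len by auto
        qed
        then show False using ne by simp
      qed
    qed (use v w \<phi> in auto)
    moreover have "card ?I = card ?S" by (rule card_image) (auto simp: inj_on_def)
    moreover have "card ?J = card ?T" by (rule card_image) (auto simp: inj_on_def)
    ultimately have "card {e \<in> arcs E. tail E e = v} * card {e \<in> arcs E. tail E e = w \<and> head E e = v} =
        card {e \<in> arcs E. tail E e = v} * card {f \<in> arcs F. tail F f = \<phi> w \<and> head F f = \<phi> v}"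
      unfolding out[OF v] by (simp only: card_cartesian_product out[OF v])
    moreover have "card {e \<in> arcs E. tail E e = v} \<noteq> 0"
      using E v by (auto simp: no_sinks_def out_arcs_def)
    ultimately show ?thesis by (simp only: mult_cancel_left) blast
  qed
  then show ?thesis by (intro digraph_iso_if_card_eq[OF A.fin_digraph B.fin_digraph bij])
qed

end

section \<open>Isomorphic graphs\<close>

lemma toeplitz_family_pullback:
  assumes B: "toeplitz B F qF tF" and E: "fin_digraph E"
    and \<phi>: "bij_betw \<phi> (verts E) (verts F)" and \<psi>: "bij_betw \<psi> (arcs E) (arcs F)"
    and ends: "\<And>e. e \<in> arcs E \<Longrightarrow> tail F (\<psi> e) = \<phi> (tail E e)" "\<And>e. e \<in> arcs E \<Longrightarrow> head F (\<psi> e) = \<phi> (head E e)"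
  shows "toeplitz_family E B (\<lambda>v. qF (\<phi> v)) (\<lambda>e. tF (\<psi> e))"
proof -
  interpret B: toeplitz B F qF tF by fact
  interpret E: fin_digraph E by fact
  note fam = toeplitz_familyD[OF B.family]
  have \<phi>F: "\<phi> v \<in> verts F" if "v \<in> verts E" for v using \<phi> that by (auto simp: bij_betw_def)
  have \<psi>F: "\<psi> e \<in> arcs F" if "e \<in> arcs E" for e using \<psi> that by (auto simp: bij_betw_def)
  have inj: "inj_on \<phi> (verts E)" "inj_on \<psi> (arcs E)" using \<phi> \<psi> by (auto simp: bij_betw_def)
  show ?thesis
    unfolding toeplitz_family_def
  proof (intro conjI ballI impI)
    fix v assume v: "v \<in> verts E"
    show "projection B (qF (\<phi> v))" by (rule fam(1)[OF \<phi>F[OF v]])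
    have im: "\<psi> ` in_arcs E v = in_arcs F (\<phi> v)"
    proof (intro equalityI subsetI)
      fix f assume "f \<in> in_arcs F (\<phi> v)"
      then have f: "f \<in> arcs F" "head F f = \<phi> v" by (auto simp: in_arcs_def)
      then obtain e where e: "e \<in> arcs E" "f = \<psi> e" using \<psi> by (auto simp: bij_betw_def)
      then have "head E e = v" using ends(2) f(2) v inj_onD[OF inj(1)] by auto
      then show "f \<in> \<psi> ` in_arcs E v" using e by (auto simp: in_arcs_def)
    qed (use ends \<psi>F in \<open>auto simp: in_arcs_def\<close>)
    have "(\<Oplus>\<^bsub>B\<^esub>f\<in>\<psi> ` in_arcs E v. tF f \<otimes>\<^bsub>B\<^esub> adj B (tF f)) = (\<Oplus>\<^bsub>B\<^esub>e\<in>in_arcs E v. tF (\<psi> e) \<otimes>\<^bsub>B\<^esub> adj B (tF (\<psi> e)))"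
      using \<psi>F inj(2) by (intro B.finsum_reindex) (auto simp: in_arcs_def B.mult_closed B.adj_closed inj_on_def)
    then show "cstar_le B (\<Oplus>\<^bsub>B\<^esub>e\<in>in_arcs E v. tF (\<psi> e) \<otimes>\<^bsub>B\<^esub> adj B (tF (\<psi> e))) (qF (\<phi> v))"
      using fam(5)[OF \<phi>F[OF v]] by (simp add: im)
  next
    fix v w assume "v \<in> verts E" "w \<in> verts E" "v \<noteq> w"
    then show "qF (\<phi> v) \<otimes>\<^bsub>B\<^esub> qF (\<phi> w) = \<zero>\<^bsub>B\<^esub>" using fam(2) \<phi>F inj(1) by (auto simp: inj_on_eq_iff)
  next
    fix e assume e: "e \<in> arcs E"
    show "partial_isometry B (tF (\<psi> e))" by (rule fam(3)[OF \<psi>F[OF e]])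
    show "adj B (tF (\<psi> e)) \<otimes>\<^bsub>B\<^esub> tF (\<psi> e) = qF (\<phi> (tail E e))" using fam(4)[OF \<psi>F[OF e]] ends(1)[OF e] by simp
  qed
qed

text \<open>The universal property is applied to the graph isomorphism and to its inverse, and both
  composites fix the generators.\<close>

lemma star_iso_if_graph_iso:
  fixes A :: "'a cstar" and B :: "'b cstar"
  assumes A: "toeplitz A E qE tE" and B: "toeplitz B F qF tF"
    and \<phi>: "bij_betw \<phi> (verts E) (verts F)" and \<psi>: "bij_betw \<psi> (arcs E) (arcs F)"
    and ends: "\<And>e. e \<in> arcs E \<Longrightarrow> tail F (\<psi> e) = \<phi> (tail E e)" "\<And>e. e \<in> arcs E \<Longrightarrow> head F (\<psi> e) = \<phi> (head E e)"
  obtains \<rho> where "star_iso A B \<rho>" "\<And>v. v \<in> verts E \<Longrightarrow> \<rho> (qE v) = qF (\<phi> v)" "\<And>e. e \<in> arcs E \<Longrightarrow> \<rho> (tE e) = tF (\<psi> e)"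
proof -
  interpret A: toeplitz A E qE tE by fact
  interpret B: toeplitz B F qF tF by fact
  let ?\<phi> = "inv_into (verts E) \<phi>" and ?\<psi> = "inv_into (arcs E) \<psi>"
  have \<phi>': "bij_betw ?\<phi> (verts F) (verts E)" and \<psi>': "bij_betw ?\<psi> (arcs F) (arcs E)"
    using \<phi> \<psi> by (auto intro: bij_betw_inv_into)
  have v: "?\<phi> (\<phi> v) = v" "\<phi> v \<in> verts F" if "v \<in> verts E" for v using \<phi> that by (auto simp: bij_betw_def)
  have v': "\<phi> (?\<phi> w) = w" "?\<phi> w \<in> verts E" if "w \<in> verts F" for w
    using \<phi> that by (auto simp: bij_betw_def f_inv_into_f inv_into_into)
  have e: "?\<psi> (\<psi> e) = e" "\<psi> e \<in> arcs F" if "e \<in> arcs E" for e using \<psi> that by (auto simp: bij_betw_def)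
  have e': "\<psi> (?\<psi> f) = f" "?\<psi> f \<in> arcs E" if "f \<in> arcs F" for f
    using \<psi> that by (auto simp: bij_betw_def f_inv_into_f inv_into_into)
  have ends': "tail E (?\<psi> f) = ?\<phi> (tail F f)" "head E (?\<psi> f) = ?\<phi> (head F f)" if "f \<in> arcs F" for f
    using ends(1)[OF e'(2)[OF that]] ends(2)[OF e'(2)[OF that]] e'[OF that] v(1) by auto
  obtain \<rho> where \<rho>: "star_hom A B \<rho>" "\<And>v. v \<in> verts E \<Longrightarrow> \<rho> (qE v) = qF (\<phi> v)" "\<And>e. e \<in> arcs E \<Longrightarrow> \<rho> (tE e) = tF (\<psi> e)"
    by (rule A.universal[OF B.cstar_algebra_axioms toeplitz_family_pullback[OF B A.fin_digraph \<phi> \<psi> ends] B.generated B.countable_generators], assumption+, rule that)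
  obtain \<sigma> where \<sigma>: "star_hom B A \<sigma>" "\<And>v. v \<in> verts F \<Longrightarrow> \<sigma> (qF v) = qE (?\<phi> v)" "\<And>e. e \<in> arcs F \<Longrightarrow> \<sigma> (tF e) = tE (?\<psi> e)"
    by (rule B.universal[OF A.cstar_algebra_axioms toeplitz_family_pullback[OF A B.fin_digraph \<phi>' \<psi>' ends'] A.generated A.countable_generators], assumption+, rule that)
  have 1: "\<sigma> (\<rho> x) = x" if "x \<in> carrier A" for x
    using A.hom_eqI[OF A.cstar_algebra_axioms star_hom_comp[OF \<rho>(1) \<sigma>(1)] star_hom_id _ _ that] by (simp add: \<rho> \<sigma> v e)
  have 2: "\<rho> (\<sigma> x) = x" if "x \<in> carrier B" for x
    using B.hom_eqI[OF B.cstar_algebra_axioms star_hom_comp[OF \<sigma>(1) \<rho>(1)] star_hom_id _ _ that] by (simp add: \<rho> \<sigma> v' e')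
  have "bij_betw \<rho> (carrier A) (carrier B)"
    using \<rho>(1) \<sigma>(1) by (intro bij_betw_byWitness[where f' = \<sigma>]) (auto simp: 1 2 star_hom_def)
  then show ?thesis using that \<rho> by (auto simp: star_iso_def)
qed

text \<open>Both composites are homomorphisms that agree on the generators. General scalars cover
  the gauge action and the generalised one together.\<close>

lemma (in toeplitz_iso) intertwines_scaling:
  assumes q: "\<And>v. v \<in> verts E \<Longrightarrow> \<rho> (qE v) = qF (\<phi> v)" "\<And>v. v \<in> verts E \<Longrightarrow> \<phi> v \<in> verts F"
    and t: "\<And>e. e \<in> arcs E \<Longrightarrow> \<rho> (tE e) = tF (\<psi> e)" "\<And>e. e \<in> arcs E \<Longrightarrow> \<psi> e \<in> arcs F"
    and c: "\<And>e. e \<in> arcs E \<Longrightarrow> cmod (c e) = 1" and d: "\<And>f. f \<in> arcs F \<Longrightarrow> cmod (d f) = 1"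
    and dc: "\<And>e. e \<in> arcs E \<Longrightarrow> d (\<psi> e) = c e" and x: "x \<in> carrier A"
  shows "\<rho> (scaling_automorphism E A qE tE c x) = scaling_automorphism F B qF tF d (\<rho> x)"
proof -
  have h1: "star_hom A A (scaling_automorphism E A qE tE c)" "star_hom B B (scaling_automorphism F B qF tF d)"
    using A.scaling_star_iso[OF c] B.scaling_star_iso[OF d] by (auto simp: star_iso_def)
  have "(\<rho> \<circ> scaling_automorphism E A qE tE c) x = (scaling_automorphism F B qF tF d \<circ> \<rho>) x"
    using q t dc
    by (intro A.hom_eqI[OF B.cstar_algebra_axioms star_hom_comp[OF h1(1) h.star_hom] star_hom_comp[OF h.star_hom h1(2)] _ _ x])
      (auto simp: A.scaling_q[OF c] A.scaling_t[OF c] B.scaling_q[OF d] B.scaling_t[OF d] h.smult)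
  then show ?thesis by simp
qed

lemma (in toeplitz_iso) vertex_span_image:
  assumes \<phi>: "bij_betw \<phi> (verts E) (verts F)" and q: "\<And>v. v \<in> verts E \<Longrightarrow> \<rho> (qE v) = qF (\<phi> v)"
  shows "\<rho> ` vertex_span E A qE = vertex_span F B qF"
proof -
  have \<phi>': "inj_on \<phi> (verts E)" "\<phi> ` verts E = verts F" using \<phi> by (auto simp: bij_betw_def)
  have \<phi>F: "\<phi> v \<in> verts F" if "v \<in> verts E" for v using \<phi>' that by blast
  have im: "\<rho> (\<Oplus>\<^bsub>A\<^esub>v\<in>verts E. c (\<phi> v) \<odot>\<^bsub>A\<^esub> qE v) = (\<Oplus>\<^bsub>B\<^esub>w\<in>verts F. c w \<odot>\<^bsub>B\<^esub> qF w)" for c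
  proof -
    have "\<rho> (\<Oplus>\<^bsub>A\<^esub>v\<in>verts E. c (\<phi> v) \<odot>\<^bsub>A\<^esub> qE v) = (\<Oplus>\<^bsub>B\<^esub>v\<in>verts E. \<rho> (c (\<phi> v) \<odot>\<^bsub>A\<^esub> qE v))"
      by (rule h.finsum) (auto simp: A.smult_closed)
    also have "\<dots> = (\<Oplus>\<^bsub>B\<^esub>v\<in>verts E. c (\<phi> v) \<odot>\<^bsub>B\<^esub> qF (\<phi> v))"
      using \<phi>F by (intro B.finsum_cong') (auto simp: h.smult q B.smult_closed)
    also have "\<dots> = (\<Oplus>\<^bsub>B\<^esub>w\<in>\<phi> ` verts E. c w \<odot>\<^bsub>B\<^esub> qF w)"
      using \<phi>F \<phi>' by (intro B.finsum_reindex[symmetric]) (auto simp: B.smult_closed)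
    finally show ?thesis by (simp add: \<phi>')
  qed
  show ?thesis
  proof (intro equalityI subsetI)
    fix y assume "y \<in> \<rho> ` vertex_span E A qE"
    then obtain c where y: "y = \<rho> (\<Oplus>\<^bsub>A\<^esub>v\<in>verts E. c v \<odot>\<^bsub>A\<^esub> qE v)" by (auto simp: vertex_span_def)
    have "(\<Oplus>\<^bsub>A\<^esub>v\<in>verts E. c v \<odot>\<^bsub>A\<^esub> qE v) = (\<Oplus>\<^bsub>A\<^esub>v\<in>verts E. c (inv_into (verts E) \<phi> (\<phi> v)) \<odot>\<^bsub>A\<^esub> qE v)"
      using \<phi>' by (intro A.finsum_cong') (auto simp: A.smult_closed)
    then have "y = (\<Oplus>\<^bsub>B\<^esub>w\<in>verts F. c (inv_into (verts E) \<phi> w) \<odot>\<^bsub>B\<^esub> qF w)"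
      using y im[of "\<lambda>w. c (inv_into (verts E) \<phi> w)"] by simp
    then show "y \<in> vertex_span F B qF"
      unfolding vertex_span_def by (intro CollectI exI[of _ "\<lambda>w. c (inv_into (verts E) \<phi> w)"]) simp
  next
    fix y assume "y \<in> vertex_span F B qF"
    then obtain c where "y = (\<Oplus>\<^bsub>B\<^esub>w\<in>verts F. c w \<odot>\<^bsub>B\<^esub> qF w)" by (auto simp: vertex_span_def)
    then have "y = \<rho> (\<Oplus>\<^bsub>A\<^esub>v\<in>verts E. c (\<phi> v) \<odot>\<^bsub>A\<^esub> qE v)" by (simp add: im)
    then show "y \<in> \<rho> ` vertex_span E A qE"
      unfolding vertex_span_def by (intro image_eqI CollectI exI[of _ "\<lambda>v. c (\<phi> v)"]) simp_all
  qed
qed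

lemma intertwiner_if_digraph_iso:
  assumes A: "toeplitz A E qE tE" and B: "toeplitz B F qF tF" and iso: "digraph_iso E F"
  obtains \<rho> where "star_iso A B \<rho>" "intertwines_gauge E A qE tE F B qF tF \<rho>"
    "\<rho> ` vertex_span E A qE = vertex_span F B qF" "intertwines_gen_gauge E A qE tE F B qF tF \<rho>"
proof -
  interpret A: toeplitz A E qE tE by fact
  interpret B: toeplitz B F qF tF by fact
  obtain f where f: "pre_digraph.digraph_isomorphism E f" "F = app_iso f E" using iso by (auto simp: digraph_iso_def)
  define \<phi> where "\<phi> = iso_verts f"
  define \<psi> where "\<psi> = iso_arcs f"
  have \<phi>: "bij_betw \<phi> (verts E) (verts F)" and \<psi>: "bij_betw \<psi> (arcs E) (arcs F)"
    using f by (auto simp: pre_digraph.digraph_isomorphism_def \<phi>_def \<psi>_def bij_betw_def)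
  have ends: "tail F (\<psi> e) = \<phi> (tail E e)" "head F (\<psi> e) = \<phi> (head E e)" if "e \<in> arcs E" for e
    using f that by (auto simp: pre_digraph.digraph_isomorphism_def \<phi>_def \<psi>_def)
  obtain \<rho> where \<rho>: "star_iso A B \<rho>" "\<And>v. v \<in> verts E \<Longrightarrow> \<rho> (qE v) = qF (\<phi> v)" "\<And>e. e \<in> arcs E \<Longrightarrow> \<rho> (tE e) = tF (\<psi> e)"
    by (rule star_iso_if_graph_iso[OF A B \<phi> \<psi> ends], assumption+, rule that)
  interpret toeplitz_iso A E qE tE B F qF tF \<rho> by unfold_locales (rule \<rho>(1))
  have \<phi>F: "\<phi> v \<in> verts F" if "v \<in> verts E" for v using \<phi> that by (auto simp: bij_betw_def)
  have \<psi>F: "\<psi> e \<in> arcs F" if "e \<in> arcs E" for e using \<psi> that by (auto simp: bij_betw_def)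
  have scaling: "\<rho> (scaling_automorphism E A qE tE c x) = scaling_automorphism F B qF tF d (\<rho> x)"
    if "\<And>e. e \<in> arcs E \<Longrightarrow> cmod (c e) = 1" "\<And>f. f \<in> arcs F \<Longrightarrow> cmod (d f) = 1"
      "\<And>e. e \<in> arcs E \<Longrightarrow> d (\<psi> e) = c e" "x \<in> carrier A" for c d x
    using intertwines_scaling[of \<phi> \<psi> c d x] \<rho>(2,3) \<phi>F \<psi>F that by blast
  have "intertwines_gauge E A qE tE F B qF tF \<rho>"
    unfolding intertwines_gauge_def gauge_action_def circle_def by (auto intro!: scaling)
  moreover have "intertwines_gen_gauge E A qE tE F B qF tF \<rho>"
    unfolding intertwines_gen_gauge_def gen_gauge_action_def
  proof (intro exI[of _ \<phi>] conjI ballI \<phi>)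
    fix z x assume z: "z \<in> verts E \<rightarrow>\<^sub>E circle" and x: "x \<in> carrier A"
    have zc: "cmod (z v) = 1" if "v \<in> verts E" for v using z that by (auto simp: circle_def PiE_iff)
    have inv: "inv_into (verts E) \<phi> w \<in> verts E" if "w \<in> verts F" for w
      using \<phi> that by (auto simp: bij_betw_def inv_into_into)
    have inv': "inv_into (verts E) \<phi> (\<phi> v) = v" if "v \<in> verts E" for v using \<phi> that by (auto simp: bij_betw_def)
    show "\<rho> (scaling_automorphism E A qE tE (\<lambda>e. z (tail E e)) x) =
        scaling_automorphism F B qF tF (\<lambda>e. induced_torus_map E F \<phi> z (tail F e)) (\<rho> x)"
      by (rule scaling[OF _ _ _ x]) (auto simp: zc inv inv' induced_torus_map_def ends \<phi>F)
  qed
  ultimately show ?thesis using that \<rho>(1) vertex_span_image[OF \<phi> \<rho>(2)] by blast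
qed

theorem theorem3:
  fixes E :: "('v, 'e) pre_digraph" and F :: "('w, 'f) pre_digraph"
    and A :: "'a cstar" and qE :: "'v \<Rightarrow> 'a" and tE :: "'e \<Rightarrow> 'a"
    and B :: "'b cstar" and qF :: "'w \<Rightarrow> 'b" and tF :: "'f \<Rightarrow> 'b"
  assumes "fin_digraph E" and "fin_digraph F"
    and "toeplitz_algebra E A qE tE" and "toeplitz_algebra F B qF tF"
  shows "((\<exists>\<rho>. star_iso A B \<rho> \<and> intertwines_gauge E A qE tE F B qF tF \<rho> \<and>
              \<rho> ` vertex_span E A qE = vertex_span F B qF)
            \<longleftrightarrow> digraph_iso E F) \<and>
         (no_sinks E \<and> no_sinks F \<longrightarrow>
            ((\<exists>\<rho>. star_iso A B \<rho> \<and> intertwines_gen_gauge E A qE tE F B qF tF \<rho>)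
              \<longleftrightarrow> digraph_iso E F))"
proof -
  have A: "toeplitz A E qE tE" and B: "toeplitz B F qF tF"
    using assms by (auto simp: toeplitz_def toeplitz_axioms_def toeplitz_algebra_def)
  have iso: "toeplitz_iso A E qE tE B F qF tF \<rho>" if "star_iso A B \<rho>" for \<rho>
    using A B that by (simp add: toeplitz_iso_def toeplitz_iso_axioms_def)
  have "digraph_iso E F" if "star_iso A B \<rho>" "intertwines_gauge E A qE tE F B qF tF \<rho>"
    "\<rho> ` vertex_span E A qE = vertex_span F B qF" for \<rho>
    by (rule toeplitz_iso.digraph_iso_if_gauge_and_vertex_span[OF iso[OF that(1)] that(2,3)])
  moreover have "digraph_iso E F" if "star_iso A B \<rho>" "intertwines_gen_gauge E A qE tE F B qF tF \<rho>"
    "no_sinks E" "no_sinks F" for \<rho>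
    by (rule toeplitz_iso.digraph_iso_if_gen_gauge[OF iso[OF that(1)] that(2-4)])
  \<comment> \<open>The isomorphism induced by a graph isomorphism has all the required properties
    at once, so one construction settles this direction of both equivalences.\<close>
  moreover have "\<exists>\<rho>. star_iso A B \<rho> \<and> intertwines_gauge E A qE tE F B qF tF \<rho> \<and>
      \<rho> ` vertex_span E A qE = vertex_span F B qF \<and> intertwines_gen_gauge E A qE tE F B qF tF \<rho>"
    if "digraph_iso E F"
    by (rule intertwiner_if_digraph_iso[OF A B that]) blast
  ultimately show ?thesis by blast
qed

end
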